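(* The saturated cluster modular group $\widehat{\Gamma}_{X_6}$ is generated by the five elements $\alpha_1,\alpha_2,\beta_1,\beta_2,\sigma$, and a complete set of relations among them (that is, a presentation of $\widehat{\Gamma}_{X_6}$) is given by $$\sigma^2=1,\qquad \alpha_2=\sigma\alpha_1\sigma^{-1},\qquad \beta_2=\sigma\beta_1\sigma^{-1},$$ $$\alpha_1\alpha_2=\alpha_2\alpha_1,\qquad \beta_1^{-1}\alpha_2\beta_1=\alpha_1,\qquad (\beta_2\beta_1^{-1})^2=1,$$ $$(\alpha_2\beta_2\beta_1^{-1}\alpha_1^{-1})^3=1,\qquad \beta_2(\beta_1\alpha_1)^{-1}\beta_2=\operatorname{Ad}_{\alpha_2\beta_1}\sigma,\qquad \beta_1=\alpha_1(\beta_1\alpha_2\beta_1^{-1})\alpha_2^{-1}\sigma^{-1},$$ where $\operatorname{Ad}_x y:=xyx^{-1}$.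
   Context: Matrices and mutations. Let $I$ be a finite set (no frozen vertices here) and $\varepsilon=(\varepsilon_{ij})_{i,j\in I}$ an integer skew-symmetric matrix (exchange matrix), identified with the quiver with vertex set $I$ and $\varepsilon_{ij}$ arrows $i\to j$ whenever $\varepsilon_{ij}>0$. For $k\in I$, the mutation $\mu_k(\varepsilon)=\varepsilon'$ is $\varepsilon'_{ij}=-\varepsilon_{ij}$ if $k\in\{i,j\}$, and $\varepsilon'_{ij}=\varepsilon_{ij}+\frac12(|\varepsilon_{ik}|\varepsilon_{kj}+\varepsilon_{ik}|\varepsilon_{kj}|)$ otherwise. A permutation $\sigma$ of $I$ acts by $\sigma(\varepsilon)_{ij}=\varepsilon_{\sigma^{-1}(i),\sigma^{-1}(j)}$. A mutation sequence is a finite composition of mutations and permutations, applied from right to left; it is a mutation loop at $\varepsilon$ if it sends $\varepsilon$ to $\varepsilon$. Saturated cluster modular group. $\widehat{\Gamma}_\varepsilon$ is the group (under composition) of mutation loops with initial exchange matrix $\varepsilon$, modulo the equivalence relation generated by: (1) $\mu_k\mu_k=1$; (2) $\sigma\mu_k\sigma^{-1}=\mu_{\sigma(k)}$ for permutations $\sigma$; (3) the standard relations, applicable at any stage of a sequence to the current matrix $\varepsilon'$: $\mu_i\mu_j=\mu_j\mu_i$ if $\varepsilon'_{ij}=0$, and $\mu_i\mu_j\mu_i\mu_j\mu_i=(i\ j)$ if $\varepsilon'_{ij}=\pm1$. Permutations compose as usual (right to left). Type $X_6$. $I=\{1,\dots,6\}$, and the quiver $X_6$ has one arrow $1\to2$,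 two arrows $2\to3$, one arrow $3\to1$, one arrow $1\to4$, two arrows $4\to5$, one arrow $5\to1$, one arrow $1\to6$, and no other arrows. $\widehat{\Gamma}_{X_6}$ is the saturated cluster modular group based at this quiver. Elements. $\sigma=(2\ 4)(3\ 5)$, $\alpha_1=(2\ 3)\mu_2$, $\beta_1=(1\ 5\ 2\ 6\ 3\ 4)\mu_4\mu_2\mu_4\mu_3\mu_1$, $\alpha_2=\sigma\alpha_1\sigma^{-1}$, $\beta_2=\sigma\beta_1\sigma^{-1}$, where $(a\ b\ c\ \cdots)$ denotes the cycle $a\mapsto b\mapsto c\mapsto\cdots$. *)

theory Defs
  imports "HOL-Algebra.Generated_Groups" "HOL-Combinatorics.Cycles"
begin

section \<open>Words modulo a congruence\<close>

text \<open>
  \<open>L\<close> is a set of words closed under concatenation, \<open>r\<close> a congruence on it; the product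
  of two classes is the class of the concatenation of representatives.
\<close>

definition word_quotient :: "'a list set \<Rightarrow> ('a list \<times> 'a list) set \<Rightarrow> 'a list set monoid" where
  "word_quotient L r =
     \<lparr>carrier = L // r, monoid.mult = (\<lambda>A B. \<Union>a\<in>A. \<Union>b\<in>B. r `` {a @ b}), one = r `` {[]}\<rparr>"


section \<open>Group presentations\<close>

text \<open>
  A letter \<open>(x, True)\<close> stands for the generator \<open>x\<close>, the letter \<open>(x, False)\<close> for its inverse.
  A relation \<open>l = r\<close> is the pair of words \<open>(l, r)\<close>.
\<close>

type_synonym 'g gword = "('g \<times> bool) list"

definition gw :: "'g \<Rightarrow> 'g gword" where
  "gw x = [(x, True)]"

definition gw_inv :: "'g gword \<Rightarrow> 'g gword" where
  "gw_inv w = rev (map (\<lambda>(x, b). (x, \<not> b)) w)"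

definition gw_Ad :: "'g gword \<Rightarrow> 'g gword \<Rightarrow> 'g gword" where
  "gw_Ad x y = x @ y @ gw_inv x"

inductive pres_step :: "('g gword \<times> 'g gword) set \<Rightarrow> 'g gword \<Rightarrow> 'g gword \<Rightarrow> bool" for R where
  cancel: "pres_step R (u @ [(x, b), (x, \<not> b)] @ v) (u @ v)"
| relation: "(l, r) \<in> R \<Longrightarrow> pres_step R (u @ l @ v) (u @ r @ v)"

definition pres_equiv :: "('g gword \<times> 'g gword) set \<Rightarrow> ('g gword \<times> 'g gword) set" where
  "pres_equiv R = {(u, v). equivclp (pres_step R) u v}"

definition presented_group :: "('g gword \<times> 'g gword) set \<Rightarrow> 'g gword set monoid" where
  "presented_group R = word_quotient UNIV (pres_equiv R)"

text \<open>The generators of the presentation are all elements of the type \<open>'g\<close>.\<close>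

definition has_presentation ::
    "('a, 'm) monoid_scheme \<Rightarrow> ('g \<Rightarrow> 'a) \<Rightarrow> ('g gword \<times> 'g gword) set \<Rightarrow> bool" where
  "has_presentation G g R \<longleftrightarrow>
     group G \<and> (\<exists>h \<in> iso (presented_group R) G. \<forall>x. h (pres_equiv R `` {gw x}) = g x)"


section \<open>Exchange matrices and mutation sequences\<close>

text \<open>
  Matrices indexed by a finite set \<open>I\<close> are functions vanishing outside \<open>I \<times> I\<close>, so that
  equality of functions is equality of matrices. Mutations at \<open>k \<in> I\<close> and permutations of
  \<open>I\<close> preserve this.
\<close>

type_synonym 'i matrix = "'i \<Rightarrow> 'i \<Rightarrow> int"

definition exchange_matrix :: "'i set \<Rightarrow> 'i matrix \<Rightarrow> bool" where
  "exchange_matrix I \<epsilon> \<longleftrightarrow>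
     finite I \<and> (\<forall>i j. \<epsilon> j i = - \<epsilon> i j) \<and> (\<forall>i j. \<epsilon> i j \<noteq> 0 \<longrightarrow> i \<in> I \<and> j \<in> I)"

text \<open>The division by 2 is exact, as \<open>\<bar>a\<bar> * b + a * \<bar>b\<bar>\<close> is 0 or \<open>\<plusminus> 2 * a * b\<close>.\<close>

definition mutate :: "'i \<Rightarrow> 'i matrix \<Rightarrow> 'i matrix" where
  "mutate k \<epsilon> = (\<lambda>i j. if k = i \<or> k = j then - \<epsilon> i j
     else \<epsilon> i j + (\<bar>\<epsilon> i k\<bar> * \<epsilon> k j + \<epsilon> i k * \<bar>\<epsilon> k j\<bar>) div 2)"

definition permute_matrix :: "('i \<Rightarrow> 'i) \<Rightarrow> 'i matrix \<Rightarrow> 'i matrix" where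
  "permute_matrix \<sigma> \<epsilon> = (\<lambda>i j. \<epsilon> (inv_into UNIV \<sigma> i) (inv_into UNIV \<sigma> j))"

datatype 'i letter = Mut 'i | Perm "'i \<Rightarrow> 'i"

fun apply_letter :: "'i letter \<Rightarrow> 'i matrix \<Rightarrow> 'i matrix" where
  "apply_letter (Mut k) \<epsilon> = mutate k \<epsilon>"
| "apply_letter (Perm \<sigma>) \<epsilon> = permute_matrix \<sigma> \<epsilon>"

text \<open>The last letter of the list is applied first.\<close>

definition apply_seq :: "'i letter list \<Rightarrow> 'i matrix \<Rightarrow> 'i matrix" where
  "apply_seq w \<epsilon> = foldr apply_letter w \<epsilon>"

definition letters :: "'i set \<Rightarrow> 'i letter set" where
  "letters I = Mut ` I \<union> Perm ` {\<sigma>. \<sigma> permutes I}"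

definition mutation_seqs :: "'i set \<Rightarrow> 'i letter list set" where
  "mutation_seqs I = lists (letters I)"

definition mutation_loops :: "'i set \<Rightarrow> 'i matrix \<Rightarrow> 'i letter list set" where
  "mutation_loops I \<epsilon> = {w \<in> mutation_seqs I. apply_seq w \<epsilon> = \<epsilon>}"


section \<open>The saturated cluster modular group\<close>

text \<open>
  \<open>basic_relation I \<epsilon>\<close> lists the relations available when the current matrix is \<open>\<epsilon>\<close>. The first
  two say that permutations in a mutation sequence compose as usual.
\<close>

inductive basic_relation :: "'i set \<Rightarrow> 'i matrix \<Rightarrow> 'i letter list \<Rightarrow> 'i letter list \<Rightarrow> bool"
  for I \<epsilon> where
  perm_id: "basic_relation I \<epsilon> [Perm id] []"
| perm_comp: "\<sigma> permutes I \<Longrightarrow> \<tau> permutes I \<Longrightarrow>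
    basic_relation I \<epsilon> [Perm \<sigma>, Perm \<tau>] [Perm (\<sigma> \<circ> \<tau>)]"
| involution: "k \<in> I \<Longrightarrow> basic_relation I \<epsilon> [Mut k, Mut k] []"
| conjugation: "\<sigma> permutes I \<Longrightarrow> k \<in> I \<Longrightarrow>
    basic_relation I \<epsilon> [Perm \<sigma>, Mut k, Perm (inv_into UNIV \<sigma>)] [Mut (\<sigma> k)]"
| square: "i \<in> I \<Longrightarrow> j \<in> I \<Longrightarrow> \<epsilon> i j = 0 \<Longrightarrow>
    basic_relation I \<epsilon> [Mut i, Mut j] [Mut j, Mut i]"
| pentagon: "i \<in> I \<Longrightarrow> j \<in> I \<Longrightarrow> \<epsilon> i j = 1 \<or> \<epsilon> i j = - 1 \<Longrightarrow>
    basic_relation I \<epsilon> [Mut i, Mut j, Mut i, Mut j, Mut i] [Perm (transpose i j)]"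

inductive seq_step :: "'i set \<Rightarrow> 'i matrix \<Rightarrow> 'i letter list \<Rightarrow> 'i letter list \<Rightarrow> bool"
  for I \<epsilon> where
  "u \<in> mutation_seqs I \<Longrightarrow> v \<in> mutation_seqs I \<Longrightarrow> basic_relation I (apply_seq v \<epsilon>) l r \<Longrightarrow>
     seq_step I \<epsilon> (u @ l @ v) (u @ r @ v)"

definition loop_equiv :: "'i set \<Rightarrow> 'i matrix \<Rightarrow> ('i letter list \<times> 'i letter list) set" where
  "loop_equiv I \<epsilon> =
     {(u, v). u \<in> mutation_loops I \<epsilon> \<and> v \<in> mutation_loops I \<epsilon> \<and> equivclp (seq_step I \<epsilon>) u v}"

definition saturated_cmg :: "'i set \<Rightarrow> 'i matrix \<Rightarrow> 'i letter list set monoid" where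
  "saturated_cmg I \<epsilon> = word_quotient (mutation_loops I \<epsilon>) (loop_equiv I \<epsilon>)"


section \<open>Type \<open>X\<^sub>6\<close>\<close>

definition X6_vertices :: "nat set" where
  "X6_vertices = {1..6}"

definition X6_arrows :: "nat \<Rightarrow> nat \<Rightarrow> nat" where
  "X6_arrows i j =
     (if (i, j) \<in> {(1, 2), (3, 1), (1, 4), (5, 1), (1, 6)} then 1
      else if (i, j) \<in> {(2, 3), (4, 5)} then 2 else 0)"

definition X6 :: "nat matrix" where
  "X6 i j = int (X6_arrows i j) - int (X6_arrows j i)"

lemma exchange_matrix_X6: "exchange_matrix X6_vertices X6"
  by (auto simp: exchange_matrix_def X6_vertices_def X6_def X6_arrows_def split: if_splits)

abbreviation Gamma_X6 :: "nat letter list set monoid" where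
  "Gamma_X6 \<equiv> saturated_cmg X6_vertices X6"

definition sigma_seq :: "nat letter list" where
  "sigma_seq = [Perm (cycle_of_list [2, 4] \<circ> cycle_of_list [3, 5])]"

definition sigma_inv_seq :: "nat letter list" where
  "sigma_inv_seq = [Perm (inv_into UNIV (cycle_of_list [2, 4] \<circ> cycle_of_list [3, 5]))]"

definition alpha1_seq :: "nat letter list" where
  "alpha1_seq = [Perm (cycle_of_list [2, 3]), Mut 2]"

definition beta1_seq :: "nat letter list" where
  "beta1_seq = [Perm (cycle_of_list [1, 5, 2, 6, 3, 4]), Mut 4, Mut 2, Mut 4, Mut 3, Mut 1]"

definition alpha2_seq :: "nat letter list" where
  "alpha2_seq = sigma_seq @ alpha1_seq @ sigma_inv_seq"

definition beta2_seq :: "nat letter list" where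
  "beta2_seq = sigma_seq @ beta1_seq @ sigma_inv_seq"

datatype X6_gen = Gen_alpha1 | Gen_alpha2 | Gen_beta1 | Gen_beta2 | Gen_sigma

fun X6_gen_seq :: "X6_gen \<Rightarrow> nat letter list" where
  "X6_gen_seq Gen_alpha1 = alpha1_seq"
| "X6_gen_seq Gen_alpha2 = alpha2_seq"
| "X6_gen_seq Gen_beta1 = beta1_seq"
| "X6_gen_seq Gen_beta2 = beta2_seq"
| "X6_gen_seq Gen_sigma = sigma_seq"

definition X6_elem :: "X6_gen \<Rightarrow> nat letter list set" where
  "X6_elem x = loop_equiv X6_vertices X6 `` {X6_gen_seq x}"

definition X6_relations :: "(X6_gen gword \<times> X6_gen gword) set" where
  "X6_relations =
    (let a1 = gw Gen_alpha1; a2 = gw Gen_alpha2; b1 = gw Gen_beta1; b2 = gw Gen_beta2; s = gw Gen_sigma in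
     {(s @ s, []),
      (a2, s @ a1 @ gw_inv s),
      (b2, s @ b1 @ gw_inv s),
      (a1 @ a2, a2 @ a1),
      (gw_inv b1 @ a2 @ b1, a1),
      (concat (replicate 2 (b2 @ gw_inv b1)), []),
      (concat (replicate 3 (a2 @ b2 @ gw_inv b1 @ gw_inv a1)), []),
      (b2 @ gw_inv (b1 @ a1) @ b2, gw_Ad (a2 @ b1) s),
      (b1, a1 @ (b1 @ a2 @ gw_inv b1) @ gw_inv a2 @ gw_inv s)})"

end

theory Submission
  imports Defs
begin

text \<open>
  The cluster modular group is the vertex group at \<open>X6\<close> of a groupoid: its objects are the exchange
  matrices that mutations and permutations reach from \<open>X6\<close>, its generators are the mutations and the
  permutations, and its relations are local, that is, each can be read off a single matrix. Up to
  relabelling there are only five such matrices, the quivers 0 to 4, where quiver 0 is \<open>X6\<close>. After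
  division by the permutations the groupoid becomes finite: five objects, thirty edges (a quiver and
  a vertex at which it is mutated), automorphism groups of orders 2, 2, 2, 2 and 6, and one relation
  for each involution, square, pentagon and naturality square of an automorphism. Contracting a
  spanning tree turns this into a finite presentation of the group by the elements that belong to the
  edges and to the automorphisms.

  All these elements are words in three of them: \<open>a\<close>, which is \<open>\<alpha>\<^sub>1\<close>, the swap \<open>s\<close>, which is
  \<open>\<sigma>\<close>, and \<open>x = \<sigma> \<beta>\<^sub>1 \<alpha>\<^sub>1\<close>. Substituting the words into the local relations leaves, up to
  conjugation and inversion, eight words, and these are trivial in every group in which the relations
  \<open>axs_relations\<close> between \<open>a\<close>, \<open>x\<close> and \<open>s\<close> hold. An elementary calculation
  (\<open>axs_relations_if_X6_relations\<close> and \<open>X6_relations_if_axs_relations\<close>) shows that these relations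
  are equivalent to the nine relations of the theorem.

  The proof uses the groupoid in both directions. In a group with elements \<open>a\<close>, \<open>x\<close>, \<open>s\<close> that
  satisfy \<open>axs_relations\<close>, the product of the words along a mutation loop depends only on the class
  of the loop, because the finitely many local relations have been checked (\<open>local_correct\<close>,
  \<open>groupoid_correct\<close>, \<open>same_state_seq_eq\<close>); applied to the presented group, this shows that no
  further relations hold between the five generators. In the cluster modular group itself the local
  relations hold for the classes of the loops that run through the tree to an edge, across it, and
  back (\<open>relation_in_gamma\<close>); solving them one after the other expresses every edge by \<open>a\<close>, \<open>x\<close>
  and \<open>s\<close> and yields \<open>axs_relations\<close> (\<open>edge_values\<close>). Hence the nine relations hold, and since
  every loop is the product of the edges that it passes (\<open>transport_edge_elt\<close>), the five elements
  generate.
\<close>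

section \<open>Groups as a type class\<close>

text \<open>
  A type class keeps calculations with long products free of carrier conditions. Both the cluster
  modular group and the presented group become instances.
\<close>

class mult_group = monoid_mult +
  fixes ginv :: "'a \<Rightarrow> 'a"
  assumes ginv_left [simp]: "ginv x * x = 1"
begin

lemma ginv_left_cancel [simp]: "ginv x * (x * y) = y"
  by (simp flip: mult.assoc)

lemma ginv_right [simp]: "x * ginv x = 1"
  by (metis ginv_left ginv_left_cancel mult_1_right)

lemma ginv_right_cancel [simp]: "x * (ginv x * y) = y"
  by (simp flip: mult.assoc)

lemma mult_left_cancel_group [simp]: "x * y = x * z \<longleftrightarrow> y = z"
  by (metis ginv_left_cancel)

lemma mult_right_cancel_group [simp]: "y * x = z * x \<longleftrightarrow> y = z"
  by (metis ginv_right mult.assoc mult_1_right)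

lemma ginv_unique: "x * y = 1 \<Longrightarrow> ginv x = y"
  by (metis ginv_left_cancel mult_1_right)

lemma ginv_one [simp]: "ginv 1 = 1"
  by (rule ginv_unique) simp

lemma ginv_ginv [simp]: "ginv (ginv x) = x"
  by (rule ginv_unique) simp

lemma ginv_mult [simp]: "ginv (x * y) = ginv y * ginv x"
  by (rule ginv_unique) (simp add: mult.assoc)

lemma eq_one_iff_ginv: "ginv x = 1 \<longleftrightarrow> x = 1"
  by (metis ginv_ginv ginv_one)

lemma conj_eq_one_iff: "x * y = 1 \<longleftrightarrow> y * x = 1"
  by (metis ginv_unique ginv_left ginv_right)

lemma eq_iff_mult_ginv: "x = y \<longleftrightarrow> x * ginv y = 1"
  by (metis ginv_left ginv_right_cancel ginv_unique mult_1_right ginv_ginv)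

lemma commute_ginv: "x * y = y * x \<Longrightarrow> ginv x * y = y * ginv x"
  by (metis ginv_left_cancel ginv_right mult.assoc mult_1_right)

end

section \<open>Two equivalent sets of relations\<close>

text \<open>
  A prime stands for conjugation by the involution \<open>s\<close>. The relation \<open>x x' = x' x\<close> makes the subgroup
  generated by \<open>s\<close> and \<open>x\<^bsup>-1\<^esup> s x\<close> stable under conjugation by \<open>x\<close>, and \<open>x\<^sup>3 = x'\<^sup>3\<close> makes the
  product of these two involutions have order dividing 3: together they give the automorphism group of
  quiver 4. In terms of the generators of the theorem, \<open>a = \<alpha>\<^sub>1\<close>, \<open>s = \<sigma>\<close> and
  \<open>x = \<sigma> \<beta>\<^sub>1 \<alpha>\<^sub>1\<close>.
\<close>

definition axs_relations :: "'a::mult_group \<Rightarrow> 'a \<Rightarrow> 'a \<Rightarrow> bool" where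
  "axs_relations a x s \<longleftrightarrow>
     (let a' = s * a * s; x' = s * x * s in
      s * s = 1 \<and> a * x = x * a \<and> a * a' = a' * a \<and> x * x' = x' * x \<and>
      x * x * x = x' * x' * x' \<and> a * x' * a = x' * x' \<and>
      (ginv a * s * a) * (ginv x * s * x) = (ginv x * s * x) * (ginv a * s * a))"

definition X6_relations_hold :: "'a::mult_group \<Rightarrow> 'a \<Rightarrow> 'a \<Rightarrow> 'a \<Rightarrow> 'a \<Rightarrow> bool" where
  "X6_relations_hold a1 a2 b1 b2 s \<longleftrightarrow>
     s * s = 1 \<and> a2 = s * a1 * ginv s \<and> b2 = s * b1 * ginv s \<and>
     a1 * a2 = a2 * a1 \<and> ginv b1 * a2 * b1 = a1 \<and>
     (b2 * ginv b1) * (b2 * ginv b1) = 1 \<and>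
     (a2 * b2 * ginv b1 * ginv a1) * (a2 * b2 * ginv b1 * ginv a1) * (a2 * b2 * ginv b1 * ginv a1) = 1 \<and>
     b2 * ginv (b1 * a1) * b2 = (a2 * b1) * s * ginv (a2 * b1) \<and>
     b1 = a1 * (b1 * a2 * ginv b1) * ginv a2 * ginv s"

lemma involution_conj:
  fixes s :: "'a::mult_group"
  assumes "s * s = 1"
  shows "s * s = 1" "ginv s = s" "s * (s * y) = y"
  using assms by (auto simp: ginv_unique simp flip: mult.assoc)


text \<open>
  Oriented as rewrite rules, these move \<open>u\<close> and its inverse to the left of \<open>v\<close> and its inverse.
\<close>

lemma commute_rules:
  fixes u v :: "'a::mult_group"
  assumes "u * v = v * u"
  shows "v * u = u * v" "v * (u * z) = u * (v * z)"
    "ginv v * u = u * ginv v" "ginv v * (u * z) = u * (ginv v * z)"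
    "v * ginv u = ginv u * v" "v * (ginv u * z) = ginv u * (v * z)"
    "ginv v * ginv u = ginv u * ginv v" "ginv v * (ginv u * z) = ginv u * (ginv v * z)"
proof -
  note c = assms commute_ginv[OF assms] commute_ginv[OF assms[symmetric]] commute_ginv[OF commute_ginv[OF assms[symmetric]]]
  show "v * u = u * v" "ginv v * u = u * ginv v" "v * ginv u = ginv u * v" "ginv v * ginv u = ginv u * ginv v"
    using commute_ginv[OF assms] commute_ginv[OF assms[symmetric]] assms
    by (simp_all flip: ginv_mult)
  then show "v * (u * z) = u * (v * z)" "ginv v * (u * z) = u * (ginv v * z)"
    "v * (ginv u * z) = ginv u * (v * z)" "ginv v * (ginv u * z) = ginv u * (ginv v * z)"
    by (simp_all flip: mult.assoc)
qed

text \<open>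
  With \<open>\<beta>\<^sub>1 = s d\<close> and \<open>x = d a\<close> the fifth relation of the theorem says that \<open>d\<close> commutes with
  \<open>a\<close>, the sixth that \<open>d d'\<^bsup>-1\<^esup>\<close> is an involution, and the ninth that \<open>a d' a = x' d'\<close>. On this common
  ground the eighth relation turns out to be \<open>x x' = x' x\<close>, and the seventh \<open>x\<^sup>3 = x'\<^sup>3\<close>.
\<close>

context
  fixes a d x s a' d' x' :: "'a::mult_group"
  assumes s2: "s * s = 1" and ad: "a * d = d * a" and x: "x = d * a"
    and a': "a' = s * a * s" and d': "d' = s * d * s" and x': "x' = s * x * s"
    and aa': "a * a' = a' * a"
    and dd': "(d * ginv d') * (d * ginv d') = 1"
    and adx': "a * d' * a = x' * d'"
begin

lemmas s_involution = involution_conj[OF s2]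

lemma a'd': "a' * d' = d' * a'" and x'_eq: "x' = d' * a'"
  using ad by (simp_all add: a' d' x' x mult.assoc s_involution) (metis mult.assoc)

text \<open>
  The elements \<open>d\<close> and \<open>d'\<close> differ by the involution \<open>w\<close>. Since \<open>d'\<close> commutes with \<open>x'\<close>, conjugation
  of \<open>x'\<close> by \<open>d\<close> is conjugation by \<open>w\<close>, and the ninth relation, conjugated by \<open>s\<close>, becomes a
  formula for \<open>d\<^sup>2\<close> in terms of \<open>x\<close>, \<open>x'\<close> and \<open>w\<close>.
\<close>

lemma w_facts:
  defines "w \<equiv> ginv d' * d"
  shows "w * w = 1" "ginv w = w" "d = d' * w" "w * ginv d = ginv d'"
    "d * d * (w * ginv x' * w) = d * ginv x' * d"
    "x * (d * d) = x' * w * x' * w"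
proof -
  show 1: "w * w = 1"
  proof -
    have "ginv d' * ((d * ginv d') * (d * ginv d')) * d' = 1" unfolding dd' by simp
    then show ?thesis by (simp add: w_def mult.assoc)
  qed
  show 2: "ginv w = w" using 1 by (simp add: ginv_unique)
  show 3: "d = d' * w" by (simp add: w_def)
  show 4: "w * ginv d = ginv d'" by (simp add: w_def mult.assoc)
  have c: "d' * x' = x' * d'" by (simp add: x'_eq mult.assoc a'd')
  have c': "ginv d' * ginv x' * d' = ginv x'" by (simp add: mult.assoc commute_rules[OF c])
  have "ginv d * ginv x' * d = ginv w * (ginv d' * ginv x' * d') * w" by (subst (1 2) 3) (simp add: mult.assoc)
  then have e: "ginv d * ginv x' * d = w * ginv x' * w" using c' 2 by simp
  show "d * d * (w * ginv x' * w) = d * ginv x' * d"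
    unfolding e[symmetric] by (simp add: mult.assoc)
  have "a' * d * a' = x * d"
  proof -
    have "s * (a * d' * a) * s = s * (x' * d') * s" using adx' by simp
    then show ?thesis by (simp add: a' d' x' mult.assoc s_involution)
  qed
  moreover have "x' * ginv d' = a'" by (simp add: x'_eq mult.assoc flip: a'd')
  ultimately have "x * d = (x' * ginv d') * d * (x' * ginv d')" by simp
  then have "x * d = x' * w * x' * ginv d'" by (simp add: w_def mult.assoc)
  then have "x * d * d = x' * w * x' * (w * ginv d) * d" using 4 by simp
  then show "x * (d * d) = x' * w * x' * w" by (simp add: mult.assoc)
qed

text \<open>
  The left-hand side is the eighth relation after cancellation of \<open>s\<close>. By the formula for \<open>d\<^sup>2\<close> the
  element \<open>d x'\<^bsup>-1\<^esup> d\<close> always equals \<open>x\<^bsup>-1\<^esup> x'\<close>.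
\<close>

lemma d_x_d_iff_commute: "d * ginv x' * d = x' * ginv x \<longleftrightarrow> x * x' = x' * x"
proof -
  define w where "w = ginv d' * d"
  note w = w_facts[folded w_def]
  have "d * ginv x' * d = ginv x * (x * (d * d)) * (w * ginv x' * w)"
    using w(5) by (simp add: mult.assoc)
  also have "\<dots> = ginv x * x'" unfolding w(6) by (simp add: mult.assoc involution_conj[OF w(1)])
  finally have "d * ginv x' * d = ginv x * x'" .
  moreover have "ginv x * x' = x' * ginv x \<longleftrightarrow> x * x' = x' * x"
    using commute_ginv[of x x'] commute_ginv[of "ginv x" x'] by auto
  ultimately show ?thesis by simp
qed

text \<open>
  The element whose cube is trivial by the seventh relation is conjugate to \<open>x\<^bsup>-1\<^esup> x'\<close>.
\<close>

lemma order_three_conj: "a' * d * ginv d' * ginv a = (a * d) * (ginv x * x') * ginv (a * d)"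
proof -
  define w' where "w' = d * ginv d'"
  have 1: "ginv w' = w'" using dd' by (intro ginv_unique) (simp add: w'_def)
  have "d' * x' = x' * d'" by (simp add: x'_eq mult.assoc a'd')
  from commute_rules(2)[OF this[symmetric]] commute_rules(1)[OF this] have c: "ginv d' * x' * d' = x'"
    by (simp add: mult.assoc)
  have "d * x' * ginv d = d * (ginv d' * x' * d') * ginv d" using c by simp
  also have "\<dots> = w' * x' * ginv w'" by (simp add: w'_def mult.assoc)
  finally have "d * x' * ginv d = w' * x' * w'" using 1 by simp
  then have "d * x' * ginv d = d * (a' * d * ginv d')"
    by (simp add: w'_def mult.assoc x'_eq)
  then have "x' * ginv d = a' * d * ginv d'" by (simp add: mult.assoc)
  then have "a' * d * ginv d' * ginv a = x' * ginv d * ginv a" by simp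
  then show ?thesis by (simp add: x mult.assoc commute_rules[OF ad])
qed

lemma a_x_a: "a * x' * a = x' * x'"
  using adx' aa' x'_eq by (metis mult.assoc)

end

lemma square_iff:
  fixes p q :: "'a::mult_group"
  assumes "p * p = 1" "q * q = 1"
  shows "p * q * (p * q) = 1 \<longleftrightarrow> p * q = q * p"
proof -
  have "p * q * (p * q) = 1 \<longleftrightarrow> ginv (p * q) = p * q"
    by (metis ginv_unique ginv_right)
  then show ?thesis using assms by (auto simp: ginv_unique)
qed

lemma conj_commute:
  fixes p q :: "'a::mult_group"
  shows "(ginv g * p * g) * (ginv g * q * g) = (ginv g * q * g) * (ginv g * p * g) \<longleftrightarrow> p * q = q * p"
  by (simp add: mult.assoc) (simp flip: mult.assoc)

lemma conj_cube:
  fixes g h :: "'a::mult_group"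
  shows "(g * h * ginv g) * (g * h * ginv g) * (g * h * ginv g) = 1 \<longleftrightarrow> h * h * h = 1"
proof -
  have "(g * h * ginv g) * (g * h * ginv g) * (g * h * ginv g) = g * (h * h * h) * ginv g"
    by (simp add: mult.assoc)
  then show ?thesis by (metis ginv_right mult_1_right mult_left_cancel_group mult_right_cancel_group)
qed

lemma cube_quotient:
  fixes u v :: "'a::mult_group"
  assumes "u * v = v * u"
  shows "(ginv u * v) * (ginv u * v) * (ginv u * v) = 1 \<longleftrightarrow> u * u * u = v * v * v"
proof -
  have "(ginv u * v) * (ginv u * v) * (ginv u * v) = ginv (u * u * u) * (v * v * v)"
    by (simp add: mult.assoc commute_rules[OF assms])
  then show ?thesis by (metis ginv_left ginv_left_cancel mult_left_cancel_group)
qed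

text \<open>
  The last of the relations between \<open>a\<close>, \<open>x\<close>, \<open>s\<close> is the sixth relation of the theorem conjugated
  by \<open>x\<close>, because \<open>a\<^bsup>-1\<^esup> s a = x\<^bsup>-1\<^esup> (d s d\<^bsup>-1\<^esup>) x\<close>.
\<close>

theorem axs_relations_if_X6_relations:
  fixes a1 :: "'a::mult_group"
  assumes R: "X6_relations_hold a1 a2 b1 b2 s"
  shows "axs_relations a1 (s * b1 * a1) s"
proof -
  have R1: "s * s = 1" and R2: "a2 = s * a1 * ginv s" and R3: "b2 = s * b1 * ginv s"
    and R4: "a1 * a2 = a2 * a1" and R5: "ginv b1 * a2 * b1 = a1"
    and R6: "(b2 * ginv b1) * (b2 * ginv b1) = 1"
    and R7: "(a2 * b2 * ginv b1 * ginv a1) * (a2 * b2 * ginv b1 * ginv a1) * (a2 * b2 * ginv b1 * ginv a1) = 1"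
    and R8: "b2 * ginv (b1 * a1) * b2 = (a2 * b1) * s * ginv (a2 * b1)"
    and R9: "b1 = a1 * (b1 * a2 * ginv b1) * ginv a2 * ginv s"
    using R unfolding X6_relations_hold_def by blast+
  define a d x a' d' x' where defs: "a = a1" "d = s * b1" "x = d * a" "a' = s * a * s" "d' = s * d * s"
      "x' = s * x * s"
  note s2 = R1
  note ss = involution_conj[OF s2]
  have b1: "b1 = s * d" and b2: "b2 = d * s" and a2: "a2 = a'"
    using R2 R3 by (simp_all add: defs ss mult.assoc)
  have ad: "a * d = d * a"
  proof -
    have "ginv d * a * d = a" using R5 unfolding a2 b1 defs(4) by (simp add: mult.assoc ss defs(1))
    then show ?thesis by (metis mult.assoc ginv_right_cancel)
  qed
  have aa': "a * a' = a' * a" using R4 by (simp add: a2 defs(1))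
  have dd': "(d * ginv d') * (d * ginv d') = 1"
    using R6 by (simp add: b1 b2 mult.assoc ss defs(5))
  have adx': "a * d' * a = x' * d'"
  proof -
    have "b1 = a * (b1 * a' * ginv b1) * ginv a' * ginv s" using R9 by (simp add: a2 defs(1))
    then have "b1 * s * a' * b1 * s = a * (b1 * a' * ginv b1) * ginv a' * ginv s * s * a' * b1 * s" by simp
    then have "(s * d) * s * (s * a * s) * s * d * s = a * s * d * s * a"
      by (simp add: b1 defs(4) mult.assoc ss)
    then show ?thesis by (simp add: defs(3-) mult.assoc ss)
  qed
  note ctx = s2 ad defs(3-6) aa' dd' adx'
  have "b2 * ginv (b1 * a) * b2 = (a2 * b1) * s * ginv (a2 * b1)"
    using R8 by (simp add: defs(1))
  then have "d * ginv x' * d * s = x' * ginv x * s"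
    by (simp add: b1 b2 a2 defs(3-) mult.assoc ss ad)
  then have "d * ginv x' * d = x' * ginv x" by simp
  then have xx': "x * x' = x' * x" using d_x_d_iff_commute[OF ctx] by simp
  have "(a' * d * ginv d' * ginv a) * (a' * d * ginv d' * ginv a) * (a' * d * ginv d' * ginv a) = 1"
    using R7 by (simp add: b1 b2 a2 defs(5) mult.assoc ss flip: defs(1))
  then have "(ginv x * x') * (ginv x * x') * (ginv x * x') = 1"
    unfolding order_three_conj[OF ctx] conj_cube by simp
  then have x3: "x * x * x = x' * x' * x'"
    using cube_quotient[OF xx'] by blast
  have axa: "a * x' * a = x' * x'" by (rule a_x_a[OF ctx])
  have "(d * s * ginv d) * s = s * (d * s * ginv d)"
    using dd' square_iff[of "d * s * ginv d" s] by (simp add: defs(5) mult.assoc ss)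
  moreover have "ginv a * s * a = ginv x * (d * s * ginv d) * x" by (simp add: defs(3) mult.assoc)
  ultimately have "(ginv a * s * a) * (ginv x * s * x) = (ginv x * s * x) * (ginv a * s * a)"
    using conj_commute[of x "d * s * ginv d" s] by simp
  moreover have "a * x = x * a" using ad by (simp add: defs(3) flip: mult.assoc)
  moreover have "s * b1 * a1 = x" by (simp add: defs(1-3))
  ultimately show ?thesis using s2 aa' xx' x3 axa
    unfolding axs_relations_def Let_def by (simp only: defs(1)[symmetric] defs(4)[symmetric] defs(6)[symmetric])
qed

theorem X6_relations_if_axs_relations:
  fixes a :: "'a::mult_group"
  assumes P: "axs_relations a x s"
  shows "X6_relations_hold a (s * a * s) (s * x * ginv a) (x * ginv a * s) s"
proof -
  define d a' d' x' where defs: "d = x * ginv a" "a' = s * a * s" "d' = s * d * s" "x' = s * x * s"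
  have s2: "s * s = 1" and ax: "a * x = x * a" and aa': "a * a' = a' * a" and xx': "x * x' = x' * x"
    and x3: "x * x * x = x' * x' * x'" and axa: "a * x' * a = x' * x'"
    and asa: "(ginv a * s * a) * (ginv x * s * x) = (ginv x * s * x) * (ginv a * s * a)"
    using P unfolding axs_relations_def Let_def defs by blast+
  note ss = involution_conj[OF s2]
  have x: "x = d * a" by (simp add: defs mult.assoc)
  have ad: "a * d = d * a" by (simp add: defs(1) mult.assoc commute_rules[OF ax])
  have "ginv a * s * a = ginv x * (d * s * ginv d) * x" by (simp add: x mult.assoc)
  then have dsd: "(d * s * ginv d) * s = s * (d * s * ginv d)" using asa
    using conj_commute[of x "d * s * ginv d" s] by simp
  then have dd': "(d * ginv d') * (d * ginv d') = 1"
    using square_iff[of "d * s * ginv d" s] by (simp add: defs(3) mult.assoc ss)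
  have adx': "a * d' * a = x' * d'"
  proof -
    have d'a': "d' * a' = x'" by (simp add: defs(2-) mult.assoc ss x)
    have "a * d' * a * a' = x' * d' * a'"
    proof -
      have "a * d' * a * a' = a * (d' * a') * a" by (simp add: mult.assoc aa')
      also have "\<dots> = x' * d' * a'" using axa d'a' by (simp add: mult.assoc)
      finally show ?thesis .
    qed
    then show ?thesis by simp
  qed
  note ctx = s2 ad x defs(2-4) aa' dd' adx'
  have 8: "d * ginv x' * d = x' * ginv x" using d_x_d_iff_commute[OF ctx] xx' by simp
  have "(ginv x * x') * (ginv x * x') * (ginv x * x') = 1"
    using cube_quotient[OF xx'] x3 by blast
  then have 7: "(a' * d * ginv d' * ginv a) * (a' * d * ginv d' * ginv a) * (a' * d * ginv d' * ginv a) = 1"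
    unfolding order_three_conj[OF ctx] conj_cube by simp
  have b: "s * x * ginv a = s * d" "x * ginv a * s = d * s" by (simp_all add: defs mult.assoc)
  have 9: "s * d = a * (s * d * a' * ginv (s * d)) * ginv a' * ginv s"
  proof -
    have "(a * d' * a) * s * ginv d * ginv a = (x' * d') * s * ginv d * ginv a" using adx' by simp
    then show ?thesis by (simp add: defs(2-) mult.assoc ss x commute_rules[OF ad])
  qed
  have 88: "d * s * ginv (s * d * a) * (d * s) = (a' * (s * d)) * s * ginv (a' * (s * d))"
  proof -
    have "d * ginv x' * d * s = x' * ginv x * s" using 8 by simp
    then show ?thesis using ad by (simp add: defs(2-) mult.assoc ss x)
  qed
  show ?thesis unfolding b X6_relations_hold_def defs(2)[symmetric]
  proof (intro conjI)
    show "s * s = 1" by (rule s2)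
    show "a' = s * a * ginv s" by (simp add: defs(2) ss)
    show "d * s = s * (s * d) * ginv s" by (simp add: mult.assoc ss)
    show "a * a' = a' * a" by (rule aa')
    show "ginv (s * d) * a' * (s * d) = a" by (simp add: defs(2) mult.assoc ss commute_rules[OF ad])
    show "d * s * ginv (s * d) * (d * s * ginv (s * d)) = 1"
      using dd' by (simp add: defs(3) mult.assoc ss)
    show "a' * (d * s) * ginv (s * d) * ginv a * (a' * (d * s) * ginv (s * d) * ginv a) *
        (a' * (d * s) * ginv (s * d) * ginv a) = 1" using 7 by (simp add: defs(3) mult.assoc ss)
  qed (fact 88 9)+
qed

section \<open>Quotients of words\<close>

lemma word_quotient_mult:
  assumes "equiv L r" "a \<in> L" "b \<in> L"
    and cong: "\<And>a a' b b'. (a, a') \<in> r \<Longrightarrow> (b, b') \<in> r \<Longrightarrow> (a @ b, a' @ b') \<in> r"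
  shows "r `` {a} \<otimes>\<^bsub>word_quotient L r\<^esub> r `` {b} = r `` {a @ b}"
proof -
  have "r `` {a' @ b'} = r `` {a @ b}" if "a' \<in> r `` {a}" "b' \<in> r `` {b}" for a' b'
  proof -
    have "(a @ b, a' @ b') \<in> r" using that by (intro cong) auto
    then show ?thesis using equiv_class_eq[OF assms(1)] by blast
  qed
  moreover have "a \<in> r `` {a}" "b \<in> r `` {b}"
    using equiv_class_self[OF assms(1)] assms(2,3) by auto
  ultimately have "(\<Union>a'\<in>r `` {a}. \<Union>b'\<in>r `` {b}. r `` {a' @ b'}) = r `` {a @ b}"
    by (intro UN_constant_eq[of a] UN_constant_eq[of b] ballI)
  then show ?thesis by (simp add: word_quotient_def)
qed

lemma word_quotient_group:
  assumes eq: "equiv L r" and nil: "[] \<in> L"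
      and app: "\<And>a b. a \<in> L \<Longrightarrow> b \<in> L \<Longrightarrow> a @ b \<in> L"
    and cong: "\<And>a a' b b'. (a, a') \<in> r \<Longrightarrow> (b, b') \<in> r \<Longrightarrow> (a @ b, a' @ b') \<in> r"
    and inv: "\<And>a. a \<in> L \<Longrightarrow> \<exists>b \<in> L. (b @ a, []) \<in> r"
  shows "group (word_quotient L r)"
proof -
  note mult = word_quotient_mult[OF eq _ _ cong]
  have carr: "carrier (word_quotient L r) = L // r"
      and one: "\<one>\<^bsub>word_quotient L r\<^esub> = r `` {[]}"
    by (simp_all add: word_quotient_def)
  show ?thesis
  proof (rule groupI, unfold carr one)
    show "r `` {[]} \<in> L // r" using nil by (rule quotientI)
  next
    fix x y assume "x \<in> L // r" "y \<in> L // r"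
    then obtain a b where "a \<in> L" "x = r `` {a}" "b \<in> L" "y = r `` {b}" by (auto elim!: quotientE)
    then show "x \<otimes>\<^bsub>word_quotient L r\<^esub> y \<in> L // r" using mult app
        by (auto intro: quotientI)
  next
    fix x y z assume "x \<in> L // r" "y \<in> L // r" "z \<in> L // r"
    then obtain a b c where "a \<in> L" "x = r `` {a}" "b \<in> L" "y = r `` {b}" "c \<in> L" "z = r `` {c}"
      by (auto elim!: quotientE)
    then show "x \<otimes>\<^bsub>word_quotient L r\<^esub> y \<otimes>\<^bsub>word_quotient L r\<^esub> z = x \<otimes>\<^bsub>word_quotient L r\<^esub> (y \<otimes>\<^bsub>word_quotient L r\<^esub> z)"
      using mult app by simp
  next
    fix x assume "x \<in> L // r"
    then obtain a where "a \<in> L" "x = r `` {a}" by (auto elim!: quotientE)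
    then show "r `` {[]} \<otimes>\<^bsub>word_quotient L r\<^esub> x = x" using mult nil by simp
  next
    fix x assume "x \<in> L // r"
    then obtain a where a: "a \<in> L" "x = r `` {a}" by (auto elim!: quotientE)
    with inv obtain b where "b \<in> L" "(b @ a, []) \<in> r" by blast
    with a have "r `` {b} \<otimes>\<^bsub>word_quotient L r\<^esub> x = r `` {[]}"
      using mult equiv_class_eq[OF eq] by simp
    then show "\<exists>y \<in> L // r. y \<otimes>\<^bsub>word_quotient L r\<^esub> x = r `` {[]}"
      using \<open>b \<in> L\<close> quotientI by metis
  qed
qed

lemma equivclp_map:
  assumes "equivclp r x y" and "\<And>x y. r x y \<Longrightarrow> equivclp s (f x) (f y)"
  shows "equivclp s (f x) (f y)"
  using assms(1)
proof (induction rule: equivclp_induct)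
  case (step y z)
  have "equivclp s (f y) (f z)" using step(2) by (auto intro: assms(2) equivclp_sym[OF assms(2)])
  with step.IH show ?case by (rule equivclp_trans)
qed simp

lemma equivclp_invariant:
  assumes "equivclp r x y" and "\<And>x y. r x y \<Longrightarrow> f x = f y"
  shows "f x = f y"
  using assms(1)
proof (induction rule: equivclp_induct)
  case (step y z)
  have "f y = f z" using step(2) by (auto dest: assms(2))
  with step.IH show ?case by simp
qed simp


section \<open>Evaluating group words\<close>

primrec gletter :: "('g \<Rightarrow> 'h::mult_group) \<Rightarrow> 'g \<times> bool \<Rightarrow> 'h" where
  "gletter f (x, b) = (if b then f x else ginv (f x))"

definition gval :: "('g \<Rightarrow> 'h::mult_group) \<Rightarrow> 'g gword \<Rightarrow> 'h" where
  "gval f w = prod_list (map (gletter f) w)"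

lemma gval_simps [simp]:
  "gval f [] = 1" "gval f (l # w) = gletter f l * gval f w" "gval f (u @ w) = gval f u * gval f w"
  "gval f (gw x) = f x"
  by (simp_all add: gval_def gw_def)

lemma gval_gw_inv [simp]: "gval f (gw_inv w) = ginv (gval f w)"
  by (induction w) (auto simp: gw_inv_def)

lemma gval_pres_equiv:
  assumes "\<And>l r. (l, r) \<in> R \<Longrightarrow> gval f l = gval f r" and "(u, v) \<in> pres_equiv R"
  shows "gval f u = gval f v"
proof -
  have "pres_step R u v \<Longrightarrow> gval f u = gval f v" for u v
    by (induction rule: pres_step.induct) (auto simp: assms(1))
  with assms(2) show ?thesis
    by (auto simp: pres_equiv_def intro: equivclp_invariant)
qed


section \<open>Presented groups\<close>

lemma equiv_pres_equiv: "equiv UNIV (pres_equiv R)"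
proof (intro equivI refl_onI symI transI)
  fix u v w assume "(u, v) \<in> pres_equiv R"
  then show "(v, u) \<in> pres_equiv R" by (auto simp: pres_equiv_def intro: equivclp_sym)
  assume "(v, w) \<in> pres_equiv R"
  with \<open>(u, v) \<in> pres_equiv R\<close> show "(u, w) \<in> pres_equiv R"
    by (auto simp: pres_equiv_def dest: equivclp_trans)
qed (auto simp: pres_equiv_def)

lemma pres_step_append:
  assumes "pres_step R u v" shows "pres_step R (a @ u) (a @ v)" "pres_step R (u @ a) (v @ a)"
  using assms
proof (induction rule: pres_step.induct)
  case (cancel u x b v)
  show "pres_step R (a @ u @ [(x, b), (x, \<not> b)] @ v) (a @ u @ v)"
    "pres_step R ((u @ [(x, b), (x, \<not> b)] @ v) @ a) ((u @ v) @ a)"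
    using pres_step.cancel[of R "a @ u" x b v] pres_step.cancel[of R u x b "v @ a"] by simp_all
next
  case (relation l r u v)
  then show "pres_step R (a @ u @ l @ v) (a @ u @ r @ v)" "pres_step R ((u @ l @ v) @ a) ((u @ r @ v) @ a)"
    using pres_step.relation[of l r R "a @ u" v] pres_step.relation[of l r R u "v @ a"] by simp_all
qed

lemma pres_equiv_append:
  assumes "(a, a') \<in> pres_equiv R" "(b, b') \<in> pres_equiv R" shows "(a @ b, a' @ b') \<in> pres_equiv R"
proof -
  have "equivclp (pres_step R) (a @ b) (a' @ b)"
    by (rule equivclp_map[of "pres_step R"])
      (use assms(1) in \<open>auto simp: pres_equiv_def intro: pres_step_append\<close>)
  moreover have "equivclp (pres_step R) (a' @ b) (a' @ b')"
    by (rule equivclp_map[of "pres_step R"])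
      (use assms(2) in \<open>auto simp: pres_equiv_def intro: pres_step_append\<close>)
  ultimately show ?thesis using equivclp_trans by (auto simp: pres_equiv_def)
qed

lemma gw_inv_left: "(gw_inv w @ w, []) \<in> pres_equiv R"
proof (induction w)
  case (Cons l w)
  obtain x b where l: "l = (x, b)" by force
  have "pres_step R (gw_inv w @ [(x, \<not> b), (x, b)] @ w) (gw_inv w @ w)"
    using pres_step.cancel[of R "gw_inv w" x "\<not> b" w] by simp
  then have "(gw_inv (l # w) @ l # w, gw_inv w @ w) \<in> pres_equiv R"
    by (auto simp: pres_equiv_def gw_inv_def l)
  with Cons show ?case using equivclp_trans by (auto simp: pres_equiv_def)
qed (simp add: gw_inv_def pres_equiv_def)

lemma presented_group_group: "group (presented_group R)"
  unfolding presented_group_def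
  by (rule word_quotient_group) (auto intro: equiv_pres_equiv pres_equiv_append gw_inv_left)

lemma presented_group_mult:
  "pres_equiv R `` {u} \<otimes>\<^bsub>presented_group R\<^esub> pres_equiv R `` {v} = pres_equiv R `` {u @ v}"
  unfolding presented_group_def
  by (rule word_quotient_mult) (auto intro: equiv_pres_equiv pres_equiv_append)


section \<open>The group of mutation loops\<close>

lemma apply_seq_append: "apply_seq (u @ v) \<epsilon> = apply_seq u (apply_seq v \<epsilon>)"
  by (simp add: apply_seq_def)

lemma apply_seq_simps [simp]: "apply_seq [] \<epsilon> = \<epsilon>"
    "apply_seq (l # w) \<epsilon> = apply_letter l (apply_seq w \<epsilon>)"
  by (simp_all add: apply_seq_def)

lemma mutation_seqs_simps [simp]:
  "[] \<in> mutation_seqs I"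
      "l # w \<in> mutation_seqs I \<longleftrightarrow> l \<in> letters I \<and> w \<in> mutation_seqs I"
  "u @ v \<in> mutation_seqs I \<longleftrightarrow> u \<in> mutation_seqs I \<and> v \<in> mutation_seqs I"
  by (auto simp: mutation_seqs_def)

lemma letters_simps [simp]: "Mut k \<in> letters I \<longleftrightarrow> k \<in> I"
    "Perm \<sigma> \<in> letters I \<longleftrightarrow> \<sigma> permutes I"
  by (auto simp: letters_def)

text \<open>
  Away from row and column \<open>k\<close> the second mutation adds the opposite of what the first one added; the
  added terms are halves of even numbers, so that the division by 2 respects the sign.
\<close>

lemma mutate_mutate [simp]: "mutate k (mutate k \<epsilon>) = \<epsilon>"
proof (intro ext)
  fix i j
  have ev: "even (\<bar>a\<bar> * b + a * \<bar>b\<bar>)" for a b :: int by simp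
  have "(\<bar>a\<bar> * b + a * \<bar>b\<bar>) div 2 + (\<bar>- a\<bar> * (- b) + (- a) * \<bar>- b\<bar>) div 2 = 0" for a b :: int
  proof -
    obtain c where "\<bar>a\<bar> * b + a * \<bar>b\<bar> = 2 * c" using ev[of a b] by (elim evenE)
    moreover from this have "\<bar>- a\<bar> * (- b) + (- a) * \<bar>- b\<bar> = 2 * (- c)" by simp
    ultimately show ?thesis by (metis add.right_inverse nonzero_mult_div_cancel_left zero_neq_numeral)
  qed
  from this[of "\<epsilon> i k" "\<epsilon> k j"] show "mutate k (mutate k \<epsilon>) i j = \<epsilon> i j"
    by (auto simp: mutate_def)
qed

lemma permute_matrix_comp:
  "\<sigma> permutes I \<Longrightarrow> \<tau> permutes I \<Longrightarrow> permute_matrix \<sigma> (permute_matrix \<tau> \<epsilon>) = permute_matrix (\<sigma> \<circ> \<tau>) \<epsilon>"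
  by (simp add: permute_matrix_def o_inv_distrib permutes_bij)

lemma permute_matrix_inv:
  "\<sigma> permutes I \<Longrightarrow> permute_matrix (inv_into UNIV \<sigma>) (permute_matrix \<sigma> \<epsilon>) = \<epsilon>"
  by (simp add: permute_matrix_comp[of _ I] permutes_inv permutes_inv_o) (simp add: permute_matrix_def)

fun inv_letter :: "'i letter \<Rightarrow> 'i letter" where
  "inv_letter (Mut k) = Mut k"
| "inv_letter (Perm \<sigma>) = Perm (inv_into UNIV \<sigma>)"

definition inv_seq :: "'i letter list \<Rightarrow> 'i letter list" where
  "inv_seq w = rev (map inv_letter w)"

lemma inv_seq_simps [simp]: "inv_seq [] = []" "inv_seq (l # w) = inv_seq w @ [inv_letter l]"
  by (simp_all add: inv_seq_def)

lemma inv_letter_in [simp]: "l \<in> letters I \<Longrightarrow> inv_letter l \<in> letters I"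
  by (cases l) (auto intro: permutes_inv)

lemma inv_seq_in [simp]: "w \<in> mutation_seqs I \<Longrightarrow> inv_seq w \<in> mutation_seqs I"
  by (induction w) auto

lemma inv_letter_inv [simp]: "l \<in> letters I \<Longrightarrow> inv_letter (inv_letter l) = l"
  by (cases l) (auto simp: permutes_inv_inv)

lemma inv_seq_inv: "w \<in> mutation_seqs I \<Longrightarrow> inv_seq (inv_seq w) = w"
  by (induction w) (auto simp: inv_seq_def)

lemma apply_inv_seq: "w \<in> mutation_seqs I \<Longrightarrow> apply_seq (inv_seq w) (apply_seq w \<epsilon>) = \<epsilon>"
proof (induction w)
  case (Cons l w)
  then show ?case by (cases l) (auto simp: apply_seq_append permute_matrix_inv[of _ I])
qed simp

abbreviation seq_eq :: "'i set \<Rightarrow> 'i matrix \<Rightarrow> 'i letter list \<Rightarrow> 'i letter list \<Rightarrow> bool" where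
  "seq_eq I \<epsilon> \<equiv> equivclp (seq_step I \<epsilon>)"

lemma seq_eq_basic:
  "u \<in> mutation_seqs I \<Longrightarrow> v \<in> mutation_seqs I \<Longrightarrow> basic_relation I (apply_seq v \<epsilon>) l r \<Longrightarrow>
    seq_eq I \<epsilon> (u @ l @ v) (u @ r @ v)"
  by (intro r_into_equivclp seq_step.intros)

lemma seq_eq_append_left:
  assumes "seq_eq I \<epsilon> v v'" "u \<in> mutation_seqs I" shows "seq_eq I \<epsilon> (u @ v) (u @ v')"
proof (rule equivclp_map[OF assms(1)])
  fix x y assume "seq_step I \<epsilon> x y"
  then show "seq_eq I \<epsilon> (u @ x) (u @ y)"
  proof (induction rule: seq_step.induct)
    case (1 u' v l r)
    then show ?case using seq_eq_basic[of "u @ u'" I v \<epsilon> l r] assms(2) by simp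
  qed
qed

text \<open>
  The relations used on \<open>u\<close> are those available at the matrix that \<open>v\<close> produces.
\<close>

lemma seq_eq_append_right:
  assumes "seq_eq I (apply_seq v \<epsilon>) u u'" "v \<in> mutation_seqs I"
      shows "seq_eq I \<epsilon> (u @ v) (u' @ v)"
proof (rule equivclp_map[OF assms(1), of _ "\<lambda>u. u @ v"])
  fix x y assume "seq_step I (apply_seq v \<epsilon>) x y"
  then show "seq_eq I \<epsilon> (x @ v) (y @ v)"
  proof (induction rule: seq_step.induct)
    case (1 u v' l r)
    then show ?case using seq_eq_basic[of u I "v' @ v" \<epsilon> l r] assms(2) by (simp add: apply_seq_append)
  qed
qed

lemma seq_eq_inv_letter:
  assumes "l \<in> letters I" "u \<in> mutation_seqs I" "v \<in> mutation_seqs I"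
  shows "seq_eq I \<epsilon> (u @ [inv_letter l, l] @ v) (u @ v)"
proof (cases l)
  case (Mut k)
  then show ?thesis using assms seq_eq_basic[OF assms(2,3) basic_relation.involution[of k]] by simp
next
  case (Perm \<sigma>)
  then have "seq_eq I \<epsilon> (u @ [inv_letter l, l] @ v) (u @ [Perm id] @ v)"
    using assms seq_eq_basic[OF assms(2,3) basic_relation.perm_comp[of "inv_into UNIV \<sigma>" I \<sigma>]]
    by (simp add: permutes_inv permutes_inv_o)
  moreover have "seq_eq I \<epsilon> (u @ [Perm id] @ v) (u @ v)"
    using seq_eq_basic[OF assms(2,3) basic_relation.perm_id] by simp
  ultimately show ?thesis by (rule equivclp_trans)
qed

lemma seq_eq_inv_seq:
  assumes "w \<in> mutation_seqs I" "v \<in> mutation_seqs I"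
  shows "seq_eq I \<epsilon> (inv_seq w @ w @ v) v"
  using assms(1)
proof (induction w)
  case (Cons l w)
  have "seq_eq I \<epsilon> (inv_seq (l # w) @ (l # w) @ v) (inv_seq w @ w @ v)"
    using seq_eq_inv_letter[of l I "inv_seq w" "w @ v"] Cons assms(2) by simp
  moreover have "seq_eq I \<epsilon> (inv_seq w @ w @ v) v" using Cons by simp
  ultimately show ?case by (rule equivclp_trans)
qed simp

lemma seq_eq_inv_seq':
  assumes "w \<in> mutation_seqs I" "v \<in> mutation_seqs I"
  shows "seq_eq I \<epsilon> (w @ inv_seq w @ v) v"
  using seq_eq_inv_seq[of "inv_seq w" I v] assms by (simp add: inv_seq_inv[of w I])

lemma equiv_loop_equiv: "equiv (mutation_loops I \<epsilon>) (loop_equiv I \<epsilon>)"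
proof (intro equivI refl_onI symI transI)
  fix u v w assume "(u, v) \<in> loop_equiv I \<epsilon>"
  then show "(v, u) \<in> loop_equiv I \<epsilon>" by (auto simp: loop_equiv_def intro: equivclp_sym)
  assume "(v, w) \<in> loop_equiv I \<epsilon>"
  with \<open>(u, v) \<in> loop_equiv I \<epsilon>\<close> show "(u, w) \<in> loop_equiv I \<epsilon>"
    by (auto simp: loop_equiv_def dest: equivclp_trans)
qed (auto simp: loop_equiv_def)

lemma mutation_loops_simps:
  "[] \<in> mutation_loops I \<epsilon>"
      "u \<in> mutation_loops I \<epsilon> \<Longrightarrow> v \<in> mutation_loops I \<epsilon> \<Longrightarrow> u @ v \<in> mutation_loops I \<epsilon>"
  by (auto simp: mutation_loops_def apply_seq_append)

lemma inv_seq_loop: "w \<in> mutation_loops I \<epsilon> \<Longrightarrow> inv_seq w \<in> mutation_loops I \<epsilon>"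
  using apply_inv_seq[of w I \<epsilon>] by (auto simp: mutation_loops_def)

lemma loop_equiv_append:
  assumes "(a, a') \<in> loop_equiv I \<epsilon>" "(b, b') \<in> loop_equiv I \<epsilon>"
  shows "(a @ b, a' @ b') \<in> loop_equiv I \<epsilon>"
proof -
  have "seq_eq I \<epsilon> (a @ b) (a' @ b)" "seq_eq I \<epsilon> (a' @ b) (a' @ b')"
    using assms by (auto simp: loop_equiv_def mutation_loops_def intro: seq_eq_append_right seq_eq_append_left)
  then have "seq_eq I \<epsilon> (a @ b) (a' @ b')" by (rule equivclp_trans)
  then show ?thesis using assms mutation_loops_simps(2) by (auto simp: loop_equiv_def)
qed

lemma saturated_cmg_group: "group (saturated_cmg I \<epsilon>)"
  unfolding saturated_cmg_def
proof (rule word_quotient_group)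
  fix a assume a: "a \<in> mutation_loops I \<epsilon>"
  have "seq_eq I \<epsilon> (inv_seq a @ a) []"
    using seq_eq_inv_seq[of a I "[]"] a by (simp add: mutation_loops_def)
  then have "(inv_seq a @ a, []) \<in> loop_equiv I \<epsilon>"
    using a mutation_loops_simps(1) mutation_loops_simps(2)[OF inv_seq_loop[OF a] a]
        by (simp add: loop_equiv_def)
  then show "\<exists>b \<in> mutation_loops I \<epsilon>. (b @ a, []) \<in> loop_equiv I \<epsilon>"
    using inv_seq_loop[OF a] by blast
qed (auto intro: equiv_loop_equiv loop_equiv_append mutation_loops_simps)

lemma saturated_cmg_mult:
  "u \<in> mutation_loops I \<epsilon> \<Longrightarrow> v \<in> mutation_loops I \<epsilon> \<Longrightarrow>
    loop_equiv I \<epsilon> `` {u} \<otimes>\<^bsub>saturated_cmg I \<epsilon>\<^esub> loop_equiv I \<epsilon> `` {v} = loop_equiv I \<epsilon> `` {u @ v}"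
  unfolding saturated_cmg_def
  by (rule word_quotient_mult) (auto intro: equiv_loop_equiv loop_equiv_append)

section \<open>The five quivers and their mutations\<close>

text \<open>
  Quiver 0 is \<open>X6\<close>. The list \<open>[p\<^sub>1, \<dots>, p\<^sub>6]\<close> stands for the permutation that sends \<open>i\<close> to \<open>p\<^sub>i\<close>.
  If \<open>edge t j = (t', r, w)\<close>, then mutating quiver \<open>t\<close> at \<open>j\<close> gives quiver \<open>t'\<close> with its vertices
  renamed: the vertex \<open>i\<close> of the mutated quiver is the vertex \<open>r i\<close> of quiver \<open>t'\<close>. The word \<open>w\<close> is the
  element of the group that belongs to this edge of the groupoid, relative to the spanning tree formed
  by the edges \<open>0 \<rightarrow> 1\<close>, \<open>0 \<rightarrow> 2\<close>, \<open>1 \<rightarrow> 3\<close>, \<open>1 \<rightarrow> 4\<close> at the vertices 1, 6, 2, 6; these edges are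
  followed without renaming and carry the empty word. The list \<open>auts t\<close> consists of the automorphisms
  of quiver \<open>t\<close> with the words that belong to them. In each definition the last alternative
  also covers the numbers that do not occur.
\<close>

datatype axs = Elt_a | Elt_x | Elt_s

abbreviation (input) "la \<equiv> (Elt_a, True)"
abbreviation (input) "la' \<equiv> (Elt_a, False)"
abbreviation (input) "lx \<equiv> (Elt_x, True)"
abbreviation (input) "lx' \<equiv> (Elt_x, False)"
abbreviation (input) "ls \<equiv> (Elt_s, True)"

definition quiver_rows :: "nat \<Rightarrow> int list list" where
  "quiver_rows t =
    (if t = 0 then [[0, 1, -1, 1, -1, 1],
        [-1, 0, 2, 0, 0, 0],
        [1, -2, 0, 0, 0, 0],
        [-1, 0, 0, 0, 2, 0],
        [1, 0, 0, -2, 0, 0],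
        [-1, 0, 0, 0, 0, 0]]
     else if t = 1 then [[0, -1, 1, -1, 1, -1],
        [1, 0, 1, 0, -1, 0],
        [-1, -1, 0, 1, 0, 1],
        [1, 0, -1, 0, 1, 0],
        [-1, 1, 0, -1, 0, 1],
        [1, 0, -1, 0, -1, 0]]
     else if t = 2 then [[0, 1, -1, 1, -1, -1],
        [-1, 0, 2, 0, 0, 0],
        [1, -2, 0, 0, 0, 0],
        [-1, 0, 0, 0, 2, 0],
        [1, 0, 0, -2, 0, 0],
        [1, 0, 0, 0, 0, 0]]
     else if t = 3 then [[0, 1, 1, -1, 0, -1],
        [-1, 0, -1, 0, 1, 0],
        [-1, 1, 0, 1, -1, 1],
        [1, 0, -1, 0, 1, 0],
        [0, -1, 1, -1, 0, 1],
        [1, 0, -1, 0, -1, 0]]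
     else [[0, -1, 0, -1, 0, 1],
        [1, 0, 1, 0, -1, 0],
        [0, -1, 0, 1, 0, -1],
        [1, 0, -1, 0, 1, 0],
        [0, 1, 0, -1, 0, -1],
        [-1, 0, 1, 0, 1, 0]])"

definition edge :: "nat \<Rightarrow> nat \<Rightarrow> nat \<times> nat list \<times> axs gword" where
  "edge t j =
    (if t = 0 then
       (if j = 1 then (1, [1, 2, 3, 4, 5, 6], [])
        else if j = 2 then (0, [1, 3, 2, 4, 5, 6], [la])
        else if j = 3 then (0, [1, 3, 2, 4, 5, 6], [la'])
        else if j = 4 then (0, [1, 2, 3, 5, 4, 6], [ls, la, ls])
        else if j = 5 then (0, [1, 2, 3, 5, 4, 6], [ls, la', ls])
        else (2, [1, 2, 3, 4, 5, 6], []))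
     else if t = 1 then
       (if j = 1 then (0, [1, 2, 3, 4, 5, 6], [])
        else if j = 2 then (3, [1, 2, 3, 4, 5, 6], [])
        else if j = 3 then (3, [2, 3, 1, 4, 5, 6], [la'])
        else if j = 4 then (3, [1, 4, 5, 2, 3, 6], [ls])
        else if j = 5 then (3, [6, 4, 1, 3, 5, 2], [lx', ls, lx, la', ls])
        else (4, [1, 2, 3, 4, 5, 6], []))
     else if t = 2 then
       (if j = 1 then (3, [3, 1, 2, 5, 6, 4], [lx'])
        else if j = 2 then (2, [1, 3, 2, 4, 5, 6], [la])
        else if j = 3 then (2, [1, 3, 2, 4, 5, 6], [la'])
        else if j = 4 then (2, [1, 2, 3, 5, 4, 6], [ls, la, ls])
        else if j = 5 then (2, [1, 2, 3, 5, 4, 6], [ls, la', ls])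
        else (0, [1, 2, 3, 4, 5, 6], []))
     else if t = 3 then
       (if j = 1 then (1, [3, 1, 2, 4, 5, 6], [la])
        else if j = 2 then (1, [1, 2, 3, 4, 5, 6], [])
        else if j = 3 then (2, [2, 3, 1, 6, 4, 5], [lx])
        else if j = 4 then (4, [2, 1, 4, 3, 6, 5], [ls, lx', ls, lx, ls, lx])
        else if j = 5 then (1, [5, 6, 2, 4, 3, 1], [la, lx', ls, lx])
        else (1, [3, 6, 5, 2, 1, 4], [ls, lx', ls, lx]))
     else
       (if j = 1 then (3, [4, 1, 2, 5, 6, 3], [lx'])
        else if j = 2 then (1, [3, 6, 5, 2, 1, 4], [ls, lx', ls, lx])
        else if j = 3 then (3, [2, 1, 4, 3, 6, 5], [lx', ls, lx', ls, lx, ls])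
        else if j = 4 then (1, [3, 2, 1, 6, 5, 4], [ls, lx', ls, lx, ls])
        else if j = 5 then (3, [2, 3, 6, 1, 4, 5], [lx', ls, lx', ls, lx])
        else (1, [1, 2, 3, 4, 5, 6], [])))"

definition auts :: "nat \<Rightarrow> (nat list \<times> axs gword) list" where
  "auts t =
    (if t = 3 then [([1, 2, 3, 4, 5, 6], []),
        ([5, 6, 3, 4, 1, 2], [lx', ls, lx])]
     else if t = 4 then [([1, 2, 3, 4, 5, 6], []),
        ([1, 4, 5, 2, 3, 6], [ls]),
        ([3, 2, 1, 6, 5, 4], [ls, lx', ls, lx, ls]),
        ([3, 6, 5, 2, 1, 4], [ls, lx', ls, lx]),
        ([5, 4, 1, 6, 3, 2], [lx', ls, lx, ls]),
        ([5, 6, 3, 4, 1, 2], [lx', ls, lx])]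
     else [([1, 2, 3, 4, 5, 6], []),
        ([1, 4, 5, 2, 3, 6], [ls])])"

text \<open>
  Up to rotation and inversion, these are the non-empty words to which the words of the local
  relations reduce.
\<close>

definition axs_relators :: "axs gword list" where
  "axs_relators =
    [[la', lx', la, lx],
     [la', ls, la', ls, la, ls, la, ls],
     [lx', ls, lx', ls, lx, ls, lx, ls],
     [lx', lx', ls, lx, ls, lx', ls, lx, lx, ls],
     [la', ls, lx', ls, lx, la', ls, lx', ls, lx, lx],
     [la', ls, la, lx', ls, lx, la', ls, la, lx', ls, lx],
     [lx', ls, lx, ls, lx', ls, lx, ls, lx', ls, lx, ls],
     [la', lx', ls, lx, ls, lx', ls, lx, ls, lx, la', ls, lx', ls, lx]]"

definition quiver :: "nat \<Rightarrow> nat matrix" where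
  "quiver t i j = (if 1 \<le> i \<and> i \<le> 6 \<and> 1 \<le> j \<and> j \<le> 6 then quiver_rows t ! (i - 1) ! (j - 1) else 0)"

definition perm_of :: "nat list \<Rightarrow> nat \<Rightarrow> nat" where
  "perm_of ps i = (if 1 \<le> i \<and> i \<le> 6 then ps ! (i - 1) else i)"

definition edge_target :: "nat \<Rightarrow> nat \<Rightarrow> nat" where
  "edge_target t j = fst (edge t j)"

definition edge_relabel :: "nat \<Rightarrow> nat \<Rightarrow> nat list" where
  "edge_relabel t j = fst (snd (edge t j))"

definition edge_word :: "nat \<Rightarrow> nat \<Rightarrow> axs gword" where
  "edge_word t j = snd (snd (edge t j))"

abbreviation (input) "id6 \<equiv> [1..<7]"

definition is_perm6 :: "nat list \<Rightarrow> bool" where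
  "is_perm6 ps \<longleftrightarrow> length ps = 6 \<and> list_all (List.member ps) id6"

text \<open>
  The finite checks are evaluated by rewriting. In the larger ones a bounded quantifier is applied to a
  constant of its own that lacks only its last argument: such a term stays folded until this argument
  is a numeral, whereas the body of an abstraction would be unfolded symbolically.
\<close>

definition edge_entry_ok :: "nat \<Rightarrow> nat \<Rightarrow> nat \<Rightarrow> nat \<Rightarrow> bool" where
  "edge_entry_ok t j i k \<longleftrightarrow> mutate j (quiver t) i k =
     quiver (edge_target t j) (perm_of (edge_relabel t j) i) (perm_of (edge_relabel t j) k)"

definition edge_row_ok :: "nat \<Rightarrow> nat \<Rightarrow> nat \<Rightarrow> bool" where
  "edge_row_ok t j i \<longleftrightarrow> list_all (edge_entry_ok t j i) id6"

definition edge_ok :: "nat \<Rightarrow> nat \<Rightarrow> bool" where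
  "edge_ok t j \<longleftrightarrow> edge_target t j < 5 \<and> is_perm6 (edge_relabel t j) \<and> list_all (edge_row_ok t j) id6"

definition edges_ok :: "nat \<Rightarrow> bool" where
  "edges_ok t \<longleftrightarrow> list_all (edge_ok t) id6"

lemma edges_correct: "list_all edges_ok [0..<5]"
  by code_simp

definition aut_entry_ok :: "nat \<Rightarrow> nat list \<Rightarrow> nat \<Rightarrow> nat \<Rightarrow> bool"
    where
  "aut_entry_ok t ps i k \<longleftrightarrow> quiver t (perm_of ps i) (perm_of ps k) = quiver t i k"

definition aut_row_ok :: "nat \<Rightarrow> nat list \<Rightarrow> nat \<Rightarrow> bool" where
  "aut_row_ok t ps i \<longleftrightarrow> list_all (aut_entry_ok t ps i) id6"

definition aut_ok :: "nat \<Rightarrow> nat list \<times> axs gword \<Rightarrow> bool" where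
  "aut_ok t \<gamma> \<longleftrightarrow> is_perm6 (fst \<gamma>) \<and> list_all (aut_row_ok t (fst \<gamma>)) id6"

definition auts_ok :: "nat \<Rightarrow> bool" where
  "auts_ok t \<longleftrightarrow> List.member (auts t) (id6, []) \<and> list_all (aut_ok t) (auts t)"

lemma auts_correct: "list_all auts_ok [0..<5]"
  by code_simp

lemma X6_quiver: "X6 = quiver 0"
proof -
  have "list_all (\<lambda>i. list_all (\<lambda>j. X6 i j = quiver 0 i j) id6) id6" by code_simp
  moreover have "X6 i j = 0" if "\<not> (i \<in> {1..6} \<and> j \<in> {1..6})" for i j
    using that exchange_matrix_X6 unfolding exchange_matrix_def X6_vertices_def by blast
  ultimately show ?thesis by (auto simp: fun_eq_iff list_all_iff quiver_def)
qed

text \<open>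
  A state of the computation consists of the quiver that has been reached, the renaming of the current
  vertices into the vertices of that quiver, and the edges that have been passed, the last one first.
\<close>

type_synonym lstate = "nat \<times> nat list \<times> (nat \<times> nat) list"

definition lstep :: "nat \<Rightarrow> lstate \<Rightarrow> lstate" where
  "lstep k = (\<lambda>(t, q, es). let j = perm_of q k in
     (edge_target t j, map (perm_of (edge_relabel t j)) q, (t, j) # es))"

definition lrun :: "nat list \<Rightarrow> lstate \<Rightarrow> lstate" where
  "lrun ks st = foldr lstep ks st"

definition path_word :: "(nat \<times> nat) list \<Rightarrow> axs gword" where
  "path_word es = concat (map (\<lambda>e. edge_word (fst e) (snd e)) es)"

definition relabels :: "nat list \<Rightarrow> nat list \<Rightarrow> nat list \<times> axs gword \<Rightarrow> bool" where
  "relabels q1 q2 \<gamma> \<longleftrightarrow> map (perm_of (fst \<gamma>)) q1 = q2"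

text \<open>
  Two states that lie over the same quiver and whose renamings differ by an automorphism can be
  compared; the word that is returned is trivial in the group exactly if the values of
  the two paths differ by the value of that automorphism.
\<close>

definition compare :: "lstate \<Rightarrow> axs gword \<Rightarrow> lstate \<Rightarrow> axs gword \<Rightarrow> axs gword option" where
  "compare st1 w1 st2 w2 =
     (case st1 of (t1, q1, es1) \<Rightarrow> case st2 of (t2, q2, es2) \<Rightarrow>
      if t1 = t2 then
        (case find (relabels q1 q2) (auts t1) of None \<Rightarrow> None
         | Some \<gamma> \<Rightarrow> Some (snd \<gamma> @ path_word es1 @ w1 @ gw_inv (path_word es2 @ w2)))
      else None)"

text \<open>
  Free reduction of words in which the letter \<open>s\<close> is its own inverse.
\<close>

fun cancels :: "axs \<times> bool \<Rightarrow> axs \<times> bool \<Rightarrow> bool" where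
  "cancels (g, b) (h, c) \<longleftrightarrow> g = h \<and> (g = Elt_s \<or> b \<noteq> c)"

fun push :: "axs \<times> bool \<Rightarrow> axs gword \<Rightarrow> axs gword" where
  "push l [] = [l]"
| "push l (m # w) = (if cancels l m then w else l # m # w)"

definition positive_s :: "axs \<times> bool \<Rightarrow> axs \<times> bool" where
  "positive_s l = (fst l, snd l \<or> fst l = Elt_s)"

primrec reduce :: "axs gword \<Rightarrow> axs gword" where
  "reduce [] = []"
| "reduce (l # w) = push (positive_s l) (reduce w)"

fun cyc_reduce :: "axs gword \<Rightarrow> axs gword" where
  "cyc_reduce w = (case w of [] \<Rightarrow> [] | l # v \<Rightarrow>
     if v \<noteq> [] \<and> cancels (last v) l then cyc_reduce (butlast v) else w)"
declare cyc_reduce.simps [simp del]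

definition is_rotation :: "'a list \<Rightarrow> 'a list \<Rightarrow> bool" where
  "is_rotation v w \<longleftrightarrow> length v = length w \<and> List.member (map (\<lambda>i. rotate i v) [0..<length v]) w"

definition matches_relator :: "axs gword \<Rightarrow> axs gword \<Rightarrow> axs gword \<Rightarrow> bool"
    where
  "matches_relator c d r \<longleftrightarrow> is_rotation r c \<or> is_rotation r d"

definition known_relator :: "axs gword \<Rightarrow> bool" where
  "known_relator w = (let c = cyc_reduce (reduce w) in
     c = [] \<or> list_ex (matches_relator c (reduce (gw_inv c))) axs_relators)"

definition agree :: "lstate \<Rightarrow> axs gword \<Rightarrow> lstate \<Rightarrow> axs gword \<Rightarrow> bool" where
  "agree st1 w1 st2 w2 = (case compare st1 w1 st2 w2 of None \<Rightarrow> False | Some w \<Rightarrow> known_relator w)"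

text \<open>
  The values of the automorphisms are compatible with inverses and products, and with crossing an edge:
  an automorphism may be applied before or after a mutation.
\<close>

definition aut_inv_ok :: "nat \<Rightarrow> nat list \<times> axs gword \<Rightarrow> bool" where
  "aut_inv_ok t \<gamma> \<longleftrightarrow> agree (t, fst \<gamma>, []) (snd \<gamma>) (t, id6, []) []"

definition aut_mult_ok :: "nat \<Rightarrow> nat list \<times> axs gword \<Rightarrow> nat list \<times> axs gword \<Rightarrow> bool" where
  "aut_mult_ok t \<gamma> \<delta> \<longleftrightarrow>
     agree (t, id6, []) [] (t, map (perm_of (fst \<gamma>)) (fst \<delta>), []) (snd \<gamma> @ snd \<delta>)"

definition aut_mults_ok :: "nat \<Rightarrow> nat list \<times> axs gword \<Rightarrow> bool" where
  "aut_mults_ok t \<gamma> \<longleftrightarrow> list_all (aut_mult_ok t \<gamma>) (auts t)"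

definition natural_at :: "nat \<Rightarrow> nat list \<times> axs gword \<Rightarrow> nat \<Rightarrow> bool"
    where
  "natural_at t \<gamma> k \<longleftrightarrow> agree (lrun [k] (t, id6, [])) [] (lrun [k] (t, fst \<gamma>, [])) (snd \<gamma>)"

definition natural :: "nat \<Rightarrow> nat list \<times> axs gword \<Rightarrow> bool" where
  "natural t \<gamma> \<longleftrightarrow> list_all (natural_at t \<gamma>) id6"

definition groupoid_ok :: "nat \<Rightarrow> bool" where
  "groupoid_ok t \<longleftrightarrow> list_all (aut_inv_ok t) (auts t) \<and> list_all (aut_mults_ok t) (auts t) \<and>
     list_all (natural t) (auts t)"

definition involution_ok :: "nat \<Rightarrow> nat \<Rightarrow> bool" where
  "involution_ok t k \<longleftrightarrow> agree (lrun [k, k] (t, id6, [])) [] (t, id6, []) []"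

definition swap_list :: "nat \<Rightarrow> nat \<Rightarrow> nat list" where
  "swap_list i j = map (\<lambda>k. if k = i then j else if k = j then i else k) id6"

text \<open>
  The permutation on the other side of the pentagon relation passes no edge; as a transposition
  it is its own inverse, so that the direction in which renamings are read does not matter here.
\<close>

definition pair_ok :: "nat \<Rightarrow> nat \<Rightarrow> nat \<Rightarrow> bool" where
  "pair_ok t i j \<longleftrightarrow>
     (if quiver t i j = 0 then agree (lrun [i, j] (t, id6, [])) [] (lrun [j, i] (t, id6, [])) []
      else if \<bar>quiver t i j\<bar> = 1 then agree (lrun [i, j, i, j, i] (t, id6, [])) [] (t, swap_list i j, []) []
      else True)"

definition pairs_ok :: "nat \<Rightarrow> nat \<Rightarrow> bool" where
  "pairs_ok t i \<longleftrightarrow> list_all (pair_ok t i) id6"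

definition local_ok :: "nat \<Rightarrow> bool" where
  "local_ok t \<longleftrightarrow> list_all (involution_ok t) id6 \<and> list_all (pairs_ok t) id6"

lemma groupoid_correct: "list_all groupoid_ok [0..<5]"
  by code_simp

lemma local_correct: "list_all local_ok [0..<5]"
  by code_simp

lemma list_all_upt: "list_all P [m..<n] \<longleftrightarrow> (\<forall>i. m \<le> i \<and> i < n \<longrightarrow> P i)"
  by (auto simp: list_all_iff)

lemma in_vertices_iff: "i \<in> X6_vertices \<longleftrightarrow> 1 \<le> i \<and> i < 7"
  by (auto simp: X6_vertices_def)

lemma quiver_outside: "\<not> (i \<in> X6_vertices \<and> j \<in> X6_vertices) \<Longrightarrow> quiver t i j = 0"
  by (auto simp: quiver_def X6_vertices_def)

lemma perm_of_outside: "i \<notin> X6_vertices \<Longrightarrow> perm_of ps i = i"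
  by (auto simp: perm_of_def X6_vertices_def)

lemma perm_of_id6 [simp]: "perm_of [Suc 0..<7] = id"
  by (auto simp: perm_of_def fun_eq_iff)

lemma perm_of_map: "length qs = 6 \<Longrightarrow> perm_of (map (perm_of rs) qs) = perm_of rs \<circ> perm_of qs"
  by (auto simp: perm_of_def fun_eq_iff)

lemma perm_of_permutes:
  assumes "is_perm6 ps" shows "perm_of ps permutes X6_vertices"
proof (rule bij_imp_permutes)
  have len: "length ps = 6" and sub: "X6_vertices \<subseteq> set ps"
    using assms by (auto simp: is_perm6_def list_all_upt in_vertices_iff)
  have "card X6_vertices = 6" by (simp add: X6_vertices_def)
  then have set: "set ps = X6_vertices"
    using sub len card_length[of ps] card_seteq[of "set ps" X6_vertices] by auto
  have "X6_vertices \<subseteq> perm_of ps ` X6_vertices"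
  proof
    fix y assume "y \<in> X6_vertices"
    then obtain n where "n < 6" "ps ! n = y" using set len by (metis in_set_conv_nth)
    then have "perm_of ps (Suc n) = y" "Suc n \<in> X6_vertices" by (auto simp: perm_of_def X6_vertices_def)
    then show "y \<in> perm_of ps ` X6_vertices" by blast
  qed
  moreover have "perm_of ps ` X6_vertices \<subseteq> X6_vertices"
  proof
    fix y assume "y \<in> perm_of ps ` X6_vertices"
    then obtain i where "i \<in> {1..6}" "y = ps ! (i - 1)" by (auto simp: perm_of_def X6_vertices_def)
    then have "ps ! (i - 1) \<in> set ps" using len by (intro nth_mem) auto
    then show "y \<in> X6_vertices" using set \<open>y = ps ! (i - 1)\<close> by simp
  qed
  ultimately have "perm_of ps ` X6_vertices = X6_vertices" by blast
  then show "bij_betw (perm_of ps) X6_vertices X6_vertices"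
    by (simp add: bij_betw_def finite_surj_inj X6_vertices_def)
qed (simp add: perm_of_outside)

definition state_matrix :: "nat \<Rightarrow> (nat \<Rightarrow> nat) \<Rightarrow> nat matrix" where
  "state_matrix t q = (\<lambda>i j. quiver t (q i) (q j))"

text \<open>
  The check on the vertices 1 to 6 extends to all indices, because both matrices vanish elsewhere.
\<close>

lemma edge_facts:
  assumes "t < 5" "j \<in> X6_vertices"
  shows "edge_target t j < 5" "perm_of (edge_relabel t j) permutes X6_vertices" "length (edge_relabel t j) = 6"
    "mutate j (quiver t) = state_matrix (edge_target t j) (perm_of (edge_relabel t j))"
proof -
  have E: "edge_target t j < 5 \<and> is_perm6 (edge_relabel t j) \<and>
     (\<forall>i \<in> X6_vertices. \<forall>k \<in> X6_vertices. mutate j (quiver t) i k =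
       quiver (edge_target t j) (perm_of (edge_relabel t j) i) (perm_of (edge_relabel t j) k))"
    using edges_correct assms
    by (simp add: list_all_upt in_vertices_iff edges_ok_def edge_ok_def edge_row_ok_def edge_entry_ok_def)
  then show "edge_target t j < 5" by blast
  show perm: "perm_of (edge_relabel t j) permutes X6_vertices" using E perm_of_permutes by blast
  show "length (edge_relabel t j) = 6" using E by (simp add: is_perm6_def)
  show "mutate j (quiver t) = state_matrix (edge_target t j) (perm_of (edge_relabel t j))"
  proof (intro ext)
    fix i k show "mutate j (quiver t) i k = state_matrix (edge_target t j) (perm_of (edge_relabel t j)) i k"
    proof (cases "i \<in> X6_vertices \<and> k \<in> X6_vertices")
      case True
      then show ?thesis using E by (simp add: state_matrix_def)
    next
      case False
      then have "mutate j (quiver t) i k = 0" by (auto simp: mutate_def quiver_outside)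
      moreover have "\<not> (perm_of (edge_relabel t j) i \<in> X6_vertices \<and> perm_of (edge_relabel t j) k \<in> X6_vertices)"
        using False permutes_in_image[OF perm] by blast
      ultimately show ?thesis by (simp add: state_matrix_def quiver_outside)
    qed
  qed
qed

lemma aut_facts:
  assumes "t < 5" "(ps, w) \<in> set (auts t)"
  shows "perm_of ps permutes X6_vertices" "length ps = 6" "state_matrix t (perm_of ps) = quiver t"
proof -
  have "aut_ok t (ps, w)"
    using auts_correct assms by (simp add: list_all_upt auts_ok_def list_all_iff)
  then have A: "is_perm6 ps \<and> (\<forall>i \<in> X6_vertices. \<forall>k \<in> X6_vertices. quiver t (perm_of ps i) (perm_of ps k) = quiver t i k)"
    by (simp add: list_all_upt in_vertices_iff aut_ok_def aut_row_ok_def aut_entry_ok_def)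
  then show perm: "perm_of ps permutes X6_vertices" using perm_of_permutes by blast
  show "length ps = 6" using A by (simp add: is_perm6_def)
  show "state_matrix t (perm_of ps) = quiver t"
  proof (intro ext)
    fix i k show "state_matrix t (perm_of ps) i k = quiver t i k"
    proof (cases "i \<in> X6_vertices \<and> k \<in> X6_vertices")
      case True
      then show ?thesis using A by (simp add: state_matrix_def)
    next
      case False
      moreover have "\<not> (perm_of ps i \<in> X6_vertices \<and> perm_of ps k \<in> X6_vertices)"
        using False permutes_in_image[OF perm] by blast
      ultimately show ?thesis by (simp add: state_matrix_def quiver_outside)
    qed
  qed
qed


section \<open>Transport along mutation sequences\<close>

text \<open>
  In a state \<open>(t, q, g)\<close> the current matrix is quiver \<open>t\<close> with the current vertex \<open>i\<close> playing the role of
  \<open>q i\<close>, and \<open>g\<close> is the product of the values \<open>E\<close> of the edges passed so far. Permutations of the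
  labels change the renaming only.
\<close>

fun transport_step :: "(nat \<Rightarrow> nat \<Rightarrow> 'g::monoid_mult) \<Rightarrow> nat letter \<Rightarrow> nat \<times> (nat \<Rightarrow> nat) \<times> 'g \<Rightarrow> nat \<times> (nat \<Rightarrow> nat) \<times> 'g" where
  "transport_step E (Mut k) (t, q, g) = (edge_target t (q k), perm_of (edge_relabel t (q k)) \<circ> q, E t (q k) * g)"
| "transport_step E (Perm \<tau>) (t, q, g) = (t, q \<circ> inv_into UNIV \<tau>, g)"

definition transport :: "(nat \<Rightarrow> nat \<Rightarrow> 'g::monoid_mult) \<Rightarrow> nat letter list \<Rightarrow> nat \<times> (nat \<Rightarrow> nat) \<times> 'g \<Rightarrow> nat \<times> (nat \<Rightarrow> nat) \<times> 'g" where
  "transport E w st = foldr (transport_step E) w st"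

lemma transport_simps [simp]: "transport E [] st = st"
    "transport E (l # w) st = transport_step E l (transport E w st)"
  "transport E (u @ v) st = transport E u (transport E v st)"
  by (simp_all add: transport_def)

definition valid_state :: "nat \<times> (nat \<Rightarrow> nat) \<times> 'g \<Rightarrow> bool" where
  "valid_state = (\<lambda>(t, q, g). t < 5 \<and> q permutes X6_vertices)"

lemma transport_step_valid:
  assumes "valid_state (t, q, g)" "l \<in> letters X6_vertices" "transport_step E l (t, q, g) = (t', q', g')"
  shows "valid_state (t', q', g')" "apply_letter l (state_matrix t q) = state_matrix t' q'"
proof -
  have t: "t < 5" and q: "q permutes X6_vertices" using assms(1) by (auto simp: valid_state_def)
  have "valid_state (t', q', g') \<and> apply_letter l (state_matrix t q) = state_matrix t' q'"
  proof (cases l)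
    case (Mut k)
    then have k: "q k \<in> X6_vertices" using assms(2) permutes_in_image[OF q] by simp
    have "mutate k (state_matrix t q) = (\<lambda>i j. mutate (q k) (quiver t) (q i) (q j))"
      using permutes_inj[OF q] by (auto simp: mutate_def state_matrix_def fun_eq_iff dest: injD)
    then show ?thesis
      using assms(3) Mut edge_facts[OF t k] q permutes_compose[OF q]
      by (auto simp: valid_state_def state_matrix_def)
  next
    case (Perm \<tau>)
    then show ?thesis
      using assms(2,3) q t permutes_compose[OF permutes_inv[of \<tau>] q]
      by (auto simp: valid_state_def state_matrix_def permute_matrix_def)
  qed
  then show "valid_state (t', q', g')" "apply_letter l (state_matrix t q) = state_matrix t' q'" by blast+
qed

lemma transport_valid:
  assumes "valid_state (t, q, g)" "w \<in> mutation_seqs X6_vertices" "transport E w (t, q, g) = (t', q', g')"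
  shows "valid_state (t', q', g') \<and> apply_seq w (state_matrix t q) = state_matrix t' q'"
  using assms(2,3)
proof (induction w arbitrary: t' q' g')
  case (Cons l w)
  obtain t1 q1 g1 where 1: "transport E w (t, q, g) = (t1, q1, g1)" by (metis prod_cases3)
  with Cons have "valid_state (t1, q1, g1) \<and> apply_seq w (state_matrix t q) = state_matrix t1 q1" by simp
  with Cons.prems 1 show ?case using transport_step_valid[of t1 q1 g1 l E t' q' g'] by simp
qed (use assms(1) in auto)

lemma transport_mult_right:
  "transport E w (t, q, g) = (t', q', g') \<Longrightarrow> transport E w (t, q, g * h) = (t', q', g' * h)"
proof (induction w arbitrary: t' q' g')
  case (Cons l w)
  obtain t1 q1 g1 where 1: "transport E w (t, q, g) = (t1, q1, g1)" by (metis prod_cases3)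
  with Cons show ?case by (cases l) (auto simp: mult.assoc)
qed simp

text \<open>
  Transport does not depend on the labels. This is why a local relation has to be checked for
  the five quivers only and not for all their relabellings.
\<close>

lemma transport_relabel:
  "transport E (map (\<lambda>k. Mut (p k)) ks) (t, q, g) = (t', q', g') \<Longrightarrow>
    transport E (map Mut ks) (t, q \<circ> p, g) = (t', q' \<circ> p, g')"
proof (induction ks arbitrary: t' q' g')
  case (Cons k ks)
  obtain t1 q1 g1 where 1: "transport E (map (\<lambda>k. Mut (p k)) ks) (t, q, g) = (t1, q1, g1)"
      by (metis prod_cases3)
  with Cons show ?case by (auto simp: o_assoc)
qed simp

definition path_val :: "(nat \<Rightarrow> nat \<Rightarrow> 'g::monoid_mult) \<Rightarrow> (nat \<times> nat) list \<Rightarrow> 'g" where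
  "path_val E es = prod_list (map (\<lambda>(t, j). E t j) es)"

lemma path_val_simps [simp]: "path_val E [] = 1" "path_val E ((t, j) # es) = E t j * path_val E es"
  by (simp_all add: path_val_def)

lemma transport_lrun:
  assumes "lrun ks (t, qs, []) = (t', qs', es)" "length qs = 6"
  shows "transport E (map Mut ks) (t, perm_of qs, g) = (t', perm_of qs', path_val E es * g) \<and> length qs' = 6"
  using assms(1)
proof (induction ks arbitrary: t' qs' es)
  case (Cons k ks)
  obtain t1 q1 e1 where 1: "lrun ks (t, qs, []) = (t1, q1, e1)" by (metis prod_cases3)
  with Cons.IH have "transport E (map Mut ks) (t, perm_of qs, g) = (t1, perm_of q1, path_val E e1 * g)"
      "length q1 = 6"
    by blast+
  moreover have "lstep k (t1, q1, e1) = (t', qs', es)" using Cons.prems 1 by (simp add: lrun_def)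
  ultimately show ?case by (auto simp: lstep_def Let_def perm_of_map mult.assoc)
qed (use assms(2) in \<open>auto simp: lrun_def\<close>)


section \<open>The relators\<close>

text \<open>
  The following holds in any group. It is used for the presented group and for the cluster modular
  group.
\<close>

locale axs_group =
  fixes a x s :: "'g::mult_group"
  assumes axs: "axs_relations a x s"
begin

primrec gen :: "axs \<Rightarrow> 'g" where
  "gen Elt_a = a" | "gen Elt_x = x" | "gen Elt_s = s"

abbreviation val :: "axs gword \<Rightarrow> 'g" where "val \<equiv> gval gen"

lemma s2: "s * s = 1" using axs by (simp add: axs_relations_def Let_def)

lemmas ss = involution_conj[OF s2]

text \<open>
  The second relator says that \<open>a\<close> commutes with \<open>a'\<close>, and the sixth that two involutions commute.
  In the others the letters \<open>s\<close> pair up and leave words in \<open>a\<close>, \<open>x\<close> and \<open>x'\<close>, in which \<open>x\<close> can be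
  collected at the end; then \<open>x\<^sup>3 = x'\<^sup>3\<close> and \<open>a x' a = x'\<^sup>2\<close> apply.
\<close>

lemma axs_relators_hold: "r \<in> set axs_relators \<Longrightarrow> val r = 1"
proof -
  define x' where "x' = s * x * s"
  have ax: "a * x = x * a" and aa: "a * (s * a * s) = (s * a * s) * a" and xx': "x * x' = x' * x"
    and x3: "x * x * x = x' * x' * x'" and axa: "a * x' * a = x' * x'"
    and asa: "(ginv a * s * a) * (ginv x * s * x) = (ginv x * s * x) * (ginv a * s * a)"
    using axs unfolding axs_relations_def Let_def x'_def by blast+
  have sxs: "s * (x * s) = x'" "s * (x * (s * y)) = x' * y" "s * (ginv x * s) = ginv x'"
      "s * (ginv x * (s * y)) = ginv x' * y"
    "s * (x * (x * s)) = x' * x'" for y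
    by (simp_all add: x'_def mult.assoc ss)
  note com = commute_rules[OF xx'[symmetric]] commute_rules[OF ax]
  have 6: "ginv a * (s * (a * (ginv x * (s * (x * (ginv a * (s * (a * (ginv x * (s * x)))))))))) = 1"
    using square_iff[of "ginv a * s * a" "ginv x * s * x"] asa by (simp add: mult.assoc ss)
  have 3: "ginv x * (ginv x' * (x * x')) = 1" by (simp add: com)
  have 7: "ginv x * (x' * (ginv x * (x' * (ginv x * x')))) = 1"
    using cube_quotient[OF xx'] x3 by (simp add: mult.assoc)
  have 2: "ginv a * (s * (ginv a * (s * (a * (s * (a * s)))))) = 1"
    using aa by (simp add: mult.assoc ss)
  have 8: "ginv a * (ginv x * (x' * (ginv x * (x' * (x * (ginv a * (ginv x' * x))))))) = 1"
  proof -
    have "ginv a * (ginv x * (x' * (ginv x * (x' * (x * (ginv a * (ginv x' * x))))))) = ginv a * (x' * x') * ginv a * ginv x'"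
      by (simp add: com mult.assoc)
    then show ?thesis by (simp add: mult.assoc flip: axa)
  qed
  have 5: "ginv a * (ginv x' * (x * (ginv a * (ginv x' * (x * x))))) = 1"
  proof -
    have "ginv a * (ginv x' * (x * (ginv a * (ginv x' * (x * x))))) = ginv (x' * a * (x' * a)) * (x * x * x)"
      by (simp add: com mult.assoc)
    also have "x * x * x = x' * (a * x' * a)" using x3 axa by (simp add: mult.assoc)
    finally show ?thesis by (simp add: mult.assoc)
  qed
  have 4: "ginv x * (ginv x * (x' * (ginv x * (x' * x')))) = 1"
  proof -
    have "ginv x * (ginv x * (x' * (ginv x * (x' * x')))) = x' * x' * x' * ginv (x * x * x)"
      by (simp add: com mult.assoc)
    also have "\<dots> = 1" unfolding x3 by (rule ginv_right)
    finally show ?thesis .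
  qed
  assume "r \<in> set axs_relators"
  then show ?thesis unfolding axs_relators_def list.set insert_iff empty_iff
    by (elim disjE; simp only: gval_simps gletter.simps gen.simps if_True if_False mult_1_right ss(2) sxs 2 4 5 6 7 8)
      (simp_all add: com 3)
qed


lemma ginv_s [simp]: "ginv s = s" by (rule ss)

lemma cancels_val: "cancels l m \<Longrightarrow> gletter gen l * gletter gen m = 1"
  by (cases l; cases m) (auto simp: ss)

lemma val_push: "val (push l w) = gletter gen l * val w"
proof (cases w)
  case (Cons m v)
  then show ?thesis using cancels_val[of l m] by (simp flip: mult.assoc)
qed simp

lemma val_reduce: "val (reduce w) = val w"
proof (induction w)
  case (Cons l w)
  have "gletter gen (positive_s l) = gletter gen l" by (cases l) (auto simp: positive_s_def)
  with Cons show ?case by (simp add: val_push)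
qed simp

text \<open>
  Cyclic reduction is a conjugation, which does not affect triviality.
\<close>

lemma val_cyc_reduce: "val (cyc_reduce w) = 1 \<longleftrightarrow> val w = 1"
proof (induction w rule: cyc_reduce.induct)
  case (1 w)
  show ?case
  proof (cases "\<exists>l v. w = l # v \<and> v \<noteq> [] \<and> cancels (last v) l")
    case True
    then obtain l v where w: "w = l # v" "v \<noteq> []" "cancels (last v) l" by blast
    have "val w = gletter gen l * (val (butlast v) * gletter gen (last v))"
      using w(1) gval_simps(3)[of gen "butlast v" "[last v]"] append_butlast_last_id[OF w(2)] by simp
    then have "val w = 1 \<longleftrightarrow> val (butlast v) * (gletter gen (last v) * gletter gen l) = 1"
      using conj_eq_one_iff[of "gletter gen l"] by (simp add: mult.assoc)
    also have "\<dots> \<longleftrightarrow> val (butlast v) = 1" using cancels_val[OF w(3)] by simp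
    finally show ?thesis using 1[OF w(1)] w by (simp add: cyc_reduce.simps[of "l # v"])
  next
    case False
    then have "cyc_reduce w = w" by (auto simp: cyc_reduce.simps[of w] split: list.split)
    then show ?thesis by simp
  qed
qed

lemma val_rotate: "val (rotate n w) = 1 \<longleftrightarrow> val w = 1"
proof (induction n)
  case (Suc n)
  have "val (rotate1 v) = 1 \<longleftrightarrow> val v = 1" for v
    by (cases v) (simp_all add: conj_eq_one_iff)
  with Suc show ?case by simp
qed simp

lemma known_relator_val:
  assumes "known_relator w" shows "val w = 1"
proof -
  define c where "c = cyc_reduce (reduce w)"
  have "val c = 1"
  proof (cases "c = []")
    case False
    then obtain r where r: "r \<in> set axs_relators"
        and "is_rotation r c \<or> is_rotation r (reduce (gw_inv c))"
      using assms by (auto simp: known_relator_def matches_relator_def list_ex_iff c_def Let_def)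
    moreover have "val v = 1" if "is_rotation r v" for v
      using that axs_relators_hold[OF r] val_rotate[of _ r] by (auto simp: is_rotation_def)
    ultimately have "val c = 1 \<or> val (reduce (gw_inv c)) = 1" by blast
    then show ?thesis by (simp add: val_reduce eq_one_iff_ginv)
  qed simp
  then show ?thesis by (simp add: c_def val_cyc_reduce val_reduce)
qed

definition edge_val :: "nat \<Rightarrow> nat \<Rightarrow> 'g" where "edge_val t j = val (edge_word t j)"

lemma val_path_word: "val (path_word es) = path_val edge_val es"
  by (induction es) (auto simp: path_word_def edge_val_def)

text \<open>
  Renamings that differ by an automorphism of the quiver describe the same matrix, at the price of the
  value of the automorphism. States that are related in this way represent the same morphism of
  the groupoid.
\<close>

definition same_state :: "nat \<times> (nat \<Rightarrow> nat) \<times> 'g \<Rightarrow> nat \<times> (nat \<Rightarrow> nat) \<times> 'g \<Rightarrow> bool" (infix "\<approx>" 50) where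
  "same_state = (\<lambda>(t, q, g) (t', q', g'). t = t' \<and> (\<exists>(ps, w) \<in> set (auts t). q' = perm_of ps \<circ> q \<and> g' = val w * g))"

lemma same_state_mult_right: "(t, q, g) \<approx> (t', q', g') \<Longrightarrow> (t, q \<circ> p, g * h) \<approx> (t', q' \<circ> p, g' * h)"
  by (fastforce simp: same_state_def mult.assoc)

lemma agree_same_state:
  assumes "agree (t1, q1, es1) w1 (t2, q2, es2) w2" "length q1 = 6"
  shows "(t1, perm_of q1, path_val edge_val es1 * val w1) \<approx> (t2, perm_of q2, path_val edge_val es2 * val w2)"
proof -
  from assms(1) obtain \<gamma> where t: "t1 = t2"
      and \<gamma>: "find (relabels q1 q2) (auts t1) = Some \<gamma>"
    and rel: "known_relator (snd \<gamma> @ path_word es1 @ w1 @ gw_inv (path_word es2 @ w2))"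
    by (auto simp: agree_def compare_def split: if_splits option.splits)
  from \<gamma> have "\<gamma> \<in> set (auts t1)" and "map (perm_of (fst \<gamma>)) q1 = q2"
    by (auto simp: find_Some_iff relabels_def)
  moreover from this have "perm_of q2 = perm_of (fst \<gamma>) \<circ> perm_of q1"
      using perm_of_map[OF assms(2)] by auto
  moreover have "path_val edge_val es2 * val w2 = val (snd \<gamma>) * (path_val edge_val es1 * val w1)"
  proof -
    have "(val (snd \<gamma>) * (path_val edge_val es1 * val w1)) * ginv (path_val edge_val es2 * val w2) = 1"
      using known_relator_val[OF rel] by (simp add: val_path_word mult.assoc)
    then show ?thesis by (metis eq_iff_mult_ginv)
  qed
  ultimately show ?thesis using t by (auto simp: same_state_def intro!: bexI[of _ \<gamma>])
qed

lemma groupoid: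
  assumes "t < 5" shows "(id6, []) \<in> set (auts t)"
    "\<gamma> \<in> set (auts t) \<Longrightarrow> aut_inv_ok t \<gamma>"
    "\<gamma> \<in> set (auts t) \<Longrightarrow> \<delta> \<in> set (auts t) \<Longrightarrow> aut_mult_ok t \<gamma> \<delta>"
    "\<gamma> \<in> set (auts t) \<Longrightarrow> k \<in> X6_vertices \<Longrightarrow> natural_at t \<gamma> k"
proof -
  have "auts_ok t" "groupoid_ok t" using auts_correct groupoid_correct assms by (simp_all add: list_all_upt)
  then show "(id6, []) \<in> set (auts t)"
    "\<gamma> \<in> set (auts t) \<Longrightarrow> aut_inv_ok t \<gamma>"
    "\<gamma> \<in> set (auts t) \<Longrightarrow> \<delta> \<in> set (auts t) \<Longrightarrow> aut_mult_ok t \<gamma> \<delta>"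
    "\<gamma> \<in> set (auts t) \<Longrightarrow> k \<in> X6_vertices \<Longrightarrow> natural_at t \<gamma> k"
    by (auto simp: auts_ok_def groupoid_ok_def list_all_iff aut_mults_ok_def natural_def in_vertices_iff)
qed

lemma same_state_refl: "t < 5 \<Longrightarrow> (t, q, g) \<approx> (t, q, g)"
  using groupoid(1)[of t] by (auto simp: same_state_def intro!: bexI[of _ "(id6, [])"])

lemma same_state_sym:
  assumes "(t, q, g) \<approx> (t', q', g')" "t < 5" shows "(t', q', g') \<approx> (t, q, g)"
proof -
  from assms obtain \<gamma> where \<gamma>: "\<gamma> \<in> set (auts t)" "t' = t"
      "q' = perm_of (fst \<gamma>) \<circ> q" "g' = val (snd \<gamma>) * g"
    by (fastforce simp: same_state_def)
  have "length (fst \<gamma>) = 6" using aut_facts(2)[OF assms(2), of "fst \<gamma>"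
      "snd \<gamma>"] \<gamma>(1) by simp
  then have "(t, perm_of (fst \<gamma>), val (snd \<gamma>)) \<approx> (t, id, 1)"
    using groupoid(2)[OF assms(2) \<gamma>(1)] agree_same_state[of t "fst \<gamma>" "[]"
        "snd \<gamma>" t id6 "[]" "[]"]
    by (simp add: aut_inv_ok_def)
  from same_state_mult_right[OF this, of q g] show ?thesis using \<gamma> by simp
qed

lemma same_state_trans:
  assumes "(t, q, g) \<approx> (t', q', g')" "(t', q', g') \<approx> (t'', q'', g'')" "t < 5"
  shows "(t, q, g) \<approx> (t'', q'', g'')"
proof -
  from assms obtain \<gamma> \<delta> where \<gamma>: "\<gamma> \<in> set (auts t)" "t' = t"
      "q' = perm_of (fst \<gamma>) \<circ> q" "g' = val (snd \<gamma>) * g"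
    and \<delta>: "\<delta> \<in> set (auts t)" "t'' = t" "q'' = perm_of (fst \<delta>) \<circ> q'"
        "g'' = val (snd \<delta>) * g'"
    by (fastforce simp: same_state_def)
  have "length (fst \<gamma>) = 6" using aut_facts(2)[OF assms(3), of "fst \<gamma>"
      "snd \<gamma>"] \<gamma>(1) by simp
  then have "(t, id, 1) \<approx> (t, perm_of (fst \<delta>) \<circ> perm_of (fst \<gamma>), val (snd \<delta>) * val (snd \<gamma>))"
    using groupoid(3)[OF assms(3) \<delta>(1) \<gamma>(1)]
      agree_same_state[of t id6 "[]" "[]" t "map (perm_of (fst \<delta>)) (fst \<gamma>)" "[]"
          "snd \<delta> @ snd \<gamma>"]
    by (simp add: aut_mult_ok_def perm_of_map)
  from same_state_mult_right[OF this, of q g] show ?thesis using \<gamma> \<delta>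
      by (simp add: o_assoc mult.assoc)
qed

lemma lrun_single: "lrun [k] (t, qs, []) = (edge_target t (perm_of qs k), map (perm_of (edge_relabel t (perm_of qs k))) qs, [(t, perm_of qs k)])"
  by (simp add: lrun_def lstep_def Let_def)

text \<open>
  For a mutation this is the naturality of the automorphisms.
\<close>

lemma same_state_step:
  assumes "(t, q, g) \<approx> (t', q', g')" "valid_state (t, q, g)" "l \<in> letters X6_vertices"
  shows "transport_step edge_val l (t, q, g) \<approx> transport_step edge_val l (t', q', g')"
proof -
  have t: "t < 5" and q: "q permutes X6_vertices" using assms(2) by (auto simp: valid_state_def)
  from assms obtain \<gamma> where \<gamma>: "\<gamma> \<in> set (auts t)" "t' = t"
      "q' = perm_of (fst \<gamma>) \<circ> q" "g' = val (snd \<gamma>) * g"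
    by (fastforce simp: same_state_def)
  show ?thesis
  proof (cases l)
    case (Mut k)
    define j where "j = q k"
    have j: "j \<in> X6_vertices" using assms(3) permutes_in_image[OF q] Mut by (simp add: j_def)
    have len: "length (fst \<gamma>) = 6" using aut_facts(2)[OF t, of "fst \<gamma>"
        "snd \<gamma>"] \<gamma>(1) by simp
    have "agree (lrun [j] (t, id6, [])) [] (lrun [j] (t, fst \<gamma>, [])) (snd \<gamma>)"
      using groupoid(4)[OF t \<gamma>(1) j] by (simp add: natural_at_def)
    then have "(edge_target t j, perm_of (edge_relabel t j), edge_val t j) \<approx>
      (edge_target t (perm_of (fst \<gamma>) j), perm_of (edge_relabel t (perm_of (fst \<gamma>) j)) \<circ> perm_of (fst \<gamma>), edge_val t (perm_of (fst \<gamma>) j) * val (snd \<gamma>))"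
      using agree_same_state[of "edge_target t j" "map (perm_of (edge_relabel t j)) id6" "[(t, j)]" "[]"] len
      by (fastforce simp: lrun_single perm_of_map simp del: upt_rec_numeral)
    from same_state_mult_right[OF this, of q g] show ?thesis using \<gamma> Mut
      by (simp add: j_def o_assoc mult.assoc)
  next
    case (Perm \<tau>)
    then show ?thesis using assms(1) same_state_mult_right[of t q g t' q' g' _ 1] by simp
  qed
qed

lemma same_state_transport:
  assumes "(t, q, g) \<approx> (t', q', g')" "valid_state (t, q, g)" "w \<in> mutation_seqs X6_vertices"
  shows "transport edge_val w (t, q, g) \<approx> transport edge_val w (t', q', g')"
  using assms(3)
proof (induction w)
  case (Cons l w)
  obtain t1 q1 g1 where 1: "transport edge_val w (t, q, g) = (t1, q1, g1)" by (metis prod_cases3)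
  obtain t2 q2 g2 where 2: "transport edge_val w (t', q', g') = (t2, q2, g2)" by (metis prod_cases3)
  have "valid_state (t1, q1, g1)" using transport_valid[OF assms(2) _ 1] Cons.prems by simp
  with Cons 1 2 show ?case using same_state_step[of t1 q1 g1 t2 q2 g2 l] by simp
qed (use assms in simp)

end

section \<open>Invariance under the relations of the cluster modular group\<close>

lemma basic_relation_seqs:
  assumes "basic_relation I \<epsilon> l r" shows "l \<in> mutation_seqs I" "r \<in> mutation_seqs I"
  using assms
  by (induction rule: basic_relation.induct)
    (auto simp: permutes_id permutes_compose permutes_inv permutes_in_image permutes_swap_id)

lemma state_matrix_id: "state_matrix 0 id = X6"
  by (simp add: state_matrix_def X6_quiver)

lemma perm_of_swap_list: "i \<in> X6_vertices \<Longrightarrow> j \<in> X6_vertices \<Longrightarrow> perm_of (swap_list i j) = transpose i j"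
proof
  fix k assume "i \<in> X6_vertices" "j \<in> X6_vertices"
  then show "perm_of (swap_list i j) k = transpose i j k"
    by (cases "1 \<le> k \<and> k \<le> 6") (auto simp: perm_of_def swap_list_def transpose_def X6_vertices_def nth_append simp del: upt_rec_numeral)
qed

lemma comp_transpose: "inj q \<Longrightarrow> q \<circ> transpose i j = transpose (q i) (q j) \<circ> q"
  by (auto simp: fun_eq_iff transpose_def inj_eq)

context axs_group
begin

lemma agree_transport:
  assumes "agree (lrun (map q ks) (t, id6, [])) [] st w" and st: "st = (t', c, es)"
  shows "transport edge_val (map Mut ks) (t, q, g) \<approx> (t', perm_of c \<circ> q, path_val edge_val es * val w * g)"
proof -
  obtain t1 q1 e1 where 1: "lrun (map q ks) (t, id6, []) = (t1, q1, e1)" by (metis prod_cases3)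
  from transport_lrun[OF this, of edge_val 1] have 2: "transport edge_val (map Mut (map q ks)) (t, id, 1) = (t1, perm_of q1, path_val edge_val e1)"
    and len: "length q1 = 6" by simp_all
  have "transport edge_val (map Mut ks) (t, q, 1) = (t1, perm_of q1 \<circ> q, path_val edge_val e1)"
    using transport_relabel[of edge_val q ks t id 1] 2 by (simp add: comp_def)
  then have 3: "transport edge_val (map Mut ks) (t, q, g) = (t1, perm_of q1 \<circ> q, path_val edge_val e1 * g)"
    using transport_mult_right[of edge_val "map Mut ks" t q 1 t1 "perm_of q1 \<circ> q"
        "path_val edge_val e1" g] by simp
  have "(t1, perm_of q1, path_val edge_val e1 * val []) \<approx> (t', perm_of c, path_val edge_val es * val w)"
    using assms 1 len by (intro agree_same_state) auto
  from same_state_mult_right[OF this, of q g] show ?thesis using 3 by simp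
qed

lemma agree_transport_paths:
  assumes "agree (lrun (map q ks) (t, id6, [])) [] (lrun (map q ms) (t, id6, [])) []"
  shows "transport edge_val (map Mut ks) (t, q, g) \<approx> transport edge_val (map Mut ms) (t, q, g)"
proof -
  obtain t2 q2 e2 where 1: "lrun (map q ms) (t, id6, []) = (t2, q2, e2)" by (metis prod_cases3)
  from transport_lrun[OF this, of edge_val 1] have 2: "transport edge_val (map Mut (map q ms)) (t, id, 1) = (t2, perm_of q2, path_val edge_val e2)"
    by simp
  have "transport edge_val (map Mut ms) (t, q, 1) = (t2, perm_of q2 \<circ> q, path_val edge_val e2)"
    using transport_relabel[of edge_val q ms t id 1] 2 by (simp add: comp_def)
  then have "transport edge_val (map Mut ms) (t, q, g) = (t2, perm_of q2 \<circ> q, path_val edge_val e2 * g)"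
    using transport_mult_right[of edge_val "map Mut ms" t q 1 t2 "perm_of q2 \<circ> q"
        "path_val edge_val e2" g] by simp
  then show ?thesis using agree_transport[OF assms 1] by simp
qed

lemma local_facts:
  assumes "t < 5" shows "k \<in> X6_vertices \<Longrightarrow> involution_ok t k"
    "i \<in> X6_vertices \<Longrightarrow> j \<in> X6_vertices \<Longrightarrow> pair_ok t i j"
proof -
  have "local_ok t" using local_correct assms by (simp add: list_all_upt)
  then show "k \<in> X6_vertices \<Longrightarrow> involution_ok t k"
    "i \<in> X6_vertices \<Longrightarrow> j \<in> X6_vertices \<Longrightarrow> pair_ok t i j"
    by (auto simp: local_ok_def pairs_ok_def list_all_iff in_vertices_iff)
qed

text \<open>
  The relations between permutations and the conjugation relation hold on the nose. The others
  have been checked at the renaming \<open>id\<close>, from which the general case follows by relabelling.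
\<close>

lemma same_state_relation:
  assumes "basic_relation X6_vertices (state_matrix t q) l r" and valid: "valid_state (t, q, g)"
  shows "transport edge_val l (t, q, g) \<approx> transport edge_val r (t, q, g)"
proof -
  have t: "t < 5" and q: "q permutes X6_vertices" using valid by (auto simp: valid_state_def)
  note inI = permutes_in_image[OF q]
  have refl: "st \<approx> st'" if "st = st'"
      "fst st < 5" for st st' :: "nat \<times> (nat \<Rightarrow> nat) \<times> 'g"
    using that same_state_refl by (cases st') auto
  from assms(1) show ?thesis
  proof cases
    case perm_id
    then show ?thesis using t by (intro refl) (simp_all add: inv_id)
  next
    case (perm_comp \<sigma> \<tau>)
    then show ?thesis using t by (intro refl) (simp_all add: o_inv_distrib permutes_bij comp_assoc)
  next
    case (involution k)
    then show ?thesis using agree_transport_paths[of q "[k, k]" t "[]" g] local_facts(1)[OF t, of "q k"] inI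
      by (simp add: involution_ok_def lrun_def)
  next
    case (conjugation \<sigma> k)
    then have "inv_into UNIV (inv_into UNIV \<sigma>) = \<sigma>" "\<sigma> \<circ> inv_into UNIV \<sigma> = id"
      using permutes_inv_inv permutes_inv_o by blast+
    moreover have "edge_target t (q (\<sigma> k)) < 5"
      using edge_facts(1)[OF t] inI permutes_in_image[OF conjugation(3)] conjugation(4) by blast
    ultimately show ?thesis using conjugation by (intro refl) (simp_all add: comp_assoc)
  next
    case (square i j)
    then show ?thesis using agree_transport_paths[of q "[i, j]" t "[j, i]" g] local_facts(2)[OF t, of "q i"
        "q j"] inI
      by (simp add: pair_ok_def state_matrix_def)
  next
    case (pentagon i j)
    then have "agree (lrun (map q [i, j, i, j, i]) (t, id6, [])) [] (t, swap_list (q i) (q j), []) []"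
      using local_facts(2)[OF t, of "q i" "q j"] inI by (auto simp: pair_ok_def state_matrix_def)
    from agree_transport[OF this, of t "swap_list (q i) (q j)" "[]" g] show ?thesis
      using pentagon inI comp_transpose[OF permutes_inj[OF q], of i j] by (simp add: perm_of_swap_list)
  qed
qed

lemma transport_valid_start:
  assumes "w \<in> mutation_seqs X6_vertices" "transport edge_val w (0, id, 1) = (t, q, g)"
  shows "valid_state (t, q, g) \<and> apply_seq w X6 = state_matrix t q"
  using transport_valid[of 0 id 1 w edge_val t q g] assms
      by (simp add: valid_state_def permutes_id state_matrix_id)

lemma same_state_seq_step:
  assumes "seq_step X6_vertices X6 u v"
  shows "u \<in> mutation_seqs X6_vertices \<and> v \<in> mutation_seqs X6_vertices \<and>
    transport edge_val u (0, id, 1) \<approx> transport edge_val v (0, id, 1)"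
  using assms
proof cases
  case (1 u1 v1 l r)
  obtain t q g where st: "transport edge_val v1 (0, id, 1) = (t, q, g)" by (metis prod_cases3)
  with transport_valid_start[OF 1(4) st] have valid: "valid_state (t, q, g)"
      and mat: "apply_seq v1 X6 = state_matrix t q"
    by blast+
  note seqs = basic_relation_seqs[OF 1(5)]
  obtain t1 q1 g1 where st1: "transport edge_val l (t, q, g) = (t1, q1, g1)" by (metis prod_cases3)
  obtain t2 q2 g2 where st2: "transport edge_val r (t, q, g) = (t2, q2, g2)" by (metis prod_cases3)
  have "(t1, q1, g1) \<approx> (t2, q2, g2)"
      using same_state_relation[OF _ valid, of l r] 1(5) mat st1 st2 by simp
  moreover have "valid_state (t1, q1, g1)" using transport_valid[OF valid seqs(1) st1] by blast
  ultimately have "transport edge_val u1 (t1, q1, g1) \<approx> transport edge_val u1 (t2, q2, g2)"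
    using 1(3) by (rule same_state_transport)
  then show ?thesis using 1 seqs st st1 st2 by simp
qed

lemma same_state_seq_eq:
  assumes "seq_eq X6_vertices X6 u v" "u \<in> mutation_seqs X6_vertices"
  shows "transport edge_val u (0, id, 1) \<approx> transport edge_val v (0, id, 1)"
proof -
  have lt: "fst (transport edge_val w (0, id, 1)) < 5" if "w \<in> mutation_seqs X6_vertices" for w
    using transport_valid_start[OF that]
    by (cases "transport edge_val w (0, id, 1)" rule: prod_cases3) (auto simp: valid_state_def)
  have sym: "s1 \<approx> s2 \<Longrightarrow> fst s1 < 5 \<Longrightarrow> s2 \<approx> s1" for s1 s2
    using same_state_sym[of "fst s1" "fst (snd s1)" "snd (snd s1)" "fst s2" "fst (snd s2)"
        "snd (snd s2)"] by simp
  have trans: "s1 \<approx> s2 \<Longrightarrow> s2 \<approx> s3 \<Longrightarrow> fst s1 < 5 \<Longrightarrow> s1 \<approx> s3" for s1 s2 s3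
    using same_state_trans[of "fst s1" "fst (snd s1)" "snd (snd s1)" "fst s2" "fst (snd s2)" "snd (snd s2)"
      "fst s3" "fst (snd s3)" "snd (snd s3)"] by simp
  from assms(1) show ?thesis
  proof (induction rule: equivclp_induct)
    case base
    obtain t q g where st: "transport edge_val u (0, id, 1) = (t, q, g)" by (metis prod_cases3)
    then have "t < 5" using lt[OF assms(2)] by simp
    then show ?case unfolding st by (rule same_state_refl)
  next
    case (step y z)
    from step(2) have "transport edge_val y (0, id, 1) \<approx> transport edge_val z (0, id, 1)"
      using same_state_seq_step[of y z] same_state_seq_step[of z y] lt sym by blast
    with step.IH show ?case by (rule trans) (rule lt[OF assms(2)])
  qed
qed


text \<open>
  The loop \<open>w\<close> has the value \<open>g\<close> once the automorphism of \<open>X6\<close> that is left at its end has been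
  accounted for.
\<close>

definition represents :: "nat letter list \<Rightarrow> 'g \<Rightarrow> bool" where
  "represents w g \<longleftrightarrow> w \<in> mutation_loops X6_vertices X6 \<and> transport edge_val w (0, id, 1) \<approx> (0, id, g)"

lemma represents_append:
  assumes "represents u g" "represents v h" shows "represents (u @ v) (g * h)"
proof -
  obtain t q k where st: "transport edge_val v (0, id, 1) = (t, q, k)" by (metis prod_cases3)
  have seqs: "u \<in> mutation_seqs X6_vertices" "v \<in> mutation_seqs X6_vertices"
    using assms by (auto simp: represents_def mutation_loops_def)
  then have "valid_state (t, q, k)" using transport_valid_start st by blast
  then have 1: "transport edge_val u (t, q, k) \<approx> transport edge_val u (0, id, h)"
    using assms(2) st seqs by (intro same_state_transport) (auto simp: represents_def)
  obtain t1 q1 k1 where st1: "transport edge_val u (0, id, 1) = (t1, q1, k1)" by (metis prod_cases3)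
  then have st2: "transport edge_val u (0, id, h) = (t1, q1, k1 * h)"
    using transport_mult_right[of edge_val u 0 id 1] by fastforce
  have "(t1, q1, k1) \<approx> (0, id, g)" using assms(1) st1 by (simp add: represents_def)
  from same_state_mult_right[OF this, of id h] have 2: "transport edge_val u (0, id, h) \<approx> (0, id, g * h)"
    using st2 by simp
  obtain t3 q3 k3 where st3: "transport edge_val u (t, q, k) = (t3, q3, k3)" by (metis prod_cases3)
  have "t3 < 5" using transport_valid[OF \<open>valid_state (t, q, k)\<close> seqs(1) st3]
      by (simp add: valid_state_def)
  then have "transport edge_val u (t, q, k) \<approx> (0, id, g * h)"
    using same_state_trans[of t3 q3 k3 t1 q1 "k1 * h" 0 id "g * h"] 1 2 st2 st3 by simp
  then show ?thesis using assms st mutation_loops_simps(2) by (auto simp: represents_def)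
qed

lemma same_state_id_unique:
  assumes "(0, id, g) \<approx> (0, id, h)" shows "g = h"
proof -
  from assms obtain \<gamma> where "\<gamma> \<in> set (auts 0)" "perm_of (fst \<gamma>) = id"
      "h = val (snd \<gamma>) * g"
    by (fastforce simp: same_state_def)
  moreover have "perm_of [1, 4, 5, 2, 3, 6] 2 \<noteq> id 2" by (simp add: perm_of_def)
  then have "perm_of [1, 4, 5, 2, 3, 6] \<noteq> id" by metis
  ultimately show ?thesis by (auto simp: auts_def)
qed

lemma represents_unique:
  assumes "represents u g" "represents v h" "seq_eq X6_vertices X6 u v"
  shows "g = h"
proof -
  have seqs: "u \<in> mutation_seqs X6_vertices" "v \<in> mutation_seqs X6_vertices"
    using assms by (auto simp: represents_def mutation_loops_def)
  obtain t1 q1 k1 where st1: "transport edge_val u (0, id, 1) = (t1, q1, k1)" by (metis prod_cases3)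
  obtain t2 q2 k2 where st2: "transport edge_val v (0, id, 1) = (t2, q2, k2)" by (metis prod_cases3)
  have "t1 < 5" using transport_valid_start[OF seqs(1) st1] by (simp add: valid_state_def)
  have "(t1, q1, k1) \<approx> (0, id, g)" "(t2, q2, k2) \<approx> (0, id, h)"
      "(t1, q1, k1) \<approx> (t2, q2, k2)"
    using assms same_state_seq_eq[OF assms(3) seqs(1)] st1 st2 by (auto simp: represents_def)
  then have "(0, id, g) \<approx> (0, id, h)"
    using same_state_sym[of t1 q1 k1 0 id g] same_state_trans[of 0 id g t1 q1 k1 t2 q2 k2]
      same_state_trans[of 0 id g t2 q2 k2 0 id h] \<open>t1 < 5\<close> by simp
  then show ?thesis by (rule same_state_id_unique)
qed

lemma represents_nil: "represents [] 1"
  using same_state_refl[of 0] by (simp add: represents_def mutation_loops_simps)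

lemma represents_perm_mut:
  assumes "agree (lrun ks (0, id6, [])) [] (0, c, []) w" and "perm_of c permutes X6_vertices"
    and "set ks \<subseteq> X6_vertices" and "apply_seq (Perm (perm_of c) # map Mut ks) X6 = X6"
  shows "represents (Perm (perm_of c) # map Mut ks) (val w)"
proof -
  obtain t q g where st: "transport edge_val (map Mut ks) (0, id, 1) = (t, q, g)" by (metis prod_cases3)
  have "(t, q, g) \<approx> (0, perm_of c, val w)"
    using agree_transport[of id ks 0 "(0, c, [])" w 0 c "[]" 1] assms(1) st by simp
  from same_state_mult_right[OF this, of "inv_into UNIV (perm_of c)" 1]
  have "transport edge_val (Perm (perm_of c) # map Mut ks) (0, id, 1) \<approx> (0, id, val w)"
    using st permutes_inv_o[OF assms(2)] by simp
  moreover have "map Mut ks \<in> mutation_seqs X6_vertices" using assms(3) by (induction ks) auto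
  ultimately show ?thesis using assms by (simp add: represents_def mutation_loops_def)
qed

end

section \<open>The cluster modular group as a type\<close>

typedef gamma_X6 = "carrier Gamma_X6"
  using monoid.one_closed[OF group.is_monoid[OF saturated_cmg_group]] by blast

interpretation Gamma: group Gamma_X6 by (rule saturated_cmg_group)

instantiation gamma_X6 :: mult_group
begin

definition "one_gamma_X6 = Abs_gamma_X6 \<one>\<^bsub>Gamma_X6\<^esub>"
definition "times_gamma_X6 x y = Abs_gamma_X6 (Rep_gamma_X6 x \<otimes>\<^bsub>Gamma_X6\<^esub> Rep_gamma_X6 y)"
definition "ginv_gamma_X6 x = Abs_gamma_X6 (inv\<^bsub>Gamma_X6\<^esub> Rep_gamma_X6 x)"

lemma Rep_gamma_X6_simps:
  "Rep_gamma_X6 1 = \<one>\<^bsub>Gamma_X6\<^esub>"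
      "Rep_gamma_X6 (x * y) = Rep_gamma_X6 x \<otimes>\<^bsub>Gamma_X6\<^esub> Rep_gamma_X6 y"
  "Rep_gamma_X6 (ginv x) = inv\<^bsub>Gamma_X6\<^esub> Rep_gamma_X6 x"
  using Rep_gamma_X6
      by (simp_all add: one_gamma_X6_def times_gamma_X6_def ginv_gamma_X6_def Abs_gamma_X6_inverse)

instance
  by standard (simp_all add: Rep_gamma_X6_simps Gamma.m_assoc Rep_gamma_X6 flip: Rep_gamma_X6_inject)

end

abbreviation loops :: "nat letter list set" where "loops \<equiv> mutation_loops X6_vertices X6"
abbreviation seqs :: "nat letter list set" where "seqs \<equiv> mutation_seqs X6_vertices"
abbreviation eq_seq (infix "\<simeq>" 50) where "u \<simeq> v \<equiv> seq_eq X6_vertices X6 u v"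

definition loop_class :: "nat letter list \<Rightarrow> gamma_X6" where
  "loop_class w = Abs_gamma_X6 (loop_equiv X6_vertices X6 `` {w})"

lemma Rep_loop_class: "w \<in> loops \<Longrightarrow> Rep_gamma_X6 (loop_class w) = loop_equiv X6_vertices X6 `` {w}"
  unfolding loop_class_def
      by (rule Abs_gamma_X6_inverse) (simp add: saturated_cmg_def word_quotient_def quotientI)

lemma loop_class_append: "u \<in> loops \<Longrightarrow> v \<in> loops \<Longrightarrow> loop_class (u @ v) = loop_class u * loop_class v"
  by (simp add: Rep_loop_class Rep_gamma_X6_simps mutation_loops_simps saturated_cmg_mult flip: Rep_gamma_X6_inject)

lemma loop_class_eq_iff:
  assumes "u \<in> loops" "v \<in> loops" shows "loop_class u = loop_class v \<longleftrightarrow> u \<simeq> v"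
proof -
  have "loop_class u = loop_class v \<longleftrightarrow> (u, v) \<in> loop_equiv X6_vertices X6"
    using eq_equiv_class_iff[OF equiv_loop_equiv assms] assms
        by (simp add: Rep_loop_class flip: Rep_gamma_X6_inject)
  then show ?thesis using assms by (simp add: loop_equiv_def)
qed

lemma loop_class_nil: "loop_class [] = 1"
  by (simp add: one_gamma_X6_def loop_class_def saturated_cmg_def word_quotient_def)

lemma loop_class_eqI: "u \<simeq> v \<Longrightarrow> u \<in> loops \<Longrightarrow> v \<in> loops \<Longrightarrow> loop_class u = loop_class v"
  using loop_class_eq_iff by blast

lemma loop_class_eq_one: "u \<simeq> [] \<Longrightarrow> u \<in> loops \<Longrightarrow> loop_class u = 1"
  using loop_class_eqI[OF _ _ mutation_loops_simps(1)] loop_class_nil by metis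

lemma loop_class_surj: "\<exists>w \<in> loops. g = loop_class w"
proof -
  have "Rep_gamma_X6 g \<in> loops // loop_equiv X6_vertices X6"
    using Rep_gamma_X6[of g] by (simp add: saturated_cmg_def word_quotient_def)
  then obtain w where "w \<in> loops" "Rep_gamma_X6 g = loop_equiv X6_vertices X6 `` {w}" by (rule quotientE)
  then show ?thesis using Rep_loop_class by (auto simp flip: Rep_gamma_X6_inject)
qed

lemma seq_eq_perm_comp:
  assumes "\<sigma> permutes I" "\<tau> permutes I" "u \<in> mutation_seqs I" "v \<in> mutation_seqs I"
  shows "seq_eq I \<epsilon> (u @ Perm \<sigma> # Perm \<tau> # v) (u @ Perm (\<sigma> \<circ> \<tau>) # v)"
  using seq_eq_basic[OF assms(3,4) basic_relation.perm_comp[OF assms(1,2)]] by simp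

lemma seq_eq_mut_perm:
  assumes "\<sigma> permutes I" "k \<in> I" "u \<in> mutation_seqs I" "v \<in> mutation_seqs I"
  shows "seq_eq I \<epsilon> (u @ Mut (\<sigma> k) # Perm \<sigma> # v) (u @ Perm \<sigma> # Mut k # v)"
proof -
  have "seq_eq I \<epsilon> (u @ [Mut (\<sigma> k)] @ Perm \<sigma> # v) (u @ [Perm \<sigma>, Mut k, Perm (inv_into UNIV \<sigma>)] @ Perm \<sigma> # v)"
    using seq_eq_basic[OF assms(3) _ basic_relation.conjugation[OF assms(1,2)], of "Perm \<sigma> # v" \<epsilon>] assms
    by (simp add: equivclp_sym[of _ "u @ Perm \<sigma> # Mut k # Perm (inv_into UNIV \<sigma>) # Perm \<sigma> # v"])
  moreover have "seq_eq I \<epsilon> ((u @ [Perm \<sigma>, Mut k]) @ [inv_letter (Perm \<sigma>), Perm \<sigma>] @ v) ((u @ [Perm \<sigma>, Mut k]) @ v)"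
    using assms by (intro seq_eq_inv_letter) auto
  ultimately have "seq_eq I \<epsilon> (u @ [Mut (\<sigma> k)] @ Perm \<sigma> # v) ((u @ [Perm \<sigma>, Mut k]) @ v)"
    using equivclp_trans by simp
  then show ?thesis by simp
qed


section \<open>Edges and automorphisms as classes of loops\<close>

text \<open>
  The base paths run through the spanning tree from \<open>X6\<close> to the five quivers; the last mutation of a
  path comes first in the list.
\<close>

definition base_path :: "nat \<Rightarrow> nat list" where
  "base_path t = (if t = 1 then [1] else if t = 2 then [6] else if t = 3 then [2, 1] else if t = 4 then [6, 1] else [])"

definition base :: "nat \<Rightarrow> nat letter list" where
  "base t = map Mut (base_path t)"

definition base_path_ok :: "nat \<Rightarrow> bool" where
  "base_path_ok t \<longleftrightarrow> fst (lrun (base_path t) (0, id6, [])) = t \<and> fst (snd (lrun (base_path t) (0, id6, []))) = id6"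

lemma base_paths_ok: "list_all base_path_ok [0..<5]"
  by code_simp

lemma base_seqs [simp]: "base t \<in> seqs" "inv_seq (base t) \<in> seqs"
  by (auto simp: base_def base_path_def X6_vertices_def)

lemma base_transport:
  assumes "t < 5" shows "\<exists>g. transport E (base t) (0, id, 1) = (t, id, g)"
proof -
  have "base_path_ok t" using base_paths_ok assms by (simp add: list_all_upt)
  moreover obtain t' qs es where 1: "lrun (base_path t) (0, id6, []) = (t', qs, es)" by (metis prod_cases3)
  ultimately have "t' = t" "qs = id6" by (auto simp: base_path_ok_def)
  then show ?thesis using transport_lrun[OF 1, of E 1] by (simp add: base_def)
qed

lemma transport_start:
  assumes "w \<in> seqs" "transport E w (0, id, 1) = (t, q, g)"
  shows "t < 5" "q permutes X6_vertices" "apply_seq w X6 = state_matrix t q"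
  using transport_valid[of 0 id 1 w E t q g] assms
      by (simp_all add: valid_state_def permutes_id state_matrix_id)

lemma apply_base: "t < 5 \<Longrightarrow> apply_seq (base t) X6 = quiver t"
  using base_transport[of t "\<lambda>t j. 1 :: nat"] transport_start(3)[OF base_seqs(1)]
  by (fastforce simp: state_matrix_def)

lemma apply_inv_base: "t < 5 \<Longrightarrow> apply_seq (inv_seq (base t)) (quiver t) = X6"
  using apply_inv_seq[OF base_seqs(1)] apply_base by metis

lemma permute_state_matrix: "q permutes X6_vertices \<Longrightarrow> permute_matrix q (state_matrix t q) = quiver t"
  by (simp add: permute_matrix_def state_matrix_def permutes_inverses)

text \<open>
  A sequence that ends at a relabelled quiver becomes a loop when the labels are put right and the base
  path is followed back.
\<close>

definition close_up :: "nat \<Rightarrow> (nat \<Rightarrow> nat) \<Rightarrow> nat letter list \<Rightarrow> nat letter list" where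
  "close_up t q w = inv_seq (base t) @ Perm q # w"

lemma close_up_loop:
  assumes "w \<in> seqs" "apply_seq w X6 = state_matrix t q" "t < 5" "q permutes X6_vertices"
  shows "close_up t q w \<in> loops"
  using assms
      by (simp add: close_up_def mutation_loops_def apply_seq_append permute_state_matrix apply_inv_base)

definition edge_elt :: "nat \<Rightarrow> nat \<Rightarrow> gamma_X6" where
  "edge_elt t j = loop_class (close_up (edge_target t j) (perm_of (edge_relabel t j)) (Mut j # base t))"

definition aut_elt :: "nat \<Rightarrow> nat list \<Rightarrow> gamma_X6" where
  "aut_elt t ps = loop_class (close_up t (perm_of ps) (base t))"

lemma edge_loop:
  assumes "t < 5" "j \<in> X6_vertices"
  shows "close_up (edge_target t j) (perm_of (edge_relabel t j)) (Mut j # base t) \<in> loops"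
  using assms edge_facts[OF assms] by (intro close_up_loop) (auto simp: apply_base)

lemma aut_loop:
  assumes "t < 5" "(ps, w) \<in> set (auts t)"
  shows "close_up t (perm_of ps) (base t) \<in> loops"
  using assms aut_facts[OF assms] by (intro close_up_loop) (auto simp: apply_base)

text \<open>
  When loops are composed, the base path of the quiver in the middle is walked back and forth and cancels.
\<close>

lemma loop_class_close_close:
  assumes "close_up t' q' (v @ base t) \<in> loops" "close_up t q w \<in> loops" "v \<in> seqs" "w \<in> seqs"
    "q permutes X6_vertices" "q' permutes X6_vertices"
    and eq: "close_up t' q' (v @ Perm q # w) \<simeq> u" "u \<in> loops"
  shows "loop_class (close_up t' q' (v @ base t)) * loop_class (close_up t q w) = loop_class u"
proof -
  have "close_up t' q' (v @ base t) @ close_up t q w \<simeq> close_up t' q' (v @ Perm q # w)"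
    using seq_eq_append_left[OF seq_eq_inv_seq'[of "base t" X6_vertices "Perm q # w"], of "inv_seq (base t') @ Perm q' # v"] assms
    by (simp add: close_up_def)
  from equivclp_trans[OF this eq(1)] have "close_up t' q' (v @ base t) @ close_up t q w \<simeq> u" .
  then have "loop_class (close_up t' q' (v @ base t) @ close_up t q w) = loop_class u"
    by (rule loop_class_eqI) (rule mutation_loops_simps(2)[OF assms(1,2)], rule \<open>u \<in> loops\<close>)
  then show ?thesis using loop_class_append[OF assms(1,2)] by simp
qed

text \<open>
  Transport computes the class of a sequence in the cluster modular group: every sequence, closed
  up, is equivalent to the product of the closed-up edges that it passes. In the induction step the
  renaming \<open>q\<^sub>1\<close> is moved across the new mutation by the conjugation relation, and then the base path
  of the intermediate quiver is inserted.
\<close>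

lemma transport_edge_elt:
  assumes "w \<in> seqs" "transport edge_elt w (0, id, 1) = (t, q, g)"
  shows "g = loop_class (close_up t q w)"
proof -
  define start :: "nat \<times> (nat \<Rightarrow> nat) \<times> gamma_X6" where start: "start = (0, id, 1)"
  have "w \<in> seqs \<Longrightarrow> transport edge_elt w start = (t, q, g) \<Longrightarrow> g = loop_class (close_up t q w)"
  proof (induction w arbitrary: t q g)
    case Nil
    have "close_up 0 id [] \<simeq> []"
      using seq_eq_basic[of "[]" X6_vertices "[]" X6, OF _ _ basic_relation.perm_id]
      by (simp add: close_up_def base_def base_path_def)
    moreover have "close_up 0 id [] \<in> loops"
        by (rule close_up_loop) (auto simp: state_matrix_id permutes_id)
    ultimately have "loop_class (close_up 0 id []) = 1" by (rule loop_class_eq_one)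
    moreover have "t = 0" "q = id" "g = 1" using Nil by (auto simp: start)
    ultimately show ?case by (simp only:)
  next
    case (Cons l w)
    obtain t1 q1 g1 where st: "transport edge_elt w start = (t1, q1, g1)" by (metis prod_cases3)
    have w: "w \<in> seqs" using Cons.prems by simp
    with Cons.IH[OF _ st] have g1: "g1 = loop_class (close_up t1 q1 w)" by simp
    note pos = transport_start[OF w st[unfolded start]]
    have loop1: "close_up t1 q1 w \<in> loops" using close_up_loop[OF w] pos by blast
    have loop: "close_up t q (l # w) \<in> loops"
      using transport_start[OF Cons.prems[unfolded start]] Cons.prems(1) by (intro close_up_loop) auto
    show ?case
    proof (cases l)
      case (Mut k)
      define j r where jr: "j = q1 k" "r = perm_of (edge_relabel t1 (q1 k))"
      have k: "k \<in> X6_vertices" and j: "j \<in> X6_vertices"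
          using Cons.prems(1) Mut permutes_in_image[OF pos(2)] by (auto simp: jr)
      have tqg: "t = edge_target t1 j" "q = r \<circ> q1" "g = edge_elt t1 j * g1" using Cons.prems(2) Mut st
          by (auto simp: jr)
      have r: "r permutes X6_vertices" using edge_facts(2)[OF pos(1) j] by (simp add: jr)
      have "close_up t r ([Mut j] @ Perm q1 # w) \<simeq> close_up t r (Perm q1 # Mut k # w)"
        using seq_eq_mut_perm[OF pos(2) k, of "inv_seq (base t) @ [Perm r]" w] w r
            by (simp add: close_up_def jr)
      also have "close_up t r (Perm q1 # Mut k # w) \<simeq> close_up t q (Mut k # w)"
        using seq_eq_perm_comp[OF r pos(2), of "inv_seq (base t)" "Mut k # w"] w k
            by (simp add: close_up_def tqg)
      finally have "close_up t r ([Mut j] @ Perm q1 # w) \<simeq> close_up t q (l # w)" using Mut by simp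
      then have "loop_class (close_up t r ([Mut j] @ base t1)) * loop_class (close_up t1 q1 w) = loop_class (close_up t q (l # w))"
        using edge_loop[OF pos(1) j] loop1 loop w r pos(2) j
            by (intro loop_class_close_close) (auto simp: tqg jr)
      then have "g = loop_class (close_up t q (l # w))" by (simp add: tqg g1 edge_elt_def jr)
      then show ?thesis .
    next
      case (Perm \<tau>)
      then have \<tau>: "\<tau> permutes X6_vertices" using Cons.prems(1) by simp
      have tqg: "t = t1" "q = q1 \<circ> inv_into UNIV \<tau>" "g = g1" using Cons.prems(2) Perm st by auto
      have "q permutes X6_vertices" using transport_start(2)[OF Cons.prems[unfolded start]] .
      then have "close_up t q (l # w) \<simeq> close_up t1 (q \<circ> \<tau>) w"
        using seq_eq_perm_comp[of q X6_vertices \<tau> "inv_seq (base t1)" w] \<tau> w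
            by (simp add: close_up_def tqg Perm)
      moreover have "q \<circ> \<tau> = q1" using permutes_inv_o[OF \<tau>] by (simp add: tqg comp_assoc)
      ultimately have "close_up t q (l # w) \<simeq> close_up t1 q1 w" by simp
      from loop_class_eqI[OF this loop loop1] have "g = loop_class (close_up t q (l # w))" using g1 tqg by simp
      then show ?thesis .
    qed
  qed
  with assms show ?thesis by (simp add: start)
qed

lemma loop_class_close_aut:
  assumes "t < 5" "(ps, x) \<in> set (auts t)" "w \<in> seqs" "apply_seq w X6 = state_matrix t q"
      "q permutes X6_vertices"
    and "close_up t (perm_of ps \<circ> q) w \<simeq> u" "u \<in> loops"
  shows "aut_elt t ps * loop_class (close_up t q w) = loop_class u"
proof -
  note aut = aut_facts[OF assms(1,2)]
  have "close_up t (perm_of ps) (Perm q # w) \<simeq> close_up t (perm_of ps \<circ> q) w"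
    using seq_eq_perm_comp[OF aut(1) assms(5), of "inv_seq (base t)" w] assms by (simp add: close_up_def)
  from equivclp_trans[OF this assms(6)] have "close_up t (perm_of ps) ([] @ Perm q # w) \<simeq> u" by simp
  then have "loop_class (close_up t (perm_of ps) ([] @ base t)) * loop_class (close_up t q w) = loop_class u"
    using aut_loop[OF assms(1,2)] aut(1) assms close_up_loop by (intro loop_class_close_close) auto
  then show ?thesis by (simp add: aut_elt_def)
qed

lemma transport_edge_elt_base:
  assumes "t < 5" shows "transport edge_elt (base t) (0, id, 1) = (t, id, 1)"
proof -
  obtain g where g: "transport edge_elt (base t) (0, id, 1) = (t, id, g)" using base_transport[OF assms]
      by blast
  have "close_up t id (base t) \<simeq> inv_seq (base t) @ base t"
    using seq_eq_basic[of "inv_seq (base t)" X6_vertices "base t" X6, OF _ _ basic_relation.perm_id]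
        by (simp add: close_up_def)
  also have "inv_seq (base t) @ base t \<simeq> []" using seq_eq_inv_seq[of "base t" X6_vertices "[]"] by simp
  finally have "close_up t id (base t) \<simeq> []" .
  moreover have "close_up t id (base t) \<in> loops"
    using assms by (intro close_up_loop) (auto simp: apply_base state_matrix_def permutes_id)
  ultimately have "loop_class (close_up t id (base t)) = 1" by (rule loop_class_eq_one)
  then show ?thesis using transport_edge_elt[OF base_seqs(1) g] g by simp
qed

text \<open>
  Read after the base path of \<open>t\<close>, the two sides of a relation are equivalent, and their transports
  compute the two classes. The renamings at the end may differ by an automorphism, which contributes its
  own class.
\<close>

lemma relation_in_gamma:
  assumes "t < 5" "basic_relation X6_vertices (quiver t) l r"
    and st1: "transport edge_elt l (t, id, 1) = (t1, q1, g1)"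
        and st2: "transport edge_elt r (t, id, 1) = (t1, perm_of ps \<circ> q1, g2)"
    and ps: "(ps, w) \<in> set (auts t1)"
  shows "g2 = aut_elt t1 ps * g1"
proof -
  note seqs = basic_relation_seqs[OF assms(2)]
  have 1: "transport edge_elt (l @ base t) (0, id, 1) = (t1, q1, g1)"
      and 2: "transport edge_elt (r @ base t) (0, id, 1) = (t1, perm_of ps \<circ> q1, g2)"
    using st1 st2 transport_edge_elt_base[OF assms(1)] by simp_all
  have lseq: "l @ base t \<in> seqs" and rseq: "r @ base t \<in> seqs" using seqs by simp_all
  note start1 = transport_start[OF lseq 1] and start2 = transport_start[OF rseq 2]
  have "l @ base t \<simeq> r @ base t"
    using seq_eq_basic[of "[]" X6_vertices "base t" X6 l r] assms(1,2) by (simp add: apply_base)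
  then have "close_up t1 (perm_of ps \<circ> q1) (l @ base t) \<simeq> close_up t1 (perm_of ps \<circ> q1) (r @ base t)"
    using seq_eq_append_left[of X6_vertices X6 _ _ "inv_seq (base t1) @ [Perm (perm_of ps \<circ> q1)]"] start2(2)
    by (simp add: close_up_def)
  then have "aut_elt t1 ps * loop_class (close_up t1 q1 (l @ base t)) = loop_class (close_up t1 (perm_of ps \<circ> q1) (r @ base t))"
    using start1 start2 lseq rseq ps by (intro loop_class_close_aut[where x = w] close_up_loop) auto
  then show ?thesis using transport_edge_elt[OF lseq 1] transport_edge_elt[OF rseq 2] by simp
qed

section \<open>The local relations in the cluster modular group\<close>

lemma lrun_transport:
  assumes "lrun ks (t, id6, []) = (t', qs, es)"
  shows "transport edge_elt (map Mut ks) (t, id, 1) = (t', perm_of qs, path_val edge_elt es)" "length qs = 6"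
  using transport_lrun[OF assms, of edge_elt 1] by simp_all

lemma square_in_gamma:
  assumes "t < 5" "i \<in> X6_vertices" "j \<in> X6_vertices" "quiver t i j = 0"
    and "lrun [i, j] (t, id6, []) = (t1, q1, e1)" "lrun [j, i] (t, id6, []) = (t1, map (perm_of ps) q1, e2)"
    and "List.member (auts t1) (ps, w)"
  shows "aut_elt t1 ps * path_val edge_elt e1 = path_val edge_elt e2"
proof -
  have rel: "basic_relation X6_vertices (quiver t) [Mut i, Mut j] [Mut j, Mut i]"
    using assms by (intro basic_relation.square)
  note 1 = lrun_transport[OF assms(5)] and 2 = lrun_transport[OF assms(6)]
  show ?thesis
    using relation_in_gamma[OF assms(1) rel, of t1 "perm_of q1"
        "path_val edge_elt e1" ps "path_val edge_elt e2" w] 1 2 assms(7)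
    by (simp add: perm_of_map)
qed

lemma involution_in_gamma:
  assumes "t < 5" "k \<in> X6_vertices"
    and "lrun [k, k] (t, id6, []) = (t, q1, e1)" "map (perm_of ps) q1 = id6" "List.member (auts t) (ps, w)"
  shows "aut_elt t ps * path_val edge_elt e1 = 1"
proof -
  have rel: "basic_relation X6_vertices (quiver t) [Mut k, Mut k] []"
    using assms by (intro basic_relation.involution)
  note 1 = lrun_transport[OF assms(3)]
  have "perm_of ps \<circ> perm_of q1 = id" using perm_of_map[OF 1(2), of ps] assms(4) by simp
  then show ?thesis
    using relation_in_gamma[OF assms(1) rel, of t "perm_of q1" "path_val edge_elt e1" ps 1 w] 1 assms(5) by simp
qed

lemma pentagon_in_gamma:
  assumes "t < 5" "i \<in> X6_vertices" "j \<in> X6_vertices" "quiver t i j = 1 \<or> quiver t i j = - 1"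
    and "lrun [i, j, i, j, i] (t, id6, []) = (t, q1, e1)" "map (perm_of ps) q1 = swap_list i j"
    and "List.member (auts t) (ps, w)"
  shows "aut_elt t ps * path_val edge_elt e1 = 1"
proof -
  have rel: "basic_relation X6_vertices (quiver t) [Mut i, Mut j, Mut i, Mut j, Mut i] [Perm (transpose i j)]"
    using assms by (intro basic_relation.pentagon)
  note 1 = lrun_transport[OF assms(5)]
  have "perm_of ps \<circ> perm_of q1 = transpose i j"
    using perm_of_map[OF 1(2), of ps] assms(6) perm_of_swap_list[OF assms(2,3)] by simp
  then show ?thesis
    using relation_in_gamma[OF assms(1) rel, of t "perm_of q1" "path_val edge_elt e1" ps 1 w] 1 assms(7) by simp
qed

lemma aut_elt_mult:
  assumes "t < 5" "List.member (auts t) (ps, w)" "List.member (auts t) (ps', w')"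
    "List.member (auts t) (ps'', w'')" and ps'': "map (perm_of ps) ps' = ps''"
  shows "aut_elt t ps * aut_elt t ps' = aut_elt t ps''"
proof -
  have in1: "(ps, w) \<in> set (auts t)" "(ps', w') \<in> set (auts t)"
      "(map (perm_of ps) ps', w'') \<in> set (auts t)"
    using assms(2-4) unfolding ps'' by simp_all
  note aut' = aut_facts[OF assms(1) in1(2)]
  have "aut_elt t ps * loop_class (close_up t (perm_of ps') (base t)) = loop_class (close_up t (perm_of (map (perm_of ps) ps')) (base t))"
    using aut' aut_loop[OF assms(1) in1(3)]
    by (intro loop_class_close_aut[OF assms(1) in1(1)]) (auto simp: apply_base[OF assms(1)] perm_of_map)
  then show ?thesis by (simp add: aut_elt_def flip: ps'')
qed

text \<open>
  Both sides are the class of the sequence \<open>Mut k\<close> after the base path, closed up by \<open>r \<circ> ps\<close>.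
\<close>

lemma aut_elt_natural:
  assumes "t < 5" "k \<in> X6_vertices" "List.member (auts t) (ps, w)"
      "List.member (auts (edge_target t k)) (ps', w')"
    and "edge_target t (perm_of ps k) = edge_target t k"
    and "map (perm_of ps') (edge_relabel t k) = map (perm_of (edge_relabel t (perm_of ps k))) ps"
    and "perm_of ps k = k'" "edge_target t k = t'"
  shows "edge_elt t k' * aut_elt t ps = aut_elt t' ps' * edge_elt t k"
proof -
  define r where r_def: "r = edge_relabel t (perm_of ps k)"
  note defs = assms(8)[symmetric] r_def
  have in1: "(ps, w) \<in> set (auts t)" "(ps', w') \<in> set (auts t')"
    using assms(3,4,8) by simp_all
  note aut = aut_facts[OF assms(1) in1(1)]
  have k': "perm_of ps k \<in> X6_vertices" using permutes_in_image[OF aut(1)] assms(2) by simp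
  note edge = edge_facts[OF assms(1,2)] and edge' = edge_facts[OF assms(1) k']
  have t': "t' < 5" using edge by (simp add: defs)
  have r: "perm_of r permutes X6_vertices" using edge'(2) by (simp add: defs)
  have rel: "perm_of ps' \<circ> perm_of (edge_relabel t k) = perm_of r \<circ> perm_of ps"
    using perm_of_map[of "edge_relabel t k" ps'] perm_of_map[of ps r] aut(2) edge(3) assms(6)
        by (simp add: defs)
  let ?w = "Mut k # base t"
  have w: "?w \<in> seqs" "apply_seq ?w X6 = state_matrix t' (perm_of (edge_relabel t k))"
    using assms(1,2) edge(4) by (simp_all add: apply_base defs)
  have u: "close_up t' (perm_of r \<circ> perm_of ps) ?w \<in> loops"
    unfolding rel[symmetric] using w t' aut_facts[OF t' in1(2)] edge(2)
    by (intro close_up_loop) (auto simp: permutes_compose state_matrix_def fun_eq_iff)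
  have "close_up t' (perm_of r) ([Mut (perm_of ps k)] @ Perm (perm_of ps) # base t) \<simeq> close_up t' (perm_of r) (Perm (perm_of ps) # ?w)"
    using seq_eq_mut_perm[OF aut(1) assms(2), of "inv_seq (base t') @ [Perm (perm_of r)]" "base t"] r
        by (simp add: close_up_def)
  moreover have "close_up t' (perm_of r) (Perm (perm_of ps) # ?w) \<simeq> close_up t' (perm_of r \<circ> perm_of ps) ?w"
    using seq_eq_perm_comp[OF r aut(1), of "inv_seq (base t')" ?w] w(1) by (simp add: close_up_def)
  ultimately have "close_up t' (perm_of r) ([Mut (perm_of ps k)] @ Perm (perm_of ps) # base t) \<simeq> close_up t' (perm_of r \<circ> perm_of ps) ?w"
    by (rule equivclp_trans)
  then have "loop_class (close_up t' (perm_of r) ([Mut (perm_of ps k)] @ base t)) * loop_class (close_up t (perm_of ps) (base t)) = loop_class (close_up t' (perm_of r \<circ> perm_of ps) ?w)"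
    using edge_loop[OF assms(1) k'] aut_loop[OF assms(1) in1(1)] u aut r k'
    by (intro loop_class_close_close) (auto simp: defs assms(5))
  moreover have "aut_elt t' ps' * loop_class (close_up t' (perm_of (edge_relabel t k)) ?w) = loop_class (close_up t' (perm_of r \<circ> perm_of ps) ?w)"
    using w edge(2) u by (intro loop_class_close_aut[OF t' in1(2)]) (auto simp: rel)
  ultimately show ?thesis by (simp add: edge_elt_def aut_elt_def defs assms(5) assms(7)[symmetric])
qed

lemma aut_elt_id:
  assumes "t < 5" shows "aut_elt t [1, 2, 3, 4, 5, 6] = 1"
proof -
  have m: "List.member (auts t) ([1, 2, 3, 4, 5, 6], [])" by (auto simp: auts_def)
  have p: "map (perm_of [1, 2, 3, 4, 5, 6]) [1, 2, 3, 4, 5, 6] = [1, 2, 3, 4, 5, 6]" by code_simp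
  have "aut_elt t [1, 2, 3, 4, 5, 6] * aut_elt t [1, 2, 3, 4, 5, 6] = aut_elt t [1, 2, 3, 4, 5, 6]"
    by (rule aut_elt_mult[OF assms m m m p])
  then show ?thesis by (metis mult_1_right mult_left_cancel_group)
qed

text \<open>
  An equation between products determines a factor that occurs in it once.
\<close>

lemma mid_unique:
  fixes z :: "'a::mult_group"
  shows "p * (z * q) = r \<Longrightarrow> p * (W * q) = r \<Longrightarrow> z = W"
  by (metis mult_left_cancel_group mult_right_cancel_group)

lemma edge_elt_tree: "edge_elt 0 1 = 1" "edge_elt 0 6 = 1" "edge_elt 1 2 = 1" "edge_elt 1 6 = 1"
proof -
  have 1: "path_val edge_elt (snd (snd (lrun (base_path t) (0, id6, [])))) = 1" if "t < 5" for t
    using lrun_transport[of "base_path t" 0] transport_edge_elt_base[OF that]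
    by (cases "lrun (base_path t) (0, id6, [])" rule: prod_cases3) (auto simp: base_def)
  have *: "lrun (base_path 1) (0, id6, []) = (1, id6, [(0, 1)])"
      "lrun (base_path 2) (0, id6, []) = (2, id6, [(0, 6)])"
     "lrun (base_path 3) (0, id6, []) = (3, id6, [(1, 2), (0, 1)])"
         "lrun (base_path 4) (0, id6, []) = (4, id6, [(1, 6), (0, 1)])"
    by code_simp+
  show "edge_elt 0 1 = 1" "edge_elt 0 6 = 1" using 1[of 1] 1[of 2] * by simp_all
  then show "edge_elt 1 2 = 1" "edge_elt 1 6 = 1" using 1[of 3] 1[of 4] * by simp_all
qed

text \<open>
  Each step below takes a local relation in which a single edge or automorphism is still unknown, and
  solves for it. The arguments of the rules describe the instance: the quiver, the vertices, the
  renaming and the edges along the path, and the automorphism at the end with its word.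
\<close>

lemma edge_values:
  defines "a \<equiv> edge_elt 0 2" and "x \<equiv> edge_elt 3 3" and "s \<equiv> aut_elt 0 [1, 4, 5, 2, 3, 6]"
  shows "axs_relations a x s"
    and "t < 5 \<Longrightarrow> j \<in> X6_vertices \<Longrightarrow> edge_elt t j = axs_group.edge_val a x s t j"
proof -
  let ?i = "[1, 2, 3, 4, 5, 6]" and ?\<sigma> = "[1, 4, 5, 2, 3, 6]"
  have s2: "s * s = 1"
  proof -
    have "aut_elt 0 [1, 4, 5, 2, 3, 6] * aut_elt 0 [1, 4, 5, 2, 3, 6] = aut_elt 0 [1, 2, 3, 4, 5, 6]"
      by (rule aut_elt_mult[of _ _ "[(Elt_s, True)]" _ "[(Elt_s, True)]" _ "[]"]; code_simp)
    then show ?thesis using aut_elt_id[of 0] by (simp add: s_def)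
  qed
  note ss = involution_conj[OF s2]
  have "aut_elt t [1, 2, 3, 4, 5, 6] = 1" if "t < 5" for t using that by (rule aut_elt_id)
  then have ids: "aut_elt 0 [1, 2, 3, 4, 5, 6] = 1" "aut_elt 1 [1, 2, 3, 4, 5, 6] = 1"
      "aut_elt 2 [1, 2, 3, 4, 5, 6] = 1"
    "aut_elt 3 [1, 2, 3, 4, 5, 6] = 1" "aut_elt 4 [1, 2, 3, 4, 5, 6] = 1" by simp_all
  note known = edge_elt_tree ids a_def[symmetric] x_def[symmetric] s_def[symmetric]
  \<comment> \<open>Walking a tree edge back is trivial as well, since mutations are involutions.\<close>
  have r1: "aut_elt 0 ?i * path_val edge_elt [(1, 1), (0, 1)] = 1"
    by (rule involution_in_gamma[of 0 1 "?i" "[(1, 1), (0, 1)]" "?i" "[]"]; code_simp)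
  have e_11: "edge_elt 1 1 = 1"
    by (rule mid_unique[of "aut_elt 0 ?i" _ "edge_elt 0 1" "1"])
      (use r1 in \<open>simp_all add: known mult.assoc ss del: One_nat_def\<close>)
  note known = known e_11
  have r2: "aut_elt 0 ?i * path_val edge_elt [(2, 6), (0, 6)] = 1"
    by (rule involution_in_gamma[of 0 6 "?i" "[(2, 6), (0, 6)]" "?i" "[]"]; code_simp)
  have e_26: "edge_elt 2 6 = 1"
    by (rule mid_unique[of "aut_elt 0 ?i" _ "edge_elt 0 6" "1"])
      (use r2 in \<open>simp_all add: known mult.assoc ss del: One_nat_def\<close>)
  note known = known e_26
  have r3: "aut_elt 1 ?i * path_val edge_elt [(3, 2), (1, 2)] = 1"
    by (rule involution_in_gamma[of 1 2 "?i" "[(3, 2), (1, 2)]" "?i" "[]"]; code_simp)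
  have e_32: "edge_elt 3 2 = 1"
    by (rule mid_unique[of "aut_elt 1 ?i" _ "edge_elt 1 2" "1"])
      (use r3 in \<open>simp_all add: known mult.assoc ss del: One_nat_def\<close>)
  note known = known e_32
  have r4: "aut_elt 1 ?i * path_val edge_elt [(4, 6), (1, 6)] = 1"
    by (rule involution_in_gamma[of 1 6 "?i" "[(4, 6), (1, 6)]" "?i" "[]"]; code_simp)
  have e_46: "edge_elt 4 6 = 1"
    by (rule mid_unique[of "aut_elt 1 ?i" _ "edge_elt 1 6" "1"])
      (use r4 in \<open>simp_all add: known mult.assoc ss del: One_nat_def\<close>)
  note known = known e_46
  \<comment> \<open>The swap is defined at the root; naturality along tree edges carries it to the other quivers.\<close>
  have r5: "edge_elt 0 1 * aut_elt 0 ?\<sigma> = aut_elt 1 ?\<sigma> * edge_elt 0 1"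
    by (rule aut_elt_natural[of 0 1 "?\<sigma>" "[ls]" "?\<sigma>" "[ls]" 1 1]; code_simp)
  have A_1: "aut_elt 1 ?\<sigma> = s"
    by (rule mid_unique[of "1" _ "edge_elt 0 1" "edge_elt 0 1 * aut_elt 0 ?\<sigma>"])
      (use r5 in \<open>simp_all add: known mult.assoc ss del: One_nat_def\<close>)
  note known = known A_1
  have r6: "aut_elt 0 ?i * path_val edge_elt [(0, 3), (0, 2)] = 1"
    by (rule involution_in_gamma[of 0 2 "?i" "[(0, 3), (0, 2)]" "?i" "[]"]; code_simp)
  have e_03: "edge_elt 0 3 = ginv a"
    by (rule mid_unique[of "aut_elt 0 ?i" _ "edge_elt 0 2" "1"])
      (use r6 in \<open>simp_all add: known mult.assoc ss del: One_nat_def\<close>)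
  note known = known e_03
  have r7: "edge_elt 0 6 * aut_elt 0 ?\<sigma> = aut_elt 2 ?\<sigma> * edge_elt 0 6"
    by (rule aut_elt_natural[of 0 6 "?\<sigma>" "[ls]" "?\<sigma>" "[ls]" 6 2]; code_simp)
  have A_2: "aut_elt 2 ?\<sigma> = s"
    by (rule mid_unique[of "1" _ "edge_elt 0 6" "edge_elt 0 6 * aut_elt 0 ?\<sigma>"])
      (use r7 in \<open>simp_all add: known mult.assoc ss del: One_nat_def\<close>)
  note known = known A_2
  \<comment> \<open>Vertices 2 and 4 of quiver 1 are exchanged by the swap.\<close>
  have r8: "edge_elt 1 2 * aut_elt 1 ?\<sigma> = aut_elt 3 ?i * edge_elt 1 4"
    by (rule aut_elt_natural[of 1 4 "?\<sigma>" "[ls]" "?i" "[]" 2 3]; code_simp)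
  have e_14: "edge_elt 1 4 = s"
    by (rule mid_unique[of "aut_elt 3 ?i" _ "1" "edge_elt 1 2 * aut_elt 1 ?\<sigma>"])
      (use r8 in \<open>simp_all add: known mult.assoc ss del: One_nat_def\<close>)
  note known = known e_14
  have r9: "edge_elt 1 6 * aut_elt 1 ?\<sigma> = aut_elt 4 ?\<sigma> * edge_elt 1 6"
    by (rule aut_elt_natural[of 1 6 "?\<sigma>" "[ls]" "?\<sigma>" "[ls]" 6 4]; code_simp)
  have A_4: "aut_elt 4 ?\<sigma> = s"
    by (rule mid_unique[of "1" _ "edge_elt 1 6" "edge_elt 1 6 * aut_elt 1 ?\<sigma>"])
      (use r9 in \<open>simp_all add: known mult.assoc ss del: One_nat_def\<close>)
  note known = known A_4
  have r10: "aut_elt 2 ?i * path_val edge_elt [(3, 3), (2, 1)] = 1"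
    by (rule involution_in_gamma[of 2 1 "?i" "[(3, 3), (2, 1)]" "?i" "[]"]; code_simp)
  have e_21: "edge_elt 2 1 = ginv x"
    by (rule mid_unique[of "aut_elt 2 ?i * edge_elt 3 3" _ "1" "1"])
      (use r10 in \<open>simp_all add: known mult.assoc ss del: One_nat_def\<close>)
  note known = known e_21
  have r11: "edge_elt 0 2 * aut_elt 0 ?\<sigma> = aut_elt 0 ?\<sigma> * edge_elt 0 4"
    by (rule aut_elt_natural[of 0 4 "?\<sigma>" "[ls]" "?\<sigma>" "[ls]" 2 0]; code_simp)
  have e_04: "edge_elt 0 4 = s * a * s"
    by (rule mid_unique[of "aut_elt 0 ?\<sigma>" _ "1" "edge_elt 0 2 * aut_elt 0 ?\<sigma>"])
      (use r11 in \<open>simp_all add: known mult.assoc ss del: One_nat_def\<close>)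
  note known = known e_04
  have r12: "aut_elt 0 ?i * path_val edge_elt [(0, 5), (0, 4)] = 1"
    by (rule involution_in_gamma[of 0 4 "?i" "[(0, 5), (0, 4)]" "?i" "[]"]; code_simp)
  have e_05: "edge_elt 0 5 = s * ginv a * s"
    by (rule mid_unique[of "aut_elt 0 ?i" _ "edge_elt 0 4" "1"])
      (use r12 in \<open>simp_all add: known mult.assoc ss del: One_nat_def\<close>)
  note known = known e_05
  have r13: "edge_elt 2 1 * aut_elt 2 ?\<sigma> = aut_elt 3 [5, 6, 3, 4, 1, 2] * edge_elt 2 1"
    by (rule aut_elt_natural[of 2 1 "?\<sigma>" "[ls]" "[5, 6, 3, 4, 1, 2]" "[lx', ls, lx]" 1 3];
        code_simp)
  have A_3_563412: "aut_elt 3 [5, 6, 3, 4, 1, 2] = ginv x * s * x"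
    by (rule mid_unique[of "1" _ "edge_elt 2 1" "edge_elt 2 1 * aut_elt 2 ?\<sigma>"])
      (use r13 in \<open>simp_all add: known mult.assoc ss del: One_nat_def\<close>)
  note known = known A_3_563412
  have r14: "aut_elt 3 [5, 6, 3, 4, 1, 2] * path_val edge_elt [(1, 4), (3, 6)] = 1"
    by (rule involution_in_gamma[of 3 6 "[5, 6, 3, 4, 1, 2]" "[(1, 4), (3, 6)]" "[5, 6, 3, 4, 1, 2]"
        "[lx', ls, lx]"]; code_simp)
  have e_36: "edge_elt 3 6 = s * ginv x * s * x"
    by (rule mid_unique[of "aut_elt 3 [5, 6, 3, 4, 1, 2] * edge_elt 1 4" _ "1" "1"])
      (use r14 in \<open>simp_all add: known mult.assoc ss del: One_nat_def\<close>)
  note known = known e_36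
  \<comment> \<open>The mutations at 2 and 6 commute at the root, so that the tree edge at 6 carries \<open>a\<close> to quiver 2.\<close>
  have r15: "aut_elt 2 ?i * path_val edge_elt [(2, 2), (0, 6)] = path_val edge_elt [(0, 6), (0, 2)]"
    by (rule square_in_gamma[of 0 2 6 2 "[1, 3, 2, 4, 5, 6]" "[(2, 2), (0, 6)]" "?i"
        "[(0, 6), (0, 2)]" "[]"]; code_simp)
  have e_22: "edge_elt 2 2 = a"
    by (rule mid_unique[of "aut_elt 2 ?i" _ "edge_elt 0 6" "edge_elt 0 6 * edge_elt 0 2"])
      (use r15 in \<open>simp_all add: known mult.assoc ss del: One_nat_def\<close>)
  note known = known e_22
  have r16: "aut_elt 2 ?i * path_val edge_elt [(2, 3), (2, 2)] = 1"
    by (rule involution_in_gamma[of 2 2 "?i" "[(2, 3), (2, 2)]" "?i" "[]"]; code_simp)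
  have e_23: "edge_elt 2 3 = ginv a"
    by (rule mid_unique[of "aut_elt 2 ?i" _ "edge_elt 2 2" "1"])
      (use r16 in \<open>simp_all add: known mult.assoc ss del: One_nat_def\<close>)
  note known = known e_23
  have r17: "edge_elt 2 2 * aut_elt 2 ?\<sigma> = aut_elt 2 ?\<sigma> * edge_elt 2 4"
    by (rule aut_elt_natural[of 2 4 "?\<sigma>" "[ls]" "?\<sigma>" "[ls]" 2 2]; code_simp)
  have e_24: "edge_elt 2 4 = s * a * s"
    by (rule mid_unique[of "aut_elt 2 ?\<sigma>" _ "1" "edge_elt 2 2 * aut_elt 2 ?\<sigma>"])
      (use r17 in \<open>simp_all add: known mult.assoc ss del: One_nat_def\<close>)
  note known = known e_24
  have r18: "aut_elt 2 ?i * path_val edge_elt [(2, 5), (2, 4)] = 1"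
    by (rule involution_in_gamma[of 2 4 "?i" "[(2, 5), (2, 4)]" "?i" "[]"]; code_simp)
  have e_25: "edge_elt 2 5 = s * ginv a * s"
    by (rule mid_unique[of "aut_elt 2 ?i" _ "edge_elt 2 4" "1"])
      (use r18 in \<open>simp_all add: known mult.assoc ss del: One_nat_def\<close>)
  note known = known e_25
  \<comment> \<open>From here on the symmetric group of order 6 that acts on quiver 4 appears, generated by
    \<open>s\<close> and its conjugate by \<open>x\<close>.\<close>
  have r19: "aut_elt 1 ?i * path_val edge_elt [(4, 2), (1, 6)] = path_val edge_elt [(3, 6), (1, 2)]"
    by (rule square_in_gamma[of 1 2 6 1 "[3, 6, 5, 2, 1, 4]" "[(4, 2), (1, 6)]" "?i"
        "[(3, 6), (1, 2)]" "[]"]; code_simp)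
  have e_42: "edge_elt 4 2 = s * ginv x * s * x"
    by (rule mid_unique[of "aut_elt 1 ?i" _ "edge_elt 1 6" "edge_elt 3 6 * edge_elt 1 2"])
      (use r19 in \<open>simp_all add: known mult.assoc ss del: One_nat_def\<close>)
  note known = known e_42
  have r20: "edge_elt 4 2 * aut_elt 4 [5, 6, 3, 4, 1, 2] = aut_elt 1 ?\<sigma> * edge_elt 4 6"
    by (rule aut_elt_natural[of 4 6 "[5, 6, 3, 4, 1, 2]" "[lx', ls, lx]" "?\<sigma>" "[ls]" 2 1];
        code_simp)
  have A_4_563412: "aut_elt 4 [5, 6, 3, 4, 1, 2] = ginv x * s * x"
    by (rule mid_unique[of "edge_elt 4 2" _ "1" "aut_elt 1 ?\<sigma> * edge_elt 4 6"])
      (use r20 in \<open>simp_all add: known mult.assoc ss del: One_nat_def\<close>)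
  note known = known A_4_563412
  have r21: "aut_elt 4 [5, 4, 1, 6, 3, 2] * path_val edge_elt [(1, 6), (4, 2)] = 1"
    by (rule involution_in_gamma[of 4 2 "[3, 6, 5, 2, 1, 4]" "[(1, 6), (4, 2)]" "[5, 4, 1, 6, 3, 2]"
        "[lx', ls, lx, ls]"]; code_simp)
  have A_4_541632: "aut_elt 4 [5, 4, 1, 6, 3, 2] = ginv x * s * x * s"
    by (rule mid_unique[of "1" _ "edge_elt 1 6 * edge_elt 4 2" "1"])
      (use r21 in \<open>simp_all add: known mult.assoc ss del: One_nat_def\<close>)
  note known = known A_4_541632
  have r22: "edge_elt 4 6 * aut_elt 4 [3, 6, 5, 2, 1, 4] = aut_elt 1 ?i * edge_elt 4 2"
    by (rule aut_elt_natural[of 4 2 "[3, 6, 5, 2, 1, 4]" "[ls, lx', ls, lx]" "?i" "[]" 6 1]; code_simp)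
  have A_4_365214: "aut_elt 4 [3, 6, 5, 2, 1, 4] = s * ginv x * s * x"
    by (rule mid_unique[of "edge_elt 4 6" _ "1" "aut_elt 1 ?i * edge_elt 4 2"])
      (use r22 in \<open>simp_all add: known mult.assoc ss del: One_nat_def\<close>)
  note known = known A_4_365214
  have r23: "edge_elt 4 2 * aut_elt 4 ?\<sigma> = aut_elt 1 ?i * edge_elt 4 4"
    by (rule aut_elt_natural[of 4 4 "?\<sigma>" "[ls]" "?i" "[]" 2 1]; code_simp)
  have e_44: "edge_elt 4 4 = s * ginv x * s * x * s"
    by (rule mid_unique[of "aut_elt 1 ?i" _ "1" "edge_elt 4 2 * aut_elt 4 ?\<sigma>"])
      (use r23 in \<open>simp_all add: known mult.assoc ss del: One_nat_def\<close>)
  note known = known e_44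
  have r24: "aut_elt 4 [3, 2, 1, 6, 5, 4] * path_val edge_elt [(1, 6), (4, 4)] = 1"
    by (rule involution_in_gamma[of 4 4 "[3, 2, 1, 6, 5, 4]" "[(1, 6), (4, 4)]" "[3, 2, 1, 6, 5, 4]"
        "[ls, lx', ls, lx, ls]"]; code_simp)
  have A_4_321654: "aut_elt 4 [3, 2, 1, 6, 5, 4] = s * ginv x * s * x * s"
    by (rule mid_unique[of "1" _ "edge_elt 1 6 * edge_elt 4 4" "1"])
      (use r24 in \<open>simp_all add: known mult.assoc ss del: One_nat_def\<close>)
  note known = known A_4_321654
  \<comment> \<open>The pentagon at the root on the arrow from 1 to 2 determines the edges between quivers 1 and 3
    that lie outside the tree.\<close>
  have r25: "aut_elt 0 ?i * path_val edge_elt [(0, 3), (1, 1), (3, 1), (1, 2), (0, 1)] = 1"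
    by (rule pentagon_in_gamma[of 0 1 2 "[2, 1, 3, 4, 5, 6]"
        "[(0, 3), (1, 1), (3, 1), (1, 2), (0, 1)]" "?i" "[]"]; code_simp)
  have e_31: "edge_elt 3 1 = a"
    by (rule mid_unique[of "aut_elt 0 ?i * edge_elt 0 3 * edge_elt 1 1" _ "edge_elt 1 2 * edge_elt 0 1" "1"])
      (use r25 in \<open>simp_all add: known mult.assoc ss del: One_nat_def\<close>)
  note known = known e_31
  have r26: "aut_elt 1 ?i * path_val edge_elt [(3, 1), (1, 3)] = 1"
    by (rule involution_in_gamma[of 1 3 "?i" "[(3, 1), (1, 3)]" "?i" "[]"]; code_simp)
  have e_13: "edge_elt 1 3 = ginv a"
    by (rule mid_unique[of "aut_elt 1 ?i * edge_elt 3 1" _ "1" "1"])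
      (use r26 in \<open>simp_all add: known mult.assoc ss del: One_nat_def\<close>)
  note known = known e_13
  have r27: "edge_elt 3 1 * aut_elt 3 [5, 6, 3, 4, 1, 2] = aut_elt 1 ?i * edge_elt 3 5"
    by (rule aut_elt_natural[of 3 5 "[5, 6, 3, 4, 1, 2]" "[lx', ls, lx]" "?i" "[]" 1 1]; code_simp)
  have e_35: "edge_elt 3 5 = a * ginv x * s * x"
    by (rule mid_unique[of "aut_elt 1 ?i" _ "1" "edge_elt 3 1 * aut_elt 3 [5, 6, 3, 4, 1, 2]"])
      (use r27 in \<open>simp_all add: known mult.assoc ss del: One_nat_def\<close>)
  note known = known e_35
  have r28: "aut_elt 1 ?\<sigma> * path_val edge_elt [(3, 5), (1, 5)] = 1"
    by (rule involution_in_gamma[of 1 5 "?\<sigma>" "[(3, 5), (1, 5)]" "?\<sigma>" "[ls]"]; code_simp)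
  have e_15: "edge_elt 1 5 = ginv x * s * x * ginv a * s"
    by (rule mid_unique[of "aut_elt 1 ?\<sigma> * edge_elt 3 5" _ "1" "1"])
      (use r28 in \<open>simp_all add: known mult.assoc ss del: One_nat_def\<close>)
  note known = known e_15
  \<comment> \<open>The pentagon at the root on the arrow from 1 to 6 does the same for quivers 3 and 4.\<close>
  have r29: "aut_elt 0 ?i * path_val edge_elt [(2, 6), (3, 3), (4, 1), (1, 6), (0, 1)] = 1"
    by (rule pentagon_in_gamma[of 0 1 6 "[6, 2, 3, 4, 5, 1]"
        "[(2, 6), (3, 3), (4, 1), (1, 6), (0, 1)]" "?i" "[]"]; code_simp)
  have e_41: "edge_elt 4 1 = ginv x"
    by (rule mid_unique[of "aut_elt 0 ?i * edge_elt 2 6 * edge_elt 3 3" _ "edge_elt 1 6 * edge_elt 0 1" "1"])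
      (use r29 in \<open>simp_all add: known mult.assoc ss del: One_nat_def\<close>)
  note known = known e_41
  have r30: "edge_elt 4 1 * aut_elt 4 [3, 6, 5, 2, 1, 4] = aut_elt 3 ?i * edge_elt 4 5"
    by (rule aut_elt_natural[of 4 5 "[3, 6, 5, 2, 1, 4]" "[ls, lx', ls, lx]" "?i" "[]" 1 3]; code_simp)
  have e_45: "edge_elt 4 5 = ginv x * s * ginv x * s * x"
    by (rule mid_unique[of "aut_elt 3 ?i" _ "1" "edge_elt 4 1 * aut_elt 4 [3, 6, 5, 2, 1, 4]"])
      (use r30 in \<open>simp_all add: known mult.assoc ss del: One_nat_def\<close>)
  note known = known e_45
  have r31: "aut_elt 4 [3, 2, 1, 6, 5, 4] * path_val edge_elt [(3, 4), (4, 1)] = 1"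
    by (rule involution_in_gamma[of 4 1 "[3, 2, 1, 6, 5, 4]" "[(3, 4), (4, 1)]" "[3, 2, 1, 6, 5, 4]"
        "[ls, lx', ls, lx, ls]"]; code_simp)
  have e_34: "edge_elt 3 4 = s * ginv x * s * x * s * x"
    by (rule mid_unique[of "aut_elt 4 [3, 2, 1, 6, 5, 4]" _ "edge_elt 4 1" "1"])
      (use r31 in \<open>simp_all add: known mult.assoc ss del: One_nat_def\<close>)
  note known = known e_34
  have r32: "aut_elt 3 ?i * path_val edge_elt [(4, 3), (3, 4)] = 1"
    by (rule involution_in_gamma[of 3 4 "?i" "[(4, 3), (3, 4)]" "?i" "[]"]; code_simp)
  have e_43: "edge_elt 4 3 = ginv x * s * ginv x * s * x * s"
    by (rule mid_unique[of "aut_elt 3 ?i" _ "edge_elt 3 4" "1"])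
      (use r32 in \<open>simp_all add: known mult.assoc ss del: One_nat_def\<close>)
  note known = known e_43

  \<comment> \<open>With all values known, six of the remaining local relations become the relations between \<open>a\<close>, \<open>x\<close> and \<open>s\<close>.\<close>
  have "aut_elt 1 ?i * path_val edge_elt [(3, 1), (2, 1), (2, 3), (3, 3), (1, 2)] = 1"
    by (rule pentagon_in_gamma[of 1 2 3 "[1, 3, 2, 4, 5, 6]"
        "[(3, 1), (2, 1), (2, 3), (3, 3), (1, 2)]" "?i" "[]"]; code_simp)
  then have ax: "a * ginv x * ginv a * x = 1"
    by (simp add: known mult.assoc ss del: One_nat_def)
  have "aut_elt 0 ?i * path_val edge_elt [(0, 2), (0, 4)] = path_val edge_elt [(0, 4), (0, 2)]"
    by (rule square_in_gamma[of 0 2 4 0 "[1, 3, 2, 5, 4, 6]" "[(0, 2), (0, 4)]" "?i"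
        "[(0, 4), (0, 2)]" "[]"]; code_simp)
  then have aa: "a * s * a * s = s * a * s * a"
    by (simp add: known mult.assoc ss del: One_nat_def)
  have "aut_elt 3 ?i * path_val edge_elt [(4, 1), (3, 4)] = path_val edge_elt [(1, 4), (3, 2)]"
    by (rule square_in_gamma[of 3 2 4 3 "?\<sigma>" "[(4, 1), (3, 4)]" "?i" "[(1, 4), (3, 2)]" "[]"]; code_simp)
  then have xx: "ginv x * s * ginv x * s * x * s * x = s"
    by (simp add: known mult.assoc ss del: One_nat_def)
  have "aut_elt 4 [3, 2, 1, 6, 5, 4] * aut_elt 4 [5, 4, 1, 6, 3, 2] = aut_elt 4 [5, 6, 3, 4, 1, 2]"
    by (rule aut_elt_mult[of 4 "[3, 2, 1, 6, 5, 4]" "[ls, lx', ls, lx, ls]" "[5, 4, 1, 6, 3, 2]"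
        "[lx', ls, lx, ls]" "[5, 6, 3, 4, 1, 2]" "[lx', ls, lx]"]; code_simp)
  then have x3: "s * ginv x * s * x * s * ginv x * s * x * s = ginv x * s * x"
    by (simp add: known mult.assoc ss del: One_nat_def)
  have "aut_elt 1 ?\<sigma> * path_val edge_elt [(3, 5), (4, 3), (1, 6), (3, 5), (1, 2)] = 1"
    by (rule pentagon_in_gamma[of 1 2 5 "[1, 3, 5, 2, 4, 6]"
        "[(3, 5), (4, 3), (1, 6), (3, 5), (1, 2)]" "?\<sigma>" "[ls]"]; code_simp)
  then have axa: "s * a * ginv x * ginv x * s * x * s * a * ginv x * s * x = 1"
    by (simp add: known mult.assoc ss del: One_nat_def)
  have "aut_elt 3 [5, 6, 3, 4, 1, 2] * path_val edge_elt [(1, 5), (3, 5)] = path_val edge_elt [(1, 5), (3, 1)]"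
    by (rule square_in_gamma[of 3 1 5 3 "[5, 2, 4, 3, 1, 6]" "[(1, 5), (3, 5)]" "[5, 6, 3, 4, 1, 2]"
        "[(1, 5), (3, 1)]" "[lx', ls, lx]"]; code_simp)
  then have asa: "ginv a * s * a * ginv x * s * x = ginv x * s * x * ginv a * s * a"
    by (simp add: known mult.assoc ss del: One_nat_def)

  define x' where "x' = s * x * s"
  have sxs: "s * (x * s) = x'" "s * (x * (s * y)) = x' * y" "s * (ginv x * s) = ginv x'"
      "s * (ginv x * (s * y)) = ginv x' * y" for y
    by (simp_all add: x'_def mult.assoc ss)
  have "a * ginv x * (ginv a * x) = ginv x * a * (ginv a * x)" using ax by (simp add: mult.assoc)
  then have "ginv x * a = a * ginv x" by (metis mult_right_cancel_group)
  then have ax': "a * x = x * a" using commute_ginv[of "ginv x" a] by simp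
  have "ginv x * s * ginv x * s * x * s * x * s = s * s" using xx by simp
  then have "ginv (x' * x) * (x * x') = 1" by (simp add: mult.assoc sxs ss)
  then have xx': "x * x' = x' * x" by (metis mult_1_right ginv_right_cancel)
  have "(s * ginv x * s * x * s * ginv x * s * x * s) * (ginv x * s * x) = (ginv x * s * x) * (ginv x * s * x)"
    using x3 by simp
  then have "(ginv x' * x) * (ginv x' * x) * (ginv x' * x) = 1" by (simp add: mult.assoc sxs ss)
  then have x3': "x * x * x = x' * x' * x'" using cube_quotient[OF xx'[symmetric]] by simp
  have axa': "a * x' * a = x' * x'"
  proof -
    have "s * (s * a * ginv x * ginv x * s * x * s * a * ginv x * s * x) * s = s * s" using axa by simp
    then have "a * (ginv x * (ginv x * (x' * (a * (ginv x * x'))))) = 1" by (simp add: mult.assoc sxs ss)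
    then have "(a * x' * a * x') * ginv (x * x * x) = 1"
      by (simp add: mult.assoc commute_rules[OF ax'] commute_rules[OF xx'[symmetric]])
    then have "a * x' * a * x' = x * x * x" by (metis eq_iff_mult_ginv)
    then show ?thesis unfolding x3' by simp
  qed
  show axs: "axs_relations a x s"
    unfolding axs_relations_def Let_def x'_def[symmetric]
    using s2 ax' aa xx' x3' axa' asa by (simp add: mult.assoc)
  interpret axs_group a x s by (unfold_locales) (rule axs)
  assume "t < 5" "j \<in> X6_vertices"
  then have "t \<in> {0, 1, 2, 3, 4}" "j \<in> {1, 2, 3, 4, 5, 6}" by (auto simp: X6_vertices_def)
  then show "edge_elt t j = edge_val t j"
    by (elim insertE emptyE; simp only: edge_val_def edge_word_def)
      (simp_all add: known edge_def mult.assoc ss del: One_nat_def)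
qed

section \<open>The loops of the generators\<close>

text \<open>
  These properties of double arrows, and of the simple arrows next to them, single out quiver 0 among
  the five quivers and leave it only two automorphisms.
\<close>

definition arrow_shape :: "nat \<Rightarrow> nat \<Rightarrow> nat \<Rightarrow> bool" where
  "arrow_shape t i j \<longleftrightarrow>
     (quiver t i j = 2 \<longrightarrow> (t = 0 \<or> t = 2) \<and> (i = 2 \<and> j = 3 \<or> i = 4 \<and> j = 5)) \<and>
     ((t = 0 \<or> t = 2) \<and> (j = 2 \<or> j = 4) \<and> quiver t i j = 1 \<longrightarrow> i = 1) \<and>
     ((t = 0 \<or> t = 2) \<and> i = 1 \<and> quiver t i j = 1 \<longrightarrow> j = 2 \<or> j = 4 \<or> t = 0 \<and> j = 6)"

text \<open>
  The double arrows force \<open>q\<close> to permute the pairs \<open>(2, 3)\<close> and \<open>(4, 5)\<close>, then the vertex 1 is fixed as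
  the source of an arrow to 2, and the vertex 6 as the remaining vertex that receives an arrow
  from 1. In quiver 2 the arrow at 6 points the other way.
\<close>

lemma X6_automorphism:
  assumes "t < 5" "q permutes X6_vertices" "state_matrix t q = X6"
  shows "t = 0 \<and> (q = id \<or> q = perm_of [1, 4, 5, 2, 3, 6])"
proof -
  have "list_all (\<lambda>t. list_all (\<lambda>i. list_all (arrow_shape t i) id6) id6) [0..<5]"
    by code_simp
  then have "arrow_shape t i j" if "i \<in> X6_vertices" "j \<in> X6_vertices" for i j
    using that assms(1) by (simp add: list_all_upt in_vertices_iff)
  note F = this[unfolded arrow_shape_def]
  have V: "n \<in> X6_vertices" if "n \<in> {1, 2, 3, 4, 5, 6}" for n using that by (auto simp: X6_vertices_def)
  have Q: "q n \<in> X6_vertices" if "n \<in> {1, 2, 3, 4, 5, 6}" for n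
    using permutes_in_image[OF assms(2)] V[OF that] by simp
  have mat: "quiver t (q i) (q j) = X6 i j" for i j using assms(3) by (metis state_matrix_def)
  have X: "X6 2 3 = 2" "X6 4 5 = 2" "X6 1 2 = 1" "X6 1 6 = 1" by code_simp+
  have inj: "q i = q j \<longleftrightarrow> i = j" for i j using permutes_inj[OF assms(2)]
      by (simp add: inj_eq)
  have 23: "(t = 0 \<or> t = 2) \<and> (q 2 = 2 \<and> q 3 = 3 \<or> q 2 = 4 \<and> q 3 = 5)"
    using F[OF Q Q, of 2 3] mat[of 2 3] X by simp
  have 45: "q 4 = 2 \<and> q 5 = 3 \<or> q 4 = 4 \<and> q 5 = 5"
    using F[OF Q Q, of 4 5] mat[of 4 5] X by simp
  have 1: "q 1 = 1" using F[OF Q Q, of 1 2] mat[of 1 2] X 23 by auto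
  have "q 6 = 2 \<or> q 6 = 4 \<or> t = 0 \<and> q 6 = 6" using F[OF Q Q, of 1 6] mat[of 1 6] X 23 1 by auto
  moreover have "q 6 \<noteq> q 2" "q 6 \<noteq> q 4" "q 2 \<noteq> q 4" by (simp_all add: inj)
  ultimately have 6: "t = 0" "q 6 = 6"
      and alt: "q 2 = 2 \<and> q 3 = 3 \<and> q 4 = 4 \<and> q 5 = 5 \<or> q 2 = 4 \<and> q 3 = 5 \<and> q 4 = 2 \<and> q 5 = 3"
    using 23 45 by auto
  have out: "q n = n" if "n \<notin> {1, 2, 3, 4, 5, 6}" for n
    using that permutes_not_in[OF assms(2), of n] by (auto simp: X6_vertices_def)
  have S: "perm_of [1, 4, 5, 2, 3, 6] 1 = 1" "perm_of [1, 4, 5, 2, 3, 6] 2 = 4"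
      "perm_of [1, 4, 5, 2, 3, 6] 3 = 5"
    "perm_of [1, 4, 5, 2, 3, 6] 4 = 2" "perm_of [1, 4, 5, 2, 3, 6] 5 = 3"
        "perm_of [1, 4, 5, 2, 3, 6] 6 = 6" by code_simp+
  have Sout: "perm_of [1, 4, 5, 2, 3, 6] n = n" if "n \<notin> {1, 2, 3, 4, 5, 6}" for n
    using that perm_of_outside[of n] by (auto simp: X6_vertices_def)
  have "q = id" if "q 2 = 2 \<and> q 3 = 3 \<and> q 4 = 4 \<and> q 5 = 5"
  proof
    fix n show "q n = id n" using that out[of n] 1 6 by (cases "n \<in> {1, 2, 3, 4, 5, 6}") auto
  qed
  moreover have "q = perm_of [1, 4, 5, 2, 3, 6]" if "q 2 = 4 \<and> q 3 = 5 \<and> q 4 = 2 \<and> q 5 = 3"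
  proof
    fix n show "q n = perm_of [1, 4, 5, 2, 3, 6] n"
      using that out[of n] Sout[of n] 1 6 S by (cases "n \<in> {1, 2, 3, 4, 5, 6}") auto
  qed
  ultimately show ?thesis using alt 6(1) by blast
qed

lemma perm_lists:
  "cycle_of_list [2, 3] = perm_of [1, 3, 2, 4, 5, 6]"
  "cycle_of_list [1, 5, 2, 6, 3, 4] = perm_of [5, 6, 4, 1, 2, 3]"
  "cycle_of_list [2, 4] \<circ> cycle_of_list [3, 5] = perm_of [1, 4, 5, 2, 3, 6]"
proof -
  have cases: "f = perm_of ps"
    if "\<And>n. n \<notin> {1, 2, 3, 4, 5, 6} \<Longrightarrow> f n = n"
        "map f [1, 2, 3, 4, 5, 6] = ps" for f ps
  proof
    fix n show "f n = perm_of ps n"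
    proof (cases "n \<in> {1, 2, 3, 4, 5, 6}")
      case True
      then show ?thesis using that(2) by (auto simp: perm_of_def)
    next
      case False
      then have "perm_of ps n = n" by (intro perm_of_outside) (auto simp: X6_vertices_def)
      with that(1)[OF False] show ?thesis by simp
    qed
  qed
  show "cycle_of_list [2, 3] = perm_of [1, 3, 2, 4, 5, 6]"
      "cycle_of_list [1, 5, 2, 6, 3, 4] = perm_of [5, 6, 4, 1, 2, 3]"
    "cycle_of_list [2, 4] \<circ> cycle_of_list [3, 5] = perm_of [1, 4, 5, 2, 3, 6]"
    by (rule cases; simp add: transpose_def)+
qed

lemma sigma_inv_seq_eq: "sigma_inv_seq = inv_seq sigma_seq"
  by (simp add: sigma_inv_seq_def sigma_seq_def)

context axs_group
begin

text \<open>
  Transport along \<open>inv_seq w\<close> undoes transport along \<open>w\<close>, and multiplication on the right is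
  compatible with transport.
\<close>

lemma represents_inv:
  assumes "represents w g" shows "represents (inv_seq w) (ginv g)"
proof -
  have loop: "w \<in> mutation_loops X6_vertices X6" and w: "w \<in> mutation_seqs X6_vertices"
    using assms by (auto simp: represents_def mutation_loops_def)
  obtain t q h where st: "transport edge_val w (0, id, 1) = (t, q, h)" by (metis prod_cases3)
  have valid: "valid_state (t, q, h)" using transport_valid_start[OF w st] by blast
  then have "t < 5" by (simp add: valid_state_def)
  obtain t1 q1 h1 where st1: "transport edge_val (inv_seq w) (t, q, h) = (t1, q1, h1)" by (metis prod_cases3)
  have "t1 < 5" using transport_valid[OF valid _ st1] w by (simp add: valid_state_def)
  obtain t2 q2 h2 where st2: "transport edge_val (inv_seq w) (0, id, 1) = (t2, q2, h2)" by (metis prod_cases3)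
  then have st3: "transport edge_val (inv_seq w) (0, id, g) = (t2, q2, h2 * g)"
    using transport_mult_right[of edge_val "inv_seq w" 0 id 1 t2 q2 h2 g] by simp
  have "seq_eq X6_vertices X6 (inv_seq w @ w) []" using seq_eq_inv_seq[of w X6_vertices "[]"] w by simp
  from same_state_seq_eq[OF this] have 1: "(t1, q1, h1) \<approx> (0, id, 1)" using w st st1 by simp
  have "(t, q, h) \<approx> (0, id, g)" using assms st by (simp add: represents_def)
  from same_state_transport[OF this valid, of "inv_seq w"] have "(t1, q1, h1) \<approx> (t2, q2, h2 * g)"
    using w st1 st3 by simp
  from same_state_sym[OF this \<open>t1 < 5\<close>] have 2: "(t2, q2, h2 * g) \<approx> (t1, q1, h1)" .
  have "t2 = t1" using 2 by (simp add: same_state_def)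
  then have "(t2, q2, h2 * g) \<approx> (0, id, 1)" using same_state_trans[OF 2 1] \<open>t1 < 5\<close> by simp
  from same_state_mult_right[OF this, of id "ginv g"] have "(t2, q2, h2) \<approx> (0, id, ginv g)"
    by (simp add: mult.assoc)
  then show ?thesis using st2 inv_seq_loop[OF loop] by (simp add: represents_def)
qed

lemma represents_by_check:
  assumes "agree (lrun ks (0, id6, [])) [] (0, c, []) w" "is_perm6 c"
      "list_all (\<lambda>k. 1 \<le> k \<and> k < 7) ks"
    and "lrun ks (0, id6, []) = (0, qs, es)" "List.member (auts 0) (ps, v)" "map (perm_of ps) qs = c"
  shows "represents (Perm (perm_of c) # map Mut ks) (val w)"
proof (rule represents_perm_mut[OF assms(1) perm_of_permutes[OF assms(2)]])
  show sub: "set ks \<subseteq> X6_vertices" using assms(3) by (auto simp: list_all_iff in_vertices_iff)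
  then have seq: "map Mut ks \<in> mutation_seqs X6_vertices" by (induction ks) auto
  have st: "transport edge_val (map Mut ks) (0, id, 1) = (0, perm_of qs, path_val edge_val es)"
      and len: "length qs = 6"
    using transport_lrun[OF assms(4), of edge_val 1] by simp_all
  have "perm_of c = perm_of ps \<circ> perm_of qs" using perm_of_map[OF len, of ps] assms(6) by simp
  then have "state_matrix 0 (perm_of c) = (\<lambda>i j. state_matrix 0 (perm_of ps) (perm_of qs i) (perm_of qs j))"
    by (simp add: state_matrix_def)
  also have "\<dots> = state_matrix 0 (perm_of qs)"
    using aut_facts(3)[of 0 ps v] assms(5) by (simp add: state_matrix_def)
  finally have "apply_seq (map Mut ks) X6 = state_matrix 0 (perm_of c)"
    using transport_valid_start[OF seq st] by simp
  then show "apply_seq (Perm (perm_of c) # map Mut ks) X6 = X6"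
    using permute_state_matrix[OF perm_of_permutes[OF assms(2)]] by (simp add: X6_quiver)
qed

lemma represents_sigma: "represents sigma_seq s"
proof -
  have "represents (Perm (perm_of [1, 4, 5, 2, 3, 6]) # map Mut []) (val [(Elt_s, True)])"
    by (rule represents_by_check[where qs = "[1, 2, 3, 4, 5, 6]" and es = "[]"
        and ps = "[1, 4, 5, 2, 3, 6]" and v = "[(Elt_s, True)]"]; code_simp)
  then show ?thesis unfolding sigma_seq_def perm_lists by (simp add: mult.assoc)
qed

lemma represents_alpha1: "represents alpha1_seq a"
proof -
  have "represents (Perm (perm_of [1, 3, 2, 4, 5, 6]) # map Mut [2]) (val [(Elt_a, True)])"
    by (rule represents_by_check[where qs = "[1, 3, 2, 4, 5, 6]" and es = "[(0, 2)]"
        and ps = "[1, 2, 3, 4, 5, 6]" and v = "[]"]; code_simp)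
  then show ?thesis unfolding alpha1_seq_def perm_lists by (simp add: mult.assoc)
qed

lemma represents_beta1: "represents beta1_seq (s * x * ginv a)"
proof -
  have "represents (Perm (perm_of [5, 6, 4, 1, 2, 3]) # map Mut [4, 2, 4, 3, 1])
    (val [(Elt_s, True), (Elt_x, True), (Elt_a, False)])"
    by (rule represents_by_check[where qs = "[3, 6, 2, 1, 4, 5]"
        and es = "[(1, 1), (4, 4), (3, 4), (1, 3), (0, 1)]"
        and ps = "[1, 4, 5, 2, 3, 6]" and v = "[(Elt_s, True)]"]; code_simp)
  then show ?thesis unfolding beta1_seq_def perm_lists by (simp add: mult.assoc)
qed

primrec gen_val :: "X6_gen \<Rightarrow> 'g" where
  "gen_val Gen_alpha1 = a" | "gen_val Gen_alpha2 = s * a * s" | "gen_val Gen_beta1 = s * x * ginv a"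
| "gen_val Gen_beta2 = x * ginv a * s" | "gen_val Gen_sigma = s"

lemma represents_gen: "represents (X6_gen_seq y) (gen_val y)"
proof (cases y)
  case Gen_alpha2
  have "represents (sigma_seq @ alpha1_seq @ inv_seq sigma_seq) (s * (a * ginv s))"
    by (intro represents_append represents_inv represents_sigma represents_alpha1)
  then show ?thesis using Gen_alpha2 by (simp add: alpha2_seq_def sigma_inv_seq_eq mult.assoc)
next
  case Gen_beta2
  have "represents (sigma_seq @ beta1_seq @ inv_seq sigma_seq) (s * (s * x * ginv a * ginv s))"
    by (intro represents_append represents_inv represents_sigma represents_beta1)
  then show ?thesis using Gen_beta2 by (simp add: beta2_seq_def sigma_inv_seq_eq mult.assoc ss)
qed (simp_all add: represents_sigma represents_alpha1 represents_beta1)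

end

lemma transport_cong:
  assumes "\<And>t j. t < 5 \<Longrightarrow> j \<in> X6_vertices \<Longrightarrow> E t j = E' t j"
    and "valid_state (t, q, g)" "w \<in> mutation_seqs X6_vertices"
  shows "transport E w (t, q, g) = transport E' w (t, q, g)"
  using assms(3)
proof (induction w)
  case (Cons l w)
  obtain t1 q1 g1 where st: "transport E w (t, q, g) = (t1, q1, g1)" by (metis prod_cases3)
  then have "t1 < 5" "q1 permutes X6_vertices"
    using transport_valid[OF assms(2) _ st] Cons.prems by (auto simp: valid_state_def)
  then have "transport_step E l (t1, q1, g1) = transport_step E' l (t1, q1, g1)"
    using assms(1)[of t1] permutes_in_image[of q1 X6_vertices] Cons.prems by (cases l) auto
  with Cons st show ?case by simp
qed simp

context axs_group
begin

lemma transport_val: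
  assumes "transport edge_val w (t0, q0, 1) = (t, q, g)" shows "\<exists>v. g = val v"
  using assms
proof (induction w arbitrary: t q g)
  case Nil
  then have "g = val []" by simp
  then show ?case by blast
next
  case (Cons l w)
  obtain t1 q1 g1 where st: "transport edge_val w (t0, q0, 1) = (t1, q1, g1)" by (metis prod_cases3)
  with Cons.IH obtain v where v: "g1 = val v" by blast
  show ?case
  proof (cases l)
    case (Mut k)
    then have "g = edge_val t1 (q1 k) * g1" using Cons.prems st by simp
    then have "g = val (edge_word t1 (q1 k) @ v)" by (simp add: edge_val_def v)
    then show ?thesis by blast
  next
    case (Perm \<tau>)
    then show ?thesis using Cons.prems st v by auto
  qed
qed

text \<open>
  A loop ends over quiver 0 with one of the two automorphisms as its renaming; the swap contributes the
  factor \<open>s\<close>.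
\<close>

lemma represents_total:
  assumes "w \<in> mutation_loops X6_vertices X6" shows "\<exists>v. represents w (val v)"
proof -
  have w: "w \<in> mutation_seqs X6_vertices" "apply_seq w X6 = X6" using assms
      by (auto simp: mutation_loops_def)
  obtain t q g where st: "transport edge_val w (0, id, 1) = (t, q, g)" by (metis prod_cases3)
  obtain v where v: "g = val v" using transport_val[OF st] by blast
  have "t < 5" "q permutes X6_vertices" "state_matrix t q = X6"
    using transport_valid_start[OF w(1) st] w(2) by (auto simp: valid_state_def)
  then have t: "t = 0" and q: "q = id \<or> q = perm_of [1, 4, 5, 2, 3, 6]" using X6_automorphism by blast+
  from q show ?thesis
  proof
    assume "q = id"
    then have "represents w (val v)"
      using same_state_refl[of 0 id g] st t v assms by (simp add: represents_def)
    then show ?thesis by blast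
  next
    assume q: "q = perm_of [1, 4, 5, 2, 3, 6]"
    have "agree (0, [1, 4, 5, 2, 3, 6], []) [] (0, id6, []) [(Elt_s, True)]" by code_simp
    from agree_same_state[OF this] have "(0, q, 1) \<approx> (0, id, s)" by (simp add: q)
    from same_state_mult_right[OF this, of id g] have "(0, q, g) \<approx> (0, id, val ((Elt_s, True) # v))"
      by (simp add: v)
    then have "represents w (val ((Elt_s, True) # v))"
      using st t assms by (simp add: represents_def)
    then show ?thesis by blast
  qed
qed

lemma val_in_gen_vals: "\<exists>u. val v = gval gen_val u"
proof (induction v)
  case Nil
  have "val [] = gval gen_val []" by simp
  then show ?case by blast
next
  case (Cons l v)
  then obtain u where u: "val v = gval gen_val u" by blast
  obtain y b where l: "l = (y, b)" by force
  have "\<exists>u'. gen y = gval gen_val u'"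
  proof (cases y)
    case Elt_a
    then have "gen y = gval gen_val (gw Gen_alpha1)" by simp
    then show ?thesis by blast
  next
    case Elt_x
    then have "gen y = gval gen_val (gw Gen_sigma @ gw Gen_beta1 @ gw Gen_alpha1)"
      by (simp add: mult.assoc ss)
    then show ?thesis by blast
  next
    case Elt_s
    then have "gen y = gval gen_val (gw Gen_sigma)" by simp
    then show ?thesis by blast
  qed
  then obtain u' where u': "gen y = gval gen_val u'" by blast
  have "val (l # v) = gval gen_val ((if b then u' else gw_inv u') @ u)"
    by (simp add: l u u')
  then show ?case by blast
qed

end

section \<open>Generators and relations in the cluster modular group\<close>

definition gamma_a :: gamma_X6 where "gamma_a = edge_elt 0 2"
definition gamma_x :: gamma_X6 where "gamma_x = edge_elt 3 3"
definition gamma_s :: gamma_X6 where "gamma_s = aut_elt 0 [1, 4, 5, 2, 3, 6]"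

interpretation G: axs_group gamma_a gamma_x gamma_s
  by unfold_locales (simp add: edge_values(1) gamma_a_def gamma_x_def gamma_s_def del: One_nat_def)

text \<open>
  In the cluster modular group the words of the edges are the classes of the edges, so that the value
  of a loop is its own class.
\<close>

lemma loop_class_represented:
  assumes "G.represents w g" shows "loop_class w = g"
proof -
  have w: "w \<in> loops" "w \<in> seqs" and mat: "apply_seq w X6 = X6"
    using assms by (auto simp: G.represents_def mutation_loops_def)
  obtain t q h where st: "transport edge_elt w (0, id, 1) = (t, q, h)" by (metis prod_cases3)
  have "transport G.edge_val w (0, id, 1) = (t, q, h)"
    using transport_cong[of edge_elt G.edge_val 0 id 1 w] edge_values(2) w(2) st
    by (simp add: gamma_a_def gamma_x_def gamma_s_def valid_state_def permutes_id del: One_nat_def)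
  with assms obtain \<gamma> where t: "t = 0" and \<gamma>: "\<gamma> \<in> set (auts 0)"
      "id = perm_of (fst \<gamma>) \<circ> q" "g = G.val (snd \<gamma>) * h"
    by (fastforce simp: G.represents_def G.same_state_def)
  have aut_elt: "aut_elt 0 (fst \<gamma>) = G.val (snd \<gamma>)"
    using \<gamma>(1) aut_elt_id[of 0] by (auto simp: auts_def gamma_s_def[symmetric] simp del: One_nat_def)
  have "close_up 0 id w \<simeq> w"
    using seq_eq_basic[of "[]" X6_vertices w X6, OF _ _ basic_relation.perm_id] w
        by (simp add: close_up_def base_def base_path_def)
  then have "aut_elt 0 (fst \<gamma>) * loop_class (close_up 0 q w) = loop_class w"
    using \<gamma> transport_start[OF w(2) st] w t
    by (intro loop_class_close_aut[of 0 "fst \<gamma>" "snd \<gamma>"]) (auto simp: mat)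
  then show ?thesis using transport_edge_elt[OF w(2) st] \<gamma>(3) aut_elt t by simp
qed

lemma loop_class_gens: "loop_class (X6_gen_seq y) = G.gen_val y"
  by (rule loop_class_represented) (rule G.represents_gen)

abbreviation eval_gens :: "X6_gen gword \<Rightarrow> gamma_X6" where
  "eval_gens \<equiv> gval (\<lambda>y. loop_class (X6_gen_seq y))"

lemma eval_gens_surj: "\<exists>u. g = eval_gens u"
proof -
  obtain w where w: "w \<in> loops" "g = loop_class w" using loop_class_surj by blast
  obtain v where "G.represents w (G.val v)" using G.represents_total[OF w(1)] by blast
  then have "g = G.val v" using loop_class_represented w by simp
  moreover obtain u where "G.val v = gval G.gen_val u" using G.val_in_gen_vals by blast
  ultimately show ?thesis by (auto simp: loop_class_gens)
qed

lemma X6_relations_hold_iff: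
  "X6_relations_hold (f Gen_alpha1) (f Gen_alpha2) (f Gen_beta1) (f Gen_beta2) (f Gen_sigma) \<longleftrightarrow>
    (\<forall>(l, r) \<in> X6_relations. gval f l = gval f r)"
  by (simp add: X6_relations_hold_def X6_relations_def Let_def gw_Ad_def numeral_2_eq_2 numeral_3_eq_3 mult.assoc)

lemma eval_gens_relations:
  assumes "(l, r) \<in> X6_relations" shows "eval_gens l = eval_gens r"
proof -
  have "\<forall>(l, r) \<in> X6_relations. gval G.gen_val l = gval G.gen_val r"
    using X6_relations_if_axs_relations[OF G.axs] X6_relations_hold_iff[of G.gen_val] by simp
  then show ?thesis using assms by (auto simp: loop_class_gens)
qed


section \<open>The presented group as a type\<close>

typedef pres_X6 = "carrier (presented_group X6_relations)"
  using monoid.one_closed[OF group.is_monoid[OF presented_group_group]] by blast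

interpretation Pres: group "presented_group X6_relations" by (rule presented_group_group)

instantiation pres_X6 :: mult_group
begin

definition "one_pres_X6 = Abs_pres_X6 \<one>\<^bsub>presented_group X6_relations\<^esub>"
definition "times_pres_X6 x y = Abs_pres_X6 (Rep_pres_X6 x \<otimes>\<^bsub>presented_group X6_relations\<^esub> Rep_pres_X6 y)"
definition "ginv_pres_X6 x = Abs_pres_X6 (inv\<^bsub>presented_group X6_relations\<^esub> Rep_pres_X6 x)"

lemma Rep_pres_X6_simps:
  "Rep_pres_X6 1 = \<one>\<^bsub>presented_group X6_relations\<^esub>"
  "Rep_pres_X6 (x * y) = Rep_pres_X6 x \<otimes>\<^bsub>presented_group X6_relations\<^esub> Rep_pres_X6 y"
  "Rep_pres_X6 (ginv x) = inv\<^bsub>presented_group X6_relations\<^esub> Rep_pres_X6 x"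
  using Rep_pres_X6 by (simp_all add: one_pres_X6_def times_pres_X6_def ginv_pres_X6_def Abs_pres_X6_inverse)

instance
  by standard (simp_all add: Rep_pres_X6_simps Pres.m_assoc Rep_pres_X6 flip: Rep_pres_X6_inject)

end

definition pres_class :: "X6_gen gword \<Rightarrow> pres_X6" where
  "pres_class w = Abs_pres_X6 (pres_equiv X6_relations `` {w})"

lemma Rep_pres_class: "Rep_pres_X6 (pres_class w) = pres_equiv X6_relations `` {w}"
  unfolding pres_class_def
      by (rule Abs_pres_X6_inverse) (simp add: presented_group_def word_quotient_def quotientI)

lemma pres_class_append: "pres_class (u @ v) = pres_class u * pres_class v"
  by (simp add: Rep_pres_class Rep_pres_X6_simps presented_group_mult flip: Rep_pres_X6_inject)

lemma pres_class_eq_iff: "pres_class u = pres_class v \<longleftrightarrow> (u, v) \<in> pres_equiv X6_relations"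
  using eq_equiv_class_iff[OF equiv_pres_equiv] by (simp add: Rep_pres_class flip: Rep_pres_X6_inject)

lemma pres_class_nil: "pres_class [] = 1"
  by (simp add: one_pres_X6_def pres_class_def presented_group_def word_quotient_def)

lemma pres_class_surj: "\<exists>w. p = pres_class w"
proof -
  have "Rep_pres_X6 p \<in> UNIV // pres_equiv X6_relations"
    using Rep_pres_X6[of p] by (simp add: presented_group_def word_quotient_def)
  then obtain w where "Rep_pres_X6 p = pres_equiv X6_relations `` {w}" by (rule quotientE)
  then have "p = pres_class w" by (simp add: Rep_pres_class flip: Rep_pres_X6_inject)
  then show ?thesis ..
qed

lemma pres_class_gval: "pres_class w = gval (\<lambda>y. pres_class (gw y)) w"
proof (induction w)
  case (Cons l w)
  obtain y b where l: "l = (y, b)" by force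
  have "pres_class [(y, True)] * pres_class [(y, False)] = 1"
    using pres_step.cancel[of X6_relations "[]" y True "[]"]
    by (auto simp: pres_class_eq_iff pres_equiv_def simp flip: pres_class_append pres_class_nil)
  then have "pres_class [(y, False)] = ginv (pres_class (gw y))" using ginv_unique by (metis gw_def)
  then have "pres_class [l] = gletter (\<lambda>y. pres_class (gw y)) l" by (simp add: l gw_def)
  then show ?case using Cons pres_class_append[of "[l]" w] by simp
qed (simp add: pres_class_nil)

lemma pres_class_relations_hold:
  "X6_relations_hold (pres_class (gw Gen_alpha1)) (pres_class (gw Gen_alpha2)) (pres_class (gw Gen_beta1)) (pres_class (gw Gen_beta2)) (pres_class (gw Gen_sigma))"
proof -
  have "pres_class l = pres_class r" if "(l, r) \<in> X6_relations" for l r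
    using pres_step.relation[OF that, of "[]" "[]"] by (auto simp: pres_class_eq_iff pres_equiv_def)
  then show ?thesis
    using X6_relations_hold_iff[of "\<lambda>y. pres_class (gw y)"] by (auto simp flip: pres_class_gval)
qed

abbreviation "pres_a \<equiv> pres_class (gw Gen_alpha1)"
definition pres_x :: pres_X6
    where "pres_x = pres_class (gw Gen_sigma) * pres_class (gw Gen_beta1) * pres_class (gw Gen_alpha1)"
abbreviation "pres_s \<equiv> pres_class (gw Gen_sigma)"

interpretation P: axs_group pres_a pres_x pres_s
  by unfold_locales (unfold pres_x_def, rule axs_relations_if_X6_relations[OF pres_class_relations_hold])

lemma pres_class_gens: "P.gen_val y = pres_class (gw y)"
proof -
  have "pres_class (gw Gen_alpha2) = pres_s * pres_a * ginv pres_s"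
      "pres_class (gw Gen_beta2) = pres_s * pres_class (gw Gen_beta1) * ginv pres_s"
    using pres_class_relations_hold unfolding X6_relations_hold_def by blast+
  moreover have "pres_x * ginv pres_a = pres_s * pres_class (gw Gen_beta1)"
      "pres_x * (ginv pres_a * pres_s) = pres_s * (pres_class (gw Gen_beta1) * pres_s)"
    by (simp_all add: pres_x_def mult.assoc)
  ultimately show ?thesis by (cases y) (simp_all add: mult.assoc P.ss)
qed

definition seq_of :: "X6_gen gword \<Rightarrow> nat letter list" where
  "seq_of w = concat (map (\<lambda>(y, b). if b then X6_gen_seq y else inv_seq (X6_gen_seq y)) w)"

lemma seq_of_simps: "seq_of [] = []" "seq_of (l # w) = seq_of [l] @ seq_of w"
  by (simp_all add: seq_of_def)

text \<open>
  A word in the five generators is realised by a loop that has the expected value in both groups.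
\<close>

lemma represents_seq_of:
  "P.represents (seq_of w) (pres_class w)" "G.represents (seq_of w) (eval_gens w)"
proof (induction w)
  case Nil
  case 1 show ?case using P.represents_nil by (simp add: seq_of_simps pres_class_nil)
  case 2 show ?case using G.represents_nil by (simp add: seq_of_simps)
next
  case (Cons l w)
  obtain y b where l: "l = (y, b)" by force
  have "P.represents (seq_of [l]) (gletter P.gen_val l)" "G.represents (seq_of [l]) (gletter G.gen_val l)"
    using P.represents_gen[of y] P.represents_inv[OF P.represents_gen[of y]]
      G.represents_gen[of y] G.represents_inv[OF G.represents_gen[of y]] by (simp_all add: l seq_of_def)
  moreover case 1
  moreover case 2
  ultimately show "P.represents (seq_of (l # w)) (pres_class (l # w))"
      "G.represents (seq_of (l # w)) (eval_gens (l # w))"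
    using P.represents_append[of "seq_of [l]" "gletter P.gen_val l" "seq_of w" "pres_class w"]
      G.represents_append[of "seq_of [l]" "gletter G.gen_val l" "seq_of w" "eval_gens w"] Cons
      pres_class_gval[of "l # w"] pres_class_gval[of w] seq_of_simps(2)[of l w]
    by (cases b; simp_all add: pres_class_gens loop_class_gens l)+
qed

text \<open>
  A word that is trivial in the cluster modular group is realised by a contractible loop, and
  the value of a contractible loop in the presented group is trivial.
\<close>

lemma eval_gens_eq_one:
  assumes "eval_gens w = 1" shows "pres_class w = 1"
proof -
  have "loop_class (seq_of w) = loop_class []" using loop_class_represented[OF represents_seq_of(2)] assms
      by (simp add: loop_class_nil)
  moreover have "seq_of w \<in> loops" using represents_seq_of(1) by (simp add: P.represents_def)
  ultimately have "seq_of w \<simeq> []" using loop_class_eq_iff mutation_loops_simps(1) by blast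
  then show ?thesis using P.represents_unique[OF represents_seq_of(1) P.represents_nil] by simp
qed

lemma eval_gens_eq_iff: "eval_gens u = eval_gens v \<longleftrightarrow> pres_class u = pres_class v"
proof
  assume "pres_class u = pres_class v"
  then show "eval_gens u = eval_gens v"
    unfolding pres_class_eq_iff by (rule gval_pres_equiv[rotated]) (rule eval_gens_relations)
next
  assume "eval_gens u = eval_gens v"
  then have "eval_gens (u @ gw_inv v) = 1" by simp
  then have "pres_class (u @ gw_inv v) = 1" by (rule eval_gens_eq_one)
  then show "pres_class u = pres_class v"
      by (simp add: pres_class_gval[of "u @ gw_inv v"] pres_class_gval[of u] pres_class_gval[of v] eq_iff_mult_ginv[of "gval _ u"])
qed

lemma X6_elem_loop_class: "X6_elem y = Rep_gamma_X6 (loop_class (X6_gen_seq y))"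
  using G.represents_gen[of y] by (simp add: X6_elem_def Rep_loop_class G.represents_def)

theorem theorem1p2:
  shows "carrier Gamma_X6 =
           generate Gamma_X6
             {X6_elem Gen_alpha1, X6_elem Gen_alpha2, X6_elem Gen_beta1, X6_elem Gen_beta2, X6_elem Gen_sigma}
       \<and> has_presentation Gamma_X6 X6_elem X6_relations"
proof
  let ?S = "{X6_elem Gen_alpha1, X6_elem Gen_alpha2, X6_elem Gen_beta1, X6_elem Gen_beta2, X6_elem Gen_sigma}"
  have S: "X6_elem y \<in> ?S" for y by (cases y) simp_all
  have "Rep_gamma_X6 (eval_gens w) \<in> generate Gamma_X6 ?S" for w
  proof (induction w)
    case Nil
    show ?case by (simp add: Rep_gamma_X6_simps generate.one)
  next
    case (Cons l w)
    obtain y b where "l = (y, b)" by force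
    then have "Rep_gamma_X6 (gletter (\<lambda>y. loop_class (X6_gen_seq y)) l) \<in> generate Gamma_X6 ?S"
      using generate.incl[OF S[of y], of Gamma_X6] generate.inv[OF S[of y], of Gamma_X6]
      by (simp add: Rep_gamma_X6_simps X6_elem_loop_class)
    with Cons show ?case by (simp add: Rep_gamma_X6_simps generate.eng)
  qed
  then have "x \<in> generate Gamma_X6 ?S" if "x \<in> carrier Gamma_X6" for x
    using eval_gens_surj that Abs_gamma_X6_inverse by metis
  moreover have "?S \<subseteq> carrier Gamma_X6" using Rep_gamma_X6 by (simp add: X6_elem_loop_class)
  ultimately show "carrier Gamma_X6 = generate Gamma_X6 ?S"
    using Gamma.generate_incl by blast
next
  \<comment> \<open>The isomorphism evaluates a representative of the class; by \<open>eval_gens_eq_iff\<close> the choice does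
    not matter, and different classes have different values.\<close>
  define f :: "X6_gen gword set \<Rightarrow> nat letter list set" where
    "f C = Rep_gamma_X6 (eval_gens (SOME w. Abs_pres_X6 C = pres_class w))" for C
  have f: "f (Rep_pres_X6 (pres_class w)) = Rep_gamma_X6 (eval_gens w)" for w
  proof -
    have "pres_class w = pres_class (SOME v. pres_class w = pres_class v)" by (rule someI) (rule refl)
    then have "eval_gens (SOME v. pres_class w = pres_class v) = eval_gens w" using eval_gens_eq_iff by metis
    then show ?thesis by (simp add: f_def Rep_pres_X6_inverse)
  qed
  have carr: "\<exists>w. C = Rep_pres_X6 (pres_class w)" if "C \<in> carrier (presented_group X6_relations)" for C
    using that pres_class_surj Abs_pres_X6_inverse by metis
  have "f \<in> iso (presented_group X6_relations) Gamma_X6"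
  proof (rule isoI)
    show "f \<in> hom (presented_group X6_relations) Gamma_X6"
    proof (rule homI)
      fix C assume "C \<in> carrier (presented_group X6_relations)"
      then obtain u where C: "C = Rep_pres_X6 (pres_class u)" using carr by blast
      then show "f C \<in> carrier Gamma_X6" using f Rep_gamma_X6 by simp
      fix D assume "D \<in> carrier (presented_group X6_relations)"
      then obtain v where D: "D = Rep_pres_X6 (pres_class v)" using carr by blast
      show "f (C \<otimes>\<^bsub>presented_group X6_relations\<^esub> D) = f C \<otimes>\<^bsub>Gamma_X6\<^esub> f D"
        using f[of "u @ v"] by (simp add: C D f pres_class_append Rep_pres_X6_simps Rep_gamma_X6_simps)
    qed
    show "bij_betw f (carrier (presented_group X6_relations)) (carrier Gamma_X6)"
    proof (rule bij_betw_imageI)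
      show "inj_on f (carrier (presented_group X6_relations))"
      proof (rule inj_onI)
        fix C D assume "C \<in> carrier (presented_group X6_relations)"
            "D \<in> carrier (presented_group X6_relations)" "f C = f D"
        moreover from this obtain u v where CD: "C = Rep_pres_X6 (pres_class u)"
            "D = Rep_pres_X6 (pres_class v)" using carr by metis
        ultimately have "eval_gens u = eval_gens v" by (simp add: f Rep_gamma_X6_inject)
        then show "C = D" by (simp add: CD eval_gens_eq_iff)
      qed
      show "f ` carrier (presented_group X6_relations) = carrier Gamma_X6"
      proof (intro equalityI subsetI)
        fix x assume "x \<in> f ` carrier (presented_group X6_relations)"
        then show "x \<in> carrier Gamma_X6" using carr f Rep_gamma_X6 by fastforce
      next
        fix x assume "x \<in> carrier Gamma_X6"
        then obtain u where "x = Rep_gamma_X6 (eval_gens u)" using eval_gens_surj Abs_gamma_X6_inverse by metis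
        then have "x = f (Rep_pres_X6 (pres_class u))" by (simp add: f)
        then show "x \<in> f ` carrier (presented_group X6_relations)" using Rep_pres_X6 by blast
      qed
    qed
  qed
  moreover have "f (pres_equiv X6_relations `` {gw y}) = X6_elem y" for y
    using f[of "gw y"] by (simp add: Rep_pres_class X6_elem_loop_class)
  ultimately show "has_presentation Gamma_X6 X6_elem X6_relations"
    unfolding has_presentation_def using saturated_cmg_group by blast
qed

end
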